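(* Let $K\ge 1$ be an integer, let $0\le\mu<\frac{1}{2K-1}$, put $\delta=\frac{(K-1)\mu^2}{1-(K-2)\mu}$, and let $\epsilon$ satisfy $\frac{\sqrt{\mu+\delta}}{1+\sqrt{\mu+\delta}}<\epsilon<1$. Then there is $d_0=d_0(K,\mu,\epsilon)$ such that for every $d\ge d_0$ the following holds for every instance of the distributed sparse regression model (see context) of dimension $d$ and sparsity $K$ whose maximal coherence is $\mu_{\max}=\mu$ (so that the max-MIP condition $\mu_{\max}<\frac1{2K-1}$ holds), with SNR parameter $r$. Assume: (1) the number of machines satisfies $$M\ \ge\ K\left\lceil \frac{16\log d}{\Phi^c\!\left(\frac{(1-\sqrt r)\sqrt{2\log d}}{\sqrt{1-\delta}\,(1-\mu_{\max})}\right)}\right\rceil ;$$ (2) with $$Q_0=\frac{\log(88\sqrt2\,K)}{\log d},\qquad Q_1=\frac{1-(1-\mu_{\max})\sqrt{1-\delta}\left((1-\epsilon)\sqrt{1-\mu_{\max}}-\sqrt{Q_0}\right)}{1-2\mu_{\max}K\sqrt{1-\delta}\,\frac{1-\mu_{\max}}{1-(2K-1)\mu_{\max}}},$$ $$Q_2=\frac{\sqrt{2+2(\mu_{\max}+\delta)}\left(1+\sqrt{1-\delta}\,(1-\mu_{\max})\sqrt{Q_0}\right)}{\sqrt{1-\delta}\,(1-\mu_{\max})+\sqrt{2+2(\mu_{\max}+\delta)}},$$ one has $\sqrt r\ge Q_2$ if $(4K-1)\mu_{\max}-2K\mu_{\max}^2\ge 1$, and $\sqrt r\ge\min(Q_1,Q_2)$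 otherwise. Then, with probability at least $1-\frac{2^{K+1}}{d}$, the DJ-OMP algorithm with $K$ rounds recovers the support of $\boldsymbol\theta$, i.e. its output $S_K$ equals $\mathcal S=\operatorname{supp}(\boldsymbol\theta)$.
   Context: Model. There are $M$ machines. $\boldsymbol\theta\in\mathbb R^d$ is a fixed unknown vector with support $\mathcal S=\{i:\theta_i\ne0\}$, $|\mathcal S|=K$. Machine $m\in[M]$ holds a deterministic matrix $\mathbf X^{(m)}\in\mathbb R^{n\times d}$ with nonzero columns $\mathbf x^{(m)}_1,\dots,\mathbf x^{(m)}_d$ and the response $\mathbf y^{(m)}=\mathbf X^{(m)}\boldsymbol\theta+\sigma\boldsymbol\xi^{(m)}$, where $\sigma>0$ and the noise vectors $\boldsymbol\xi^{(m)}\sim\mathcal N(0,\mathbf I_n)$ are independent across $m$. Coherence. $\mu_{\max}=\max_{m\in[M]}\max_{i\ne j}\frac{|\langle \mathbf x^{(m)}_i,\mathbf x^{(m)}_j\rangle|}{\|\mathbf x_i^{(m)}\|_2\|\mathbf x_j^{(m)}\|_2}$. SNR. Let $\theta_{\rm crit}=\frac{\sigma\sqrt{2\log d}}{1-(2K-1)\mu_{\max}}$. Let $\tilde\theta_{\min}>0$ be a number such that $\min_{m\in[M]}\|\mathbf x^{(m)}_k\|_2\,|\theta_k|\ge\tilde\theta_{\min}$ for all $k\in\mathcal S$. The SNR parameter is $r=(\tilde\theta_{\min}/\theta_{\rm crit})^2$. $\Phi^c(t)=\Pr[Z>t]$ for $Z\sim\mathcal N(0,1)$; $\log$ is the natural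 logarithm. OMP step. Given $\mathbf X,\mathbf y$ and a set $s\subset[d]$: compute the least squares solution $\hat{\boldsymbol\theta}$ minimizing $\|\mathbf y-\mathbf X\mathbf z\|_2$ over vectors $\mathbf z$ supported on $s$, the residual $\mathbf r=\mathbf y-\mathbf X\hat{\boldsymbol\theta}$, and output an index $j\in\arg\max_{i\in[d]}\frac{|\langle\mathbf x_i,\mathbf r\rangle|}{\|\mathbf x_i\|_2}$. DJ-OMP algorithm. Start with $S_0=\emptyset$. In each round $t=1,\dots,K$: each machine $m$ performs an OMP step with input $(\mathbf X^{(m)},\mathbf y^{(m)},S_{t-1})$ and sends the resulting index $j^{(m,t)}$ to the center; the center counts votes $v_j^{(t)}=\#\{m: j^{(m,t)}=j\}$, picks an index $j_t\in\arg\max_j v^{(t)}_j$, and sets $S_t=S_{t-1}\cup\{j_t\}$. The output is $S_K$. Ties are broken arbitrarily. *)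

theory Defs
  imports "HOL-Probability.Probability" "Jordan_Normal_Form.Matrix"
begin

unbundle no inner_syntax
unbundle no vec_syntax

text \<open>
  The dimensions are natural numbers bound inside the theorem, so vectors and matrices are the
  dimension-carrying ones of Jordan_Normal_Form.  All indices (machines, rows, columns) start at 0.
\<close>

definition norm2 :: "real vec \<Rightarrow> real" where
  "norm2 v = L2_set (\<lambda>i. v $ i) {..<dim_vec v}"

definition support :: "real vec \<Rightarrow> nat set" where
  "support v = {i. i < dim_vec v \<and> v $ i \<noteq> 0}"


subsection \<open>The distributed sparse regression model\<close>

definition sparse_regression_model ::
  "nat \<Rightarrow> nat \<Rightarrow> nat \<Rightarrow> nat \<Rightarrow> (nat \<Rightarrow> real mat) \<Rightarrow> real vec \<Rightarrow> real \<Rightarrow> bool" where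
  "sparse_regression_model M n d K X \<theta> \<sigma> \<longleftrightarrow>
     0 < M \<and>
     (\<forall>m<M. X m \<in> carrier_mat n d \<and> (\<forall>i<d. col (X m) i \<noteq> 0\<^sub>v n)) \<and>
     \<theta> \<in> carrier_vec d \<and> card (support \<theta>) = K \<and> 0 < \<sigma>"

text \<open>
  The standard Gaussian law on R^n, and the joint law of M independent vectors of this law.
  A point \<^term>\<open>\<xi>\<close> of the second space holds the noise coordinate i of machine m as \<^term>\<open>\<xi> m i\<close>.
\<close>

definition std_gaussian :: "nat \<Rightarrow> (nat \<Rightarrow> real) measure" where
  "std_gaussian n = (\<Pi>\<^sub>M i\<in>{..<n}. std_normal_distribution)"

definition noise_law :: "nat \<Rightarrow> nat \<Rightarrow> (nat \<Rightarrow> nat \<Rightarrow> real) measure" where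
  "noise_law M n = (\<Pi>\<^sub>M m\<in>{..<M}. std_gaussian n)"

text \<open>
  Working on this canonical space loses no generality: on any probability space, noise vectors
  that are independent across the machines and have law \<^term>\<open>std_gaussian n\<close> have
  \<^term>\<open>noise_law M n\<close> as their joint law.
\<close>

lemma distr_indep_std_gaussian_eq_noise_law:
  assumes "prob_space P" and "0 < M"
    and indep: "prob_space.indep_vars P (\<lambda>_. \<Pi>\<^sub>M i\<in>{..<n}. borel) \<xi> {..<M}"
    and law: "\<And>m. m < M \<Longrightarrow> distr P (\<Pi>\<^sub>M i\<in>{..<n}. borel) (\<xi> m) = std_gaussian n"
  shows "distr P (\<Pi>\<^sub>M m\<in>{..<M}. \<Pi>\<^sub>M i\<in>{..<n}. borel) (\<lambda>\<omega>. \<lambda>m\<in>{..<M}. \<xi> m \<omega>) = noise_law M n"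
proof -
  interpret prob_space P by fact
  have "distr P (\<Pi>\<^sub>M m\<in>{..<M}. \<Pi>\<^sub>M i\<in>{..<n}. borel) (\<lambda>\<omega>. \<lambda>m\<in>{..<M}. \<xi> m \<omega>) =
      (\<Pi>\<^sub>M m\<in>{..<M}. distr P (\<Pi>\<^sub>M i\<in>{..<n}. borel) (\<xi> m))"
    using \<open>0 < M\<close> indep
    by (subst indep_vars_iff_distr_eq_PiM'[symmetric]) (auto simp: indep_vars_def)
  also have "\<dots> = noise_law M n"
    unfolding noise_law_def by (intro PiM_cong) (simp_all add: law)
  finally show ?thesis .
qed

definition response ::
  "(nat \<Rightarrow> real mat) \<Rightarrow> real vec \<Rightarrow> real \<Rightarrow> (nat \<Rightarrow> nat \<Rightarrow> real) \<Rightarrow> nat \<Rightarrow> real vec" where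
  "response X \<theta> \<sigma> \<xi> m = X m *\<^sub>v \<theta> + \<sigma> \<cdot>\<^sub>v vec (dim_row (X m)) (\<xi> m)"

definition coherence :: "real mat \<Rightarrow> real" where
  "coherence A = (MAX (i, j) \<in> {(i, j). i < dim_col A \<and> j < dim_col A \<and> i \<noteq> j}.
     \<bar>col A i \<bullet> col A j\<bar> / (norm2 (col A i) * norm2 (col A j)))"

definition max_coherence :: "nat \<Rightarrow> (nat \<Rightarrow> real mat) \<Rightarrow> real" where
  "max_coherence M X = (MAX m \<in> {..<M}. coherence (X m))"


subsection \<open>The DJ-OMP algorithm\<close>

text \<open>
  Ties are broken arbitrarily, so both the OMP step and the algorithm are relations
  that hold of every admissible outcome.
\<close>

definition least_squares :: "real mat \<Rightarrow> real vec \<Rightarrow> nat set \<Rightarrow> real vec \<Rightarrow> bool" where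
  "least_squares A y s z \<longleftrightarrow>
     is_arg_min (\<lambda>z. norm2 (y - A *\<^sub>v z)) (\<lambda>z. z \<in> carrier_vec (dim_col A) \<and> support z \<subseteq> s) z"

definition omp_step :: "real mat \<Rightarrow> real vec \<Rightarrow> nat set \<Rightarrow> nat \<Rightarrow> bool" where
  "omp_step A y s j \<longleftrightarrow>
     (\<exists>z. least_squares A y s z \<and>
       is_arg_max (\<lambda>i. \<bar>col A i \<bullet> (y - A *\<^sub>v z)\<bar> / norm2 (col A i)) (\<lambda>i. i < dim_col A) j)"

text \<open>
  \<open>dj_omp M d X y t S\<close>: the center may hold the set S after t rounds.
  The message of machine m in the current round is \<open>c m\<close>.
\<close>

inductive dj_omp ::
  "nat \<Rightarrow> nat \<Rightarrow> (nat \<Rightarrow> real mat) \<Rightarrow> (nat \<Rightarrow> real vec) \<Rightarrow> nat \<Rightarrow> nat set \<Rightarrow> bool"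
  for M d X y where
  start: "dj_omp M d X y 0 {}"
| round: "\<lbrakk>dj_omp M d X y t S;
           \<forall>m<M. omp_step (X m) (y m) S (c m);
           is_arg_max (\<lambda>j. card {m. m < M \<and> c m = j}) (\<lambda>j. j < d) j\<rbrakk>
          \<Longrightarrow> dj_omp M d X y (Suc t) (insert j S)"

text \<open>
  The set of possible outputs after K rounds is the singleton of the support: there is a run,
  and every run recovers the support, however the ties are broken.
\<close>

definition recovers_support ::
  "nat \<Rightarrow> nat \<Rightarrow> nat \<Rightarrow> (nat \<Rightarrow> real mat) \<Rightarrow> (nat \<Rightarrow> real vec) \<Rightarrow> real vec \<Rightarrow> bool" where
  "recovers_support M d K X y \<theta> \<longleftrightarrow> {S. dj_omp M d X y K S} = {support \<theta>}"


subsection \<open>Parameters of the guarantee\<close>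

definition theta_crit :: "nat \<Rightarrow> nat \<Rightarrow> real \<Rightarrow> real \<Rightarrow> real" where
  "theta_crit d K \<mu> \<sigma> = \<sigma> * sqrt (2 * ln (real d)) / (1 - (2 * real K - 1) * \<mu>)"

definition normal_tail :: "real \<Rightarrow> real" where
  "normal_tail t = measure std_normal_distribution {t<..}"

definition delta :: "nat \<Rightarrow> real \<Rightarrow> real" where
  "delta K \<mu> = (real K - 1) * \<mu>\<^sup>2 / (1 - (real K - 2) * \<mu>)"

definition Q0 :: "nat \<Rightarrow> nat \<Rightarrow> real" where
  "Q0 d K = ln (88 * sqrt 2 * real K) / ln (real d)"

definition Q1 :: "nat \<Rightarrow> nat \<Rightarrow> real \<Rightarrow> real \<Rightarrow> real" where
  "Q1 d K \<mu> \<epsilon> =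
     (1 - (1 - \<mu>) * sqrt (1 - delta K \<mu>) * ((1 - \<epsilon>) * sqrt (1 - \<mu>) - sqrt (Q0 d K))) /
     (1 - 2 * \<mu> * real K * sqrt (1 - delta K \<mu>) * ((1 - \<mu>) / (1 - (2 * real K - 1) * \<mu>)))"

definition Q2 :: "nat \<Rightarrow> nat \<Rightarrow> real \<Rightarrow> real" where
  "Q2 d K \<mu> =
     sqrt (2 + 2 * (\<mu> + delta K \<mu>)) * (1 + sqrt (1 - delta K \<mu>) * (1 - \<mu>) * sqrt (Q0 d K)) /
     (sqrt (1 - delta K \<mu>) * (1 - \<mu>) + sqrt (2 + 2 * (\<mu> + delta K \<mu>)))"

end

theory Submission
  imports Defs "HOL-Real_Asymp.Real_Asymp"
begin

text \<open>
  Fix a proper subset s of the support as the current set and one machine.  With unit columns, the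
  machine maximises \<open>\<bar>c i + \<sigma> g i\<bar>\<close>, where \<open>g i = \<langle>a i, \<xi>\<rangle>\<close> and \<open>a i\<close> is the part of column i orthogonal
  to the columns in s.  Let k be the remaining support index with the largest coefficient, let L be
  \<open>sqrt (2 ln d)\<close>, and let \<open>\<rho>\<close> be this coefficient divided by the critical value.  Then
  \<open>\<bar>c k\<bar> - \<bar>c j\<bar> \<ge> \<rho> \<sigma> L\<close> for all j outside the remaining support.  Splitting \<open>g j\<close> into a multiple of
  \<open>g k\<close> and an independent remainder, which exceeds L for some j only with small probability, shows
  that k wins with probability at least about \<open>p = \<Phi>\<^sup>c ((1 - \<rho>) L / (sqrt (1 - \<delta>) (1 - \<mu>)))\<close>.

  Such an index j can only win if \<open>\<bar>g j\<bar> - \<bar>g k\<bar>\<close> bridges the gap \<open>\<rho> L\<close>, which is unlikely compared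
  with p if \<open>\<rho> \<ge> Q2\<close>; or, if \<open>\<rho> \<ge> Q1\<close>, because \<open>\<bar>g j\<bar>\<close> has to compete with the maximum of all \<open>\<bar>g i\<bar>\<close>.
  For the lower tail of this maximum, an independent copy of the projections onto the span of s, which
  are negligible because this span has bounded dimension, is added to the \<open>g i\<close>.  This restores the
  Gram matrix of the columns, and Slepian's inequality allows the comparison with the equicorrelated
  Gaussian vector of correlation \<open>\<mu>\<close>.

  So a vote for j is at least \<open>16 K\<close> times less likely than a vote inside the remaining support.
  A Chernoff bound over the machines and a union bound over all s and j finish the proof.
\<close>

subsection \<open>Gaussian integration by parts\<close>

text \<open>The set held by the center depends on the very noise that the next round uses again, so
  a round cannot be analysed by conditioning on the past. All events are therefore stated for a
  fixed \<open>s\<close> and concern the noise alone; the price is a union over at most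
  \<open>2 ^ K * d\<close> pairs, hence the target \<open>1 / d^2\<close> for each of them.
  Slepian's inequality is the one multivariate Gaussian fact that is proved by analysis. Comparison
  with a fresh coordinate of the same variance also extracts from it the law of a linear functional
  and the independence of uncorrelated functionals, so that no change of variables in several
  dimensions is made. \<open>Q1\<close> and \<open>Q2\<close> are the values of \<rho> at which, in
  units of L, the deviation required for a wrong vote exceeds the one required for winning,
  \<open>(1 - \<rho>) / \<kappa>\<close>, by exactly \<open>sqrt Q0\<close>; this margin costs a
  wrong vote the factor \<open>1 / (88 * sqrt 2 * K)\<close>.\<close>

definition gauss :: "nat set \<Rightarrow> (nat \<Rightarrow> real) measure" where
  "gauss J = (\<Pi>\<^sub>M j\<in>J. std_normal_distribution)"

text \<open>Vectors are functions on all naturals of which only the coordinates in \<open>J\<close>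
  count. Enlarging a Gaussian space by fresh coordinates is then just a larger
  \<open>J\<close>.\<close>

definition ip :: "nat set \<Rightarrow> (nat \<Rightarrow> real) \<Rightarrow> (nat \<Rightarrow> real) \<Rightarrow> real" where
  "ip J u v = (\<Sum>j\<in>J. u j * v j)"

lemma prob_space_std_normal: "prob_space std_normal_distribution"
  by (rule prob_space_normal_density) simp

lemma prob_space_gauss: "prob_space (gauss J)"
  unfolding gauss_def by (intro prob_space_PiM prob_space_std_normal)

lemma product_prob_space_std_normal: "product_prob_space (\<lambda>_. std_normal_distribution)"
  by (simp add: product_prob_spaceI prob_space_std_normal)

lemma space_gauss: "space (gauss J) = extensional J"
  by (simp add: gauss_def space_PiM PiE_UNIV_domain PiE_def)

lemma measurable_gauss_component [measurable]:
  "j \<in> J \<Longrightarrow> (\<lambda>x. x j) \<in> borel_measurable (gauss J)"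
  unfolding gauss_def by measurable

lemma borel_measurable_ip [measurable]: "ip J u \<in> borel_measurable (gauss J)"
  unfolding ip_def by measurable

lemma ip_commute: "ip J u v = ip J v u"
  by (simp add: ip_def mult.commute)

lemma ip_add_left: "ip J (\<lambda>j. u j + v j) w = ip J u w + ip J v w"
  by (simp add: ip_def algebra_simps sum.distrib)

lemma ip_add_right: "ip J w (\<lambda>j. u j + v j) = ip J w u + ip J w v"
  by (simp add: ip_def algebra_simps sum.distrib)

lemma ip_scale_left: "ip J (\<lambda>j. c * u j) w = c * ip J u w"
  by (simp add: ip_def algebra_simps sum_distrib_left)

lemma ip_scale_right: "ip J w (\<lambda>j. c * u j) = c * ip J w u"
  by (simp add: ip_def algebra_simps sum_distrib_left)

lemma has_bochner_integral_deriv_real_line: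
  fixes F f :: "real \<Rightarrow> real"
  assumes "\<And>x. (F has_real_derivative f x) (at x)" and "\<And>x. isCont f x"
    and "integrable lborel f" and "(F \<longlongrightarrow> 0) at_top" and "(F \<longlongrightarrow> 0) at_bot"
  shows "(\<integral>x. f x \<partial>lborel) = 0"
proof -
  have "(LBINT x=-\<infinity>..\<infinity>. f x) = 0 - 0"
  proof (rule interval_integral_FTC_integrable)
    show "set_integrable lborel (einterval (-\<infinity>) \<infinity>) f"
      using assms(3) by (simp add: set_integrable_def)
    show "((F \<circ> real_of_ereal) \<longlongrightarrow> 0) (at_right (-\<infinity>))" "((F \<circ> real_of_ereal) \<longlongrightarrow> 0) (at_left \<infinity>)"
      using assms(4,5) by (simp_all add: ereal_tendsto_simps)
  qed (use assms in \<open>auto simp: has_real_derivative_iff_has_vector_derivative\<close>)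
  then show ?thesis
    by (simp add: interval_lebesgue_integral_def set_lebesgue_integral_def)
qed

lemma std_normal_density_DERIV:
  "(std_normal_density has_real_derivative (- x * std_normal_density x)) (at x)"
  unfolding std_normal_density_def
  by (auto intro!: derivative_eq_intros simp: power2_eq_square field_simps)

lemma std_normal_density_tendsto_0:
  "(std_normal_density \<longlongrightarrow> 0) at_top" "(std_normal_density \<longlongrightarrow> 0) at_bot"
  unfolding std_normal_density_def by real_asymp+

lemma integrable_std_normal_iff:
  fixes f :: "real \<Rightarrow> real"
  assumes "f \<in> borel_measurable borel"
  shows "integrable std_normal_distribution f \<longleftrightarrow> integrable lborel (\<lambda>x. std_normal_density x * f x)"
  using assms by (subst integrable_density) (auto simp: normal_density_nonneg)

text \<open>Stein's identity. The derivative of \<open>std_normal_density x * h x\<close> is the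
  density times \<open>h' x - x * h x\<close>, and it integrates to 0 because a bounded
  \<open>h\<close> makes the product vanish at both ends.\<close>

lemma integral_std_normal_by_parts:
  fixes h h' :: "real \<Rightarrow> real"
  assumes deriv: "\<And>x. (h has_real_derivative h' x) (at x)" and cont: "\<And>x. isCont h' x"
    and bnd: "\<And>x. \<bar>h x\<bar> \<le> C" "\<And>x. \<bar>h' x\<bar> \<le> C"
  shows "(\<integral>x. x * h x \<partial>std_normal_distribution) = (\<integral>x. h' x \<partial>std_normal_distribution)"
proof -
  interpret prob_space std_normal_distribution by (rule prob_space_std_normal)
  have conth: "isCont h x" for x using deriv DERIV_isCont by blast
  have [measurable]: "h \<in> borel_measurable borel" "h' \<in> borel_measurable borel"
    using conth cont by (auto intro!: borel_measurable_continuous_onI continuous_at_imp_continuous_on)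
  have i1: "integrable std_normal_distribution h'"
    by (rule integrable_const_bound[where B = C]) (use bnd in auto)
  have "integrable std_normal_distribution (\<lambda>x. C * x)"
    using integrable_std_normal_distribution_moment[of 1] by simp
  then have i2: "integrable std_normal_distribution (\<lambda>x. x * h x)"
    by (rule Bochner_Integration.integrable_bound)
      (use bnd abs_ge_zero[THEN order_trans, OF bnd(1)] in \<open>auto simp: abs_mult mult.commute[of C] intro!: mult_left_mono always_eventually\<close>)
  have "(\<integral>x. std_normal_density x * (h' x - x * h x) \<partial>lborel) = 0"
  proof (rule has_bochner_integral_deriv_real_line)
    show "((\<lambda>x. std_normal_density x * h x) has_real_derivative std_normal_density x * (h' x - x * h x)) (at x)" for x
      by (rule derivative_eq_intros std_normal_density_DERIV deriv refl)+ (simp add: algebra_simps)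
    show "isCont (\<lambda>x. std_normal_density x * (h' x - x * h x)) x" for x
      unfolding std_normal_density_def by (intro continuous_intros cont conth) auto
    have "integrable std_normal_distribution (\<lambda>x. h' x - x * h x)" using i1 i2 by simp
    then show "integrable lborel (\<lambda>x. std_normal_density x * (h' x - x * h x))"
      by (subst (asm) integrable_std_normal_iff) auto
    have *: "((\<lambda>x. C * std_normal_density x) \<longlongrightarrow> 0) at_top" "((\<lambda>x. C * std_normal_density x) \<longlongrightarrow> 0) at_bot"
      using std_normal_density_tendsto_0 by (auto intro: tendsto_mult_right_zero)
    have **: "norm (std_normal_density x * h x) \<le> C * std_normal_density x" for x
      using bnd(1)[of x] by (simp add: abs_mult normal_density_nonneg mult.commute mult_right_mono)
    show "((\<lambda>x. std_normal_density x * h x) \<longlongrightarrow> 0) at_top"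
      by (rule Lim_null_comparison[OF always_eventually *(1)]) (use ** in blast)
    show "((\<lambda>x. std_normal_density x * h x) \<longlongrightarrow> 0) at_bot"
      by (rule Lim_null_comparison[OF always_eventually *(2)]) (use ** in blast)
  qed
  then have "(\<integral>x. h' x - x * h x \<partial>std_normal_distribution) = 0"
    by (subst integral_density) (auto simp: normal_density_nonneg)
  then show ?thesis using i1 i2 by simp
qed

lemma integrable_gauss_component:
  assumes "finite J" "j \<in> J"
  shows "integrable (gauss J) (\<lambda>x. x j)"
proof -
  interpret product_prob_space "\<lambda>_. std_normal_distribution" J by (rule product_prob_space_std_normal)
  have "integrable (distr (gauss J) std_normal_distribution (\<lambda>x. x j)) (\<lambda>x. x)"
    unfolding gauss_def using assms PiM_component[of j] integrable_std_normal_distribution_moment[of 1] by simp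
  then show ?thesis
    using assms measurable_gauss_component[of j J] by (subst (asm) integrable_distr_eq) (simp_all cong: measurable_cong_sets)
qed

text \<open>Stein's identity in one coordinate, the others being frozen by Fubini. The hypotheses
  speak of \<open>x(j := y)\<close> because this is how the product integral splits off a
  coordinate.\<close>

lemma integral_gauss_by_parts:
  fixes H H' :: "(nat \<Rightarrow> real) \<Rightarrow> real"
  assumes J: "finite J" "j \<in> J"
    and [measurable]: "H \<in> borel_measurable (gauss J)" "H' \<in> borel_measurable (gauss J)"
    and deriv: "\<And>x y. ((\<lambda>y. H (x(j := y))) has_real_derivative H' (x(j := y))) (at y)"
    and cont: "\<And>x y. isCont (\<lambda>y. H' (x(j := y))) y"
    and bnd: "\<And>x. \<bar>H x\<bar> \<le> C" "\<And>x. \<bar>H' x\<bar> \<le> C"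
  shows "(\<integral>x. x j * H x \<partial>gauss J) = (\<integral>x. H' x \<partial>gauss J)"
proof -
  interpret product_prob_space "\<lambda>_. std_normal_distribution" J by (rule product_prob_space_std_normal)
  interpret G: prob_space "gauss J" by (rule prob_space_gauss)
  define I where "I = J - {j}"
  have I: "finite I" "j \<notin> I" "J = insert j I" using J by (auto simp: I_def)
  have i1: "integrable (gauss J) H'"
    by (rule G.integrable_const_bound[where B = C]) (use bnd in auto)
  have "integrable (gauss J) (\<lambda>x. C * x j)"
    using integrable_gauss_component[OF J] by simp
  then have i2: "integrable (gauss J) (\<lambda>x. x j * H x)"
    by (rule Bochner_Integration.integrable_bound)
      (use J bnd abs_ge_zero[THEN order_trans, OF bnd(1)] in \<open>auto simp: abs_mult mult.commute[of C] intro!: mult_left_mono always_eventually\<close>)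
  have "(\<integral>x. x j * H x \<partial>gauss J) =
      (\<integral>x. (\<integral>y. y * H (x(j := y)) \<partial>std_normal_distribution) \<partial>gauss I)"
    using product_integral_insert[OF I(1,2), of "\<lambda>x. x j * H x"] i2 unfolding gauss_def I(3) by simp
  also have "\<dots> = (\<integral>x. (\<integral>y. H' (x(j := y)) \<partial>std_normal_distribution) \<partial>gauss I)"
    using integral_std_normal_by_parts[OF deriv cont bnd] by simp
  also have "\<dots> = (\<integral>x. H' x \<partial>gauss J)"
    using product_integral_insert[OF I(1,2), of H'] i1 unfolding gauss_def I(3) by simp
  finally show ?thesis .
qed

subsection \<open>Slepian's inequality\<close>

text \<open>By the mean value theorem \<open>W\<close> dominates all difference quotients, so
  dominated convergence applies along every sequence of increments.\<close>

lemma has_real_derivative_lebesgue_integral: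
  fixes F F' :: "real \<Rightarrow> 'a \<Rightarrow> real"
  assumes deriv: "\<And>\<theta> x. x \<in> space M \<Longrightarrow> ((\<lambda>\<theta>. F \<theta> x) has_real_derivative F' \<theta> x) (at \<theta>)"
    and int: "\<And>\<theta>. integrable M (F \<theta>)" and meas [measurable]: "\<And>\<theta>. F' \<theta> \<in> borel_measurable M"
    and bnd: "\<And>\<theta> x. x \<in> space M \<Longrightarrow> \<bar>F' \<theta> x\<bar> \<le> W x" and W: "integrable M W"
  shows "((\<lambda>\<theta>. \<integral>x. F \<theta> x \<partial>M) has_real_derivative (\<integral>x. F' \<theta> x \<partial>M)) (at \<theta>)"
proof -
  have "((\<lambda>h. ((\<integral>x. F (\<theta> + h) x \<partial>M) - (\<integral>x. F \<theta> x \<partial>M)) / h) \<longlongrightarrow> (\<integral>x. F' \<theta> x \<partial>M)) (at 0)"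
    unfolding tendsto_at_iff_sequentially comp_def
  proof (intro allI impI)
    fix h :: "nat \<Rightarrow> real"
    assume h: "\<forall>i. h i \<in> UNIV - {0}" "h \<longlonglongrightarrow> 0"
    have [measurable]: "F \<theta> \<in> borel_measurable M" for \<theta> using int by blast
    have "(\<lambda>n. \<integral>x. (F (\<theta> + h n) x - F \<theta> x) / h n \<partial>M) \<longlonglongrightarrow> (\<integral>x. F' \<theta> x \<partial>M)"
    proof (rule integral_dominated_convergence[where w = W])
      show "AE x in M. (\<lambda>n. (F (\<theta> + h n) x - F \<theta> x) / h n) \<longlonglongrightarrow> F' \<theta> x"
      proof (rule AE_I2)
        fix x assume "x \<in> space M"
        from deriv[OF this, of \<theta>] have "((\<lambda>h. (F (\<theta> + h) x - F \<theta> x) / h) \<longlongrightarrow> F' \<theta> x) (at 0)"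
          by (simp add: DERIV_def)
        then show "(\<lambda>n. (F (\<theta> + h n) x - F \<theta> x) / h n) \<longlonglongrightarrow> F' \<theta> x"
          using h unfolding tendsto_at_iff_sequentially comp_def by blast
      qed
      show "AE x in M. norm ((F (\<theta> + h n) x - F \<theta> x) / h n) \<le> W x" for n
      proof (rule AE_I2)
        fix x assume x: "x \<in> space M"
        have "norm (F (\<theta> + h n) x - F \<theta> x) \<le> W x * norm (\<theta> + h n - \<theta>)"
          by (rule field_differentiable_bound[where S = UNIV and f' = "\<lambda>\<theta>. F' \<theta> x"])
            (use deriv[OF x] bnd[OF x] in auto)
        moreover have "h n \<noteq> 0" using h by simp
        ultimately show "norm ((F (\<theta> + h n) x - F \<theta> x) / h n) \<le> W x"
          by (simp add: divide_le_eq)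
      qed
    qed (use W in auto)
    then show "(\<lambda>n. ((\<integral>x. F (\<theta> + h n) x \<partial>M) - (\<integral>x. F \<theta> x \<partial>M)) / h n) \<longlonglongrightarrow> (\<integral>x. F' \<theta> x \<partial>M)"
      using int by simp
  qed
  then show "((\<lambda>\<theta>. \<integral>x. F \<theta> x \<partial>M) has_real_derivative (\<integral>x. F' \<theta> x \<partial>M)) (at \<theta>)"
    by (simp add: DERIV_def)
qed

text \<open>The logistic function: a smooth step with logarithmic derivative
  \<open>1 - sigm x\<close>. A product of such steps is therefore its own derivative up to bounded
  factors.\<close>

definition sigm :: "real \<Rightarrow> real" where
  "sigm x = 1 / (1 + exp (- x))"

lemma sigm_bounds: "0 < sigm x" "sigm x < 1"
  by (auto simp: sigm_def add_pos_pos)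

lemma sigm_DERIV: "(sigm has_real_derivative sigm x * (1 - sigm x)) (at x)"
proof -
  have "1 + exp (- x) > 0" by (simp add: add_pos_pos)
  then show ?thesis
    unfolding sigm_def by (auto intro!: derivative_eq_intros simp: field_simps power2_eq_square)
qed

lemma isCont_sigm: "isCont sigm x"
  using sigm_DERIV DERIV_isCont by blast

lemma borel_measurable_sigm [measurable]: "sigm \<in> borel_measurable borel"
  by (intro borel_measurable_continuous_onI continuous_at_imp_continuous_on ballI isCont_sigm)

lemma prod_sigm_DERIV:
  assumes "finite I" and "\<And>i. i \<in> I \<Longrightarrow> ((\<lambda>y. a i y) has_real_derivative a' i) (at y)"
  shows "((\<lambda>y. \<Prod>i\<in>I. sigm (a i y)) has_real_derivative
    (\<Sum>i\<in>I. a' i * (1 - sigm (a i y))) * (\<Prod>i\<in>I. sigm (a i y))) (at y)"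
  using assms
proof (induction rule: finite_induct)
  case (insert i I)
  have 1: "((\<lambda>y. sigm (a i y)) has_real_derivative sigm (a i y) * (1 - sigm (a i y)) * a' i) (at y)"
    using DERIV_chain2[OF sigm_DERIV insert.prems[of i]] by simp
  have 2: "((\<lambda>y. \<Prod>i\<in>I. sigm (a i y)) has_real_derivative
    (\<Sum>i\<in>I. a' i * (1 - sigm (a i y))) * (\<Prod>i\<in>I. sigm (a i y))) (at y)"
    using insert by simp
  show ?case using DERIV_mult[OF 1 2] insert.hyps by (simp add: algebra_simps)
qed simp

text \<open>A smooth substitute, with steepness \<beta>, for the indicator of
  \<open>\<forall>i\<in>I. ip J (z i) x \<le> t i\<close>.\<close>

definition softprod :: "'i set \<Rightarrow> nat set \<Rightarrow> real \<Rightarrow> ('i \<Rightarrow> real) \<Rightarrow> ('i \<Rightarrow> nat \<Rightarrow> real) \<Rightarrow> (nat \<Rightarrow> real) \<Rightarrow> real" where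
  "softprod I J \<beta> t z x = (\<Prod>i\<in>I. sigm (\<beta> * (t i - ip J (z i) x)))"

lemma softprod_bounds: "0 \<le> softprod I J \<beta> t z x" "softprod I J \<beta> t z x \<le> 1"
  unfolding softprod_def by (intro prod_nonneg prod_le_1 ballI conjI less_imp_le sigm_bounds)+

lemma borel_measurable_softprod [measurable]:
  "softprod I J \<beta> t z \<in> borel_measurable (gauss J)"
  unfolding softprod_def by measurable

lemma ip_upd_DERIV:
  assumes "finite J" "j \<in> J"
  shows "((\<lambda>y. ip J z (x(j := y))) has_real_derivative z j) (at y)"
proof -
  have "ip J z (x(j := y)) = (\<Sum>l\<in>J - {j}. z l * x l) + z j * y" for y
    unfolding ip_def using assms by (subst sum.remove[of _ j]) (auto intro!: sum.cong)
  then show ?thesis by (auto intro!: derivative_eq_intros)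
qed

text \<open>Differentiating the factor \<open>1 - s i\<close> gives the term with
  \<open>ip J q (z i)\<close>, differentiating the product gives the sum. In the interpolation below
  the first term vanishes, and what remains is a combination of nonnegative integrals with
  covariances as coefficients.\<close>

lemma softprod_by_parts:
  fixes z :: "'i \<Rightarrow> nat \<Rightarrow> real" and t :: "'i \<Rightarrow> real" and \<beta> :: real
  assumes fin: "finite I" "finite J" and i: "i \<in> I"
  defines "s \<equiv> (\<lambda>l x. sigm (\<beta> * (t l - ip J (z l) x)))"
  shows "(\<integral>x. ip J q x * ((1 - s i x) * softprod I J \<beta> t z x) \<partial>gauss J) =
    \<beta> * ip J q (z i) * (\<integral>x. s i x * (1 - s i x) * softprod I J \<beta> t z x \<partial>gauss J)
    - \<beta> * (\<Sum>l\<in>I. ip J q (z l) * (\<integral>x. (1 - s i x) * (1 - s l x) * softprod I J \<beta> t z x \<partial>gauss J))"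
proof -
  interpret G: prob_space "gauss J" by (rule prob_space_gauss)
  let ?f = "softprod I J \<beta> t z"
  have [measurable]: "s l \<in> borel_measurable (gauss J)" for l unfolding s_def by measurable
  have s: "0 < s l x" "s l x < 1" for l x unfolding s_def by (rule sigm_bounds)+
  have f: "0 \<le> ?f x" "?f x \<le> 1" for x by (rule softprod_bounds)+
  define H where "H = (\<lambda>x. (1 - s i x) * ?f x)"
  define H' where "H' = (\<lambda>j x. \<beta> * z i j * (s i x * (1 - s i x) * ?f x)
    - \<beta> * (\<Sum>l\<in>I. z l j * ((1 - s i x) * (1 - s l x) * ?f x)))"
  have [measurable]: "H \<in> borel_measurable (gauss J)" "H' j \<in> borel_measurable (gauss J)" for j
    unfolding H_def H'_def by measurable
  have b1: "\<bar>H x\<bar> \<le> 1" for x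
    unfolding H_def abs_mult using s[of i x] f[of x] by (intro mult_le_one) auto
  have b2: "\<bar>s i x * (1 - s i x) * ?f x\<bar> \<le> 1" "\<bar>(1 - s i x) * (1 - s l x) * ?f x\<bar> \<le> 1" for l x
    using s[of i x] s[of l x] f[of x] by (auto simp: abs_mult intro!: mult_le_one mult_nonneg_nonneg)
  have int: "integrable (gauss J) (\<lambda>x. s i x * (1 - s i x) * ?f x)"
    "integrable (gauss J) (\<lambda>x. (1 - s i x) * (1 - s l x) * ?f x)" for l
    using b2 by (auto intro!: G.integrable_const_bound[where B = 1])
  have part: "(\<integral>x. x j * H x \<partial>gauss J) = (\<integral>x. H' j x \<partial>gauss J)" if j: "j \<in> J" for j
  proof (rule integral_gauss_by_parts[where C = "1 + \<bar>\<beta> * z i j\<bar> + \<bar>\<beta>\<bar> * (\<Sum>l\<in>I. \<bar>z l j\<bar>)"])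
    fix x y
    have a: "((\<lambda>y. \<beta> * (t l - ip J (z l) (x(j := y)))) has_real_derivative - \<beta> * z l j) (at y)" for l
      by (auto intro!: derivative_eq_intros ip_upd_DERIV fin j)
    have d1: "((\<lambda>y. ?f (x(j := y))) has_real_derivative
        (\<Sum>l\<in>I. - \<beta> * z l j * (1 - s l (x(j := y)))) * ?f (x(j := y))) (at y)"
      unfolding softprod_def s_def by (rule prod_sigm_DERIV[OF fin(1) a])
    have d2: "((\<lambda>y. s i (x(j := y))) has_real_derivative
       s i (x(j := y)) * (1 - s i (x(j := y))) * (- \<beta> * z i j)) (at y)" for y
      unfolding s_def
      by (rule DERIV_chain2[OF sigm_DERIV])
        (auto intro!: derivative_eq_intros ip_upd_DERIV fin j)
    show "((\<lambda>y. H (x(j := y))) has_real_derivative H' j (x(j := y))) (at y)"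
      unfolding H_def
      by (rule derivative_eq_intros refl d1 d2)+
        (simp add: H'_def algebra_simps sum_distrib_left sum_distrib_right sum_subtractf sum_negf sum.distrib)
  next
    fix x y
    have c1: "isCont (\<lambda>y. s l (x(j := y))) y" for l
      unfolding s_def
      by (rule isCont_o2[OF _ isCont_sigm])
        (intro continuous_intros DERIV_isCont[OF ip_upd_DERIV] fin j)
    have c2: "isCont (\<lambda>y. ?f (x(j := y))) y"
      unfolding softprod_def using c1 unfolding s_def by (intro continuous_intros)
    show "isCont (\<lambda>y. H' j (x(j := y))) y"
      unfolding H'_def by (intro continuous_intros c1 c2)
  next
    fix x
    show "\<bar>H x\<bar> \<le> 1 + \<bar>\<beta> * z i j\<bar> + \<bar>\<beta>\<bar> * (\<Sum>l\<in>I. \<bar>z l j\<bar>)"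
      using b1[of x] by (smt (verit) abs_ge_zero mult_nonneg_nonneg sum_nonneg)
    have "\<bar>H' j x\<bar> \<le> \<bar>\<beta> * z i j * (s i x * (1 - s i x) * ?f x)\<bar>
        + \<bar>\<beta>\<bar> * \<bar>\<Sum>l\<in>I. z l j * ((1 - s i x) * (1 - s l x) * ?f x)\<bar>"
      unfolding H'_def by (rule order_trans[OF abs_triangle_ineq4]) (simp add: abs_mult)
    also have "\<bar>\<beta> * z i j * (s i x * (1 - s i x) * ?f x)\<bar> \<le> \<bar>\<beta> * z i j\<bar> * 1"
      unfolding abs_mult[of "\<beta> * z i j"] using b2(1)[of x] by (intro mult_left_mono) auto
    also have "\<bar>\<Sum>l\<in>I. z l j * ((1 - s i x) * (1 - s l x) * ?f x)\<bar> \<le> (\<Sum>l\<in>I. \<bar>z l j\<bar> * 1)"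
      by (rule order_trans[OF sum_abs]) (use b2(2) in \<open>auto intro!: sum_mono mult_left_le simp: abs_mult[of "z _ j"]\<close>)
    finally show "\<bar>H' j x\<bar> \<le> 1 + \<bar>\<beta> * z i j\<bar> + \<bar>\<beta>\<bar> * (\<Sum>l\<in>I. \<bar>z l j\<bar>)"
      by (simp add: mult_left_mono)
  qed (use fin j in auto)
  have int2: "integrable (gauss J) (\<lambda>x. x j * H x)" if j: "j \<in> J" for j
    by (rule Bochner_Integration.integrable_bound[OF integrable_gauss_component[OF fin(2) j]])
      (use b1 j in \<open>auto simp: abs_mult intro!: mult_left_le\<close>)
  have swap: "(\<Sum>j\<in>J. q j * (\<beta> * (\<Sum>l\<in>I. z l j * E l))) = \<beta> * (\<Sum>l\<in>I. ip J q (z l) * E l)" for E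
    unfolding ip_def sum_distrib_left sum_distrib_right by (subst sum.swap) (simp add: ac_simps)
  have "(\<integral>x. ip J q x * ((1 - s i x) * ?f x) \<partial>gauss J) = (\<integral>x. (\<Sum>j\<in>J. q j * (x j * H x)) \<partial>gauss J)"
    unfolding ip_def H_def by (simp add: sum_distrib_right mult.assoc)
  also have "\<dots> = (\<Sum>j\<in>J. q j * (\<integral>x. H' j x \<partial>gauss J))"
    using int2 by (subst Bochner_Integration.integral_sum) (auto simp: part)
  also have "\<dots> = (\<Sum>j\<in>J. q j * (\<beta> * z i j * (\<integral>x. s i x * (1 - s i x) * ?f x \<partial>gauss J)
    - \<beta> * (\<Sum>l\<in>I. z l j * (\<integral>x. (1 - s i x) * (1 - s l x) * ?f x \<partial>gauss J))))"
    unfolding H'_def using int by (simp add: Bochner_Integration.integral_sum)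
  also have "\<dots> = \<beta> * ip J q (z i) * (\<integral>x. s i x * (1 - s i x) * softprod I J \<beta> t z x \<partial>gauss J)
    - \<beta> * (\<Sum>l\<in>I. ip J q (z l) * (\<integral>x. (1 - s i x) * (1 - s l x) * softprod I J \<beta> t z x \<partial>gauss J))"
    by (simp add: right_diff_distrib sum_subtractf swap) (simp add: ip_def sum_distrib_left sum_distrib_right ac_simps)
  finally show ?thesis .
qed

text \<open>Interpolation along a quarter circle from \<open>u\<close> to \<open>v\<close>, with
  \<open>w\<close> kept fixed. The covariance of the velocity of row \<open>i\<close> with row
  \<open>l\<close> is \<open>sin \<theta> * cos \<theta>\<close> times the difference of the Gram
  entries of \<open>v\<close> and \<open>u\<close>: zero on the diagonal, nonnegative off it.
  Integration by parts turns these signs into the sign of the derivative.\<close>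

lemma integral_softprod_mono:
  fixes u v w :: "'i \<Rightarrow> nat \<Rightarrow> real" and t :: "'i \<Rightarrow> real" and \<beta> :: real
  assumes fin: "finite I" "finite J"
    and orth: "\<And>i l. i \<in> I \<Longrightarrow> l \<in> I \<Longrightarrow> ip J (u i) (v l) = 0"
      "\<And>i l. i \<in> I \<Longrightarrow> l \<in> I \<Longrightarrow> ip J (u i) (w l) = 0"
      "\<And>i l. i \<in> I \<Longrightarrow> l \<in> I \<Longrightarrow> ip J (v i) (w l) = 0"
    and diag: "\<And>i. i \<in> I \<Longrightarrow> ip J (u i) (u i) = ip J (v i) (v i)"
    and off: "\<And>i l. i \<in> I \<Longrightarrow> l \<in> I \<Longrightarrow> i \<noteq> l \<Longrightarrow> ip J (u i) (u l) \<le> ip J (v i) (v l)"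
  shows "(\<integral>x. softprod I J \<beta> t (\<lambda>i j. u i j + w i j) x \<partial>gauss J) \<le>
    (\<integral>x. softprod I J \<beta> t (\<lambda>i j. v i j + w i j) x \<partial>gauss J)"
proof -
  interpret G: prob_space "gauss J" by (rule prob_space_gauss)
  define z where "z = (\<lambda>\<theta> i j. cos \<theta> * u i j + sin \<theta> * v i j + w i j)"
  define z' where "z' = (\<lambda>\<theta> i j. - sin \<theta> * u i j + cos \<theta> * v i j)"
  define s where "s = (\<lambda>\<theta> l x. sigm (\<beta> * (t l - ip J (z \<theta> l) x)))"
  define F where "F = (\<lambda>\<theta>. softprod I J \<beta> t (z \<theta>))"
  define F' where "F' = (\<lambda>\<theta> x. (\<Sum>i\<in>I. - \<beta> * ip J (z' \<theta> i) x * (1 - s \<theta> i x)) * F \<theta> x)"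
  have ipz: "ip J (z \<theta> i) x = cos \<theta> * ip J (u i) x + sin \<theta> * ip J (v i) x + ip J (w i) x" for \<theta> i x
    unfolding z_def by (simp add: ip_add_left ip_scale_left)
  have ipz': "ip J (z' \<theta> i) x = - sin \<theta> * ip J (u i) x + cos \<theta> * ip J (v i) x" for \<theta> i x
    unfolding z'_def by (simp add: ip_def algebra_simps sum_distrib_left sum_subtractf sum_negf)
  have [measurable]: "s \<theta> l \<in> borel_measurable (gauss J)" "F \<theta> \<in> borel_measurable (gauss J)" for \<theta> l
    unfolding s_def F_def by measurable
  have [measurable]: "F' \<theta> \<in> borel_measurable (gauss J)" for \<theta> unfolding F'_def by measurable
  have s: "0 < s \<theta> l x" "s \<theta> l x < 1" for \<theta> l x unfolding s_def by (rule sigm_bounds)+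
  have f: "0 \<le> F \<theta> x" "F \<theta> x \<le> 1" for \<theta> x unfolding F_def by (rule softprod_bounds)+
  have intip: "integrable (gauss J) (\<lambda>x. ip J q x)" for q
    unfolding ip_def using integrable_gauss_component[OF fin(2)] by auto
  have b: "\<bar>(1 - s \<theta> i x) * F \<theta> x\<bar> \<le> 1" for \<theta> i x
    unfolding abs_mult using s[of \<theta> i x] f[of \<theta> x] by (intro mult_le_one) auto
  \<comment> \<open>A bound uniform in \<theta>, since \<open>sin\<close> and \<open>cos\<close> are
    at most 1 in absolute value.\<close>
  define W where "W = (\<lambda>x. \<Sum>i\<in>I. \<bar>\<beta>\<bar> * (\<bar>ip J (u i) x\<bar> + \<bar>ip J (v i) x\<bar>))"
  have D: "((\<lambda>\<theta>. \<integral>x. F \<theta> x \<partial>gauss J) has_real_derivative (\<integral>x. F' \<theta> x \<partial>gauss J)) (at \<theta>)" for \<theta>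
  proof (rule has_real_derivative_lebesgue_integral[where W = W])
    fix \<theta> x
    have "((\<lambda>\<theta>. \<beta> * (t i - ip J (z \<theta> i) x)) has_real_derivative - \<beta> * ip J (z' \<theta> i) x) (at \<theta>)" for i
      unfolding ipz ipz' by (auto intro!: derivative_eq_intros simp: algebra_simps)
    then show "((\<lambda>\<theta>. F \<theta> x) has_real_derivative F' \<theta> x) (at \<theta>)"
      unfolding F_def F'_def softprod_def s_def by (rule prod_sigm_DERIV[OF fin(1)])
    have "\<bar>F' \<theta> x\<bar> = \<bar>\<Sum>i\<in>I. \<beta> * ip J (z' \<theta> i) x * ((1 - s \<theta> i x) * F \<theta> x)\<bar>"
      unfolding F'_def by (simp add: sum_distrib_right mult.assoc sum_negf)
    also have "\<dots> \<le> (\<Sum>i\<in>I. \<bar>\<beta>\<bar> * \<bar>ip J (z' \<theta> i) x\<bar> * 1)"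
      by (rule order_trans[OF sum_abs]) (use b in \<open>auto intro!: sum_mono mult_left_le simp: abs_mult[of "_ * ip J _ _"] abs_mult[of \<beta>]\<close>)
    also have "\<dots> \<le> W x"
      unfolding W_def mult_1_right
    proof (intro sum_mono mult_left_mono)
      fix i
      have "\<bar>sin \<theta> * ip J (u i) x\<bar> \<le> 1 * \<bar>ip J (u i) x\<bar>" "\<bar>cos \<theta> * ip J (v i) x\<bar> \<le> 1 * \<bar>ip J (v i) x\<bar>"
        unfolding abs_mult by (intro mult_right_mono; simp)+
      then show "\<bar>ip J (z' \<theta> i) x\<bar> \<le> \<bar>ip J (u i) x\<bar> + \<bar>ip J (v i) x\<bar>"
        unfolding ipz' by linarith
    qed auto
    finally show "\<bar>F' \<theta> x\<bar> \<le> W x" .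
  next
    show "integrable (gauss J) W" unfolding W_def using intip by auto
    show "integrable (gauss J) (F \<theta>)" for \<theta>
      by (rule G.integrable_const_bound[where B = 1]) (use f in auto)
  qed auto
  have nonneg: "0 \<le> (\<integral>x. F' \<theta> x \<partial>gauss J)" if \<theta>: "0 \<le> \<theta>" "\<theta> \<le> pi / 2" for \<theta>
  proof -
    have int: "integrable (gauss J) (\<lambda>x. ip J q x * ((1 - s \<theta> i x) * F \<theta> x))" for q i
      by (rule Bochner_Integration.integrable_bound[OF intip[of q]])
        (use b in \<open>auto simp: abs_mult[of "ip _ _ _"] intro!: mult_left_le\<close>)
    have sc: "0 \<le> sin \<theta> * cos \<theta>" using \<theta> by (simp add: sin_ge_zero cos_ge_zero)
    have gram: "ip J (z' \<theta> i) (z \<theta> l) = sin \<theta> * cos \<theta> * (ip J (v i) (v l) - ip J (u i) (u l))"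
      if "i \<in> I" "l \<in> I" for i l
      unfolding ipz' unfolding ip_commute[of J _ "z \<theta> l"] unfolding ipz
      using orth that by (simp add: ip_commute[of J "v l"] ip_commute[of J "w l"] ip_commute[of J "u l" "u i"] algebra_simps)
    have gram0: "0 \<le> ip J (z' \<theta> i) (z \<theta> l)" if "i \<in> I" "l \<in> I" for i l
      unfolding gram[OF that] using that diag off sc by (cases "i = l") auto
    have "(\<integral>x. F' \<theta> x \<partial>gauss J) = (\<integral>x. (\<Sum>i\<in>I. - \<beta> * (ip J (z' \<theta> i) x * ((1 - s \<theta> i x) * F \<theta> x))) \<partial>gauss J)"
      unfolding F'_def by (simp add: sum_distrib_right mult.assoc)
    also have "\<dots> = (\<Sum>i\<in>I. - \<beta> * (\<integral>x. ip J (z' \<theta> i) x * ((1 - s \<theta> i x) * F \<theta> x) \<partial>gauss J))"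
      using int by (subst Bochner_Integration.integral_sum) auto
    \<comment> \<open>The minus sign in \<open>F'\<close> cancels the one in front of the sum in
      \<open>softprod_by_parts\<close>; the diagonal term is gone because
      \<open>z' \<theta> i\<close> is orthogonal to \<open>z \<theta> i\<close>.\<close>
    also have "\<dots> = (\<Sum>i\<in>I. \<beta>\<^sup>2 * (\<Sum>l\<in>I. ip J (z' \<theta> i) (z \<theta> l) *
        (\<integral>x. (1 - s \<theta> i x) * (1 - s \<theta> l x) * F \<theta> x \<partial>gauss J)))"
    proof (rule sum.cong[OF refl])
      fix i assume i: "i \<in> I"
      have "ip J (z' \<theta> i) (z \<theta> i) = 0" using gram[OF i i] diag[OF i] by simp
      then show "- \<beta> * (\<integral>x. ip J (z' \<theta> i) x * ((1 - s \<theta> i x) * F \<theta> x) \<partial>gauss J) =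
        \<beta>\<^sup>2 * (\<Sum>l\<in>I. ip J (z' \<theta> i) (z \<theta> l) * (\<integral>x. (1 - s \<theta> i x) * (1 - s \<theta> l x) * F \<theta> x \<partial>gauss J))"
        unfolding s_def F_def softprod_by_parts[OF fin i] by (simp add: power2_eq_square)
    qed
    also have "\<dots> \<ge> 0"
      using gram0 s f by (intro sum_nonneg mult_nonneg_nonneg Bochner_Integration.integral_nonneg) (auto intro: less_imp_le)
    finally show ?thesis .
  qed
  have "(\<integral>x. F 0 x \<partial>gauss J) \<le> (\<integral>x. F (pi / 2) x \<partial>gauss J)"
    by (rule DERIV_nonneg_imp_nondecreasing) (use D nonneg in auto)
  then show ?thesis unfolding F_def z_def by simp
qed

text \<open>The shift by \<open>1 / real (Suc n)\<close>, multiplied by the squared steepness, still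
  tends to infinity at \<open>a = 0\<close>. So the limit is the indicator of the closed half-line,
  and points on the boundary need no separate argument.\<close>

lemma sigm_steep_tendsto:
  "(\<lambda>n. sigm ((real (Suc n))\<^sup>2 * (a + 1 / real (Suc n)))) \<longlonglongrightarrow> (if 0 \<le> a then 1 else 0)"
proof -
  have e: "(real (Suc n))\<^sup>2 * (a + 1 / real (Suc n)) = a * (real (Suc n))\<^sup>2 + real (Suc n)" for n
    by (simp add: field_simps power2_eq_square)
  consider "a = 0" | "a > 0" | "a < 0" by linarith
  then show ?thesis
  proof cases
    case 1
    then show ?thesis unfolding e sigm_def by simp real_asymp
  next
    case 2
    then show ?thesis unfolding e sigm_def by simp real_asymp
  next
    case 3
    then show ?thesis unfolding e sigm_def by simp real_asymp
  qed
qed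

text \<open>Orthogonality makes \<open>u\<close>, \<open>v\<close> and \<open>w\<close> independent
  families on one Gaussian space, as the interpolation requires. The common part \<open>w\<close>
  can carry constraints that the comparison is to leave alone. The smooth version passes to the
  limit by dominated convergence.\<close>

theorem slepian:
  fixes u v w :: "'i \<Rightarrow> nat \<Rightarrow> real" and t :: "'i \<Rightarrow> real"
  assumes fin: "finite I" "finite J"
    and "\<And>i l. i \<in> I \<Longrightarrow> l \<in> I \<Longrightarrow> ip J (u i) (v l) = 0"
      "\<And>i l. i \<in> I \<Longrightarrow> l \<in> I \<Longrightarrow> ip J (u i) (w l) = 0"
      "\<And>i l. i \<in> I \<Longrightarrow> l \<in> I \<Longrightarrow> ip J (v i) (w l) = 0"
    and "\<And>i. i \<in> I \<Longrightarrow> ip J (u i) (u i) = ip J (v i) (v i)"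
    and "\<And>i l. i \<in> I \<Longrightarrow> l \<in> I \<Longrightarrow> i \<noteq> l \<Longrightarrow> ip J (u i) (u l) \<le> ip J (v i) (v l)"
  shows "\<P>(x in gauss J. \<forall>i\<in>I. ip J (u i) x + ip J (w i) x \<le> t i) \<le>
    \<P>(x in gauss J. \<forall>i\<in>I. ip J (v i) x + ip J (w i) x \<le> t i)"
proof -
  interpret G: prob_space "gauss J" by (rule prob_space_gauss)
  define f where "f = (\<lambda>n z x. softprod I J ((real (Suc n))\<^sup>2) (\<lambda>i. t i + 1 / real (Suc n)) z x)"
  have lim: "(\<lambda>n. \<integral>x. f n z x \<partial>gauss J) \<longlonglongrightarrow> \<P>(x in gauss J. \<forall>i\<in>I. ip J (z i) x \<le> t i)" for z :: "'i \<Rightarrow> nat \<Rightarrow> real"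
  proof -
    have meas: "{x \<in> space (gauss J). \<forall>i\<in>I. ip J (z i) x \<le> t i} \<in> sets (gauss J)"
      using fin by measurable
    have "(\<lambda>n. \<integral>x. f n z x \<partial>gauss J) \<longlonglongrightarrow>
        (\<integral>x. indicator {x \<in> space (gauss J). \<forall>i\<in>I. ip J (z i) x \<le> t i} x \<partial>gauss J)"
    proof (rule integral_dominated_convergence[where w = "\<lambda>_. 1"])
      show "AE x in gauss J. (\<lambda>n. f n z x) \<longlonglongrightarrow>
          indicator {x \<in> space (gauss J). \<forall>i\<in>I. ip J (z i) x \<le> t i} x"
      proof (rule AE_I2)
        fix x assume x: "x \<in> space (gauss J)"
        have "(\<lambda>n. f n z x) \<longlonglongrightarrow> (\<Prod>i\<in>I. if 0 \<le> t i - ip J (z i) x then 1 else 0)"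
          unfolding f_def softprod_def
          using sigm_steep_tendsto[of "t _ - ip J (z _) x"]
          by (intro tendsto_prod) (simp add: algebra_simps)
        also have "(\<Prod>i\<in>I. if 0 \<le> t i - ip J (z i) x then 1 else 0) =
            (indicator {x \<in> space (gauss J). \<forall>i\<in>I. ip J (z i) x \<le> t i} x :: real)"
          using x fin by (auto simp: indicator_def)
        finally show "(\<lambda>n. f n z x) \<longlonglongrightarrow> indicator {x \<in> space (gauss J). \<forall>i\<in>I. ip J (z i) x \<le> t i} x" .
      qed
      show "AE x in gauss J. norm (f n z x) \<le> 1" for n
        unfolding f_def by (auto intro!: AE_I2 simp: softprod_bounds abs_of_nonneg simp del: of_nat_Suc)
      show "f n z \<in> borel_measurable (gauss J)" for n unfolding f_def by measurable
    qed (use meas in auto)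
    then show ?thesis using meas by simp
  qed
  have "\<P>(x in gauss J. \<forall>i\<in>I. ip J (\<lambda>j. u i j + w i j) x \<le> t i) \<le>
      \<P>(x in gauss J. \<forall>i\<in>I. ip J (\<lambda>j. v i j + w i j) x \<le> t i)"
    by (rule LIMSEQ_le[OF lim lim]) (auto simp: f_def intro!: integral_softprod_mono assms)
  then show ?thesis by (simp add: ip_add_left)
qed

subsection \<open>Gaussian tails\<close>

text \<open>The hypotheses on \<open>restrict\<close> say that \<open>P\<close> and \<open>Q\<close>
  read only their own coordinates. The same formulas then make sense on all three spaces, and the
  joint event becomes a rectangle under \<open>merge\<close>.\<close>

lemma gauss_indep:
  assumes fin: "finite I" "finite J" and disj: "I \<inter> J = {}"
    and meas: "{x \<in> space (gauss I). P x} \<in> sets (gauss I)" "{x \<in> space (gauss J). Q x} \<in> sets (gauss J)"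
    and dep: "\<And>x. P (restrict x I) = P x" "\<And>x. Q (restrict x J) = Q x"
  shows "\<P>(x in gauss (I \<union> J). P x \<and> Q x) = \<P>(x in gauss I. P x) * \<P>(x in gauss J. Q x)"
proof -
  interpret product_prob_space "\<lambda>_. std_normal_distribution" "I \<union> J" by (rule product_prob_space_std_normal)
  interpret GJ: prob_space "gauss J" by (rule prob_space_gauss)
  interpret GI: prob_space "gauss I" by (rule prob_space_gauss)
  let ?M = "gauss I \<Otimes>\<^sub>M gauss J"
  have d: "gauss (I \<union> J) = distr ?M (gauss (I \<union> J)) (merge I J)"
    unfolding gauss_def using distr_merge[OF disj fin] by simp
  have mm: "merge I J \<in> measurable ?M (gauss (I \<union> J))"
    unfolding gauss_def by measurable
  have rI: "(\<lambda>x. restrict x I) \<in> measurable (gauss (I \<union> J)) (gauss I)"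
    and rJ: "(\<lambda>x. restrict x J) \<in> measurable (gauss (I \<union> J)) (gauss J)"
    unfolding gauss_def by (auto intro!: measurable_restrict_subset)
  have "{x \<in> space (gauss (I \<union> J)). P x \<and> Q x} =
    ((\<lambda>x. restrict x I) -` {x \<in> space (gauss I). P x} \<inter> space (gauss (I \<union> J))) \<inter>
    ((\<lambda>x. restrict x J) -` {x \<in> space (gauss J). Q x} \<inter> space (gauss (I \<union> J)))"
    using dep measurable_space[OF rI] measurable_space[OF rJ] by auto
  then have s: "{x \<in> space (gauss (I \<union> J)). P x \<and> Q x} \<in> sets (gauss (I \<union> J))"
    using measurable_sets[OF rI meas(1)] measurable_sets[OF rJ meas(2)] by auto
  have r: "restrict (merge I J (x, y)) I = x" "restrict (merge I J (x, y)) J = y"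
    if "x \<in> extensional I" "y \<in> extensional J" for x y
    using that disj by (auto simp: fun_eq_iff merge_def extensional_def)
  have "measure (gauss (I \<union> J)) {x \<in> space (gauss (I \<union> J)). P x \<and> Q x} =
    measure ?M (merge I J -` {x \<in> space (gauss (I \<union> J)). P x \<and> Q x} \<inter> space ?M)"
    by (subst d, rule measure_distr[OF mm]) (use s in simp)
  also have "merge I J -` {x \<in> space (gauss (I \<union> J)). P x \<and> Q x} \<inter> space ?M =
      {x \<in> space (gauss I). P x} \<times> {x \<in> space (gauss J). Q x}"
  proof (rule Set.set_eqI)
    fix p :: "(nat \<Rightarrow> real) \<times> (nat \<Rightarrow> real)"
    obtain x y where p: "p = (x, y)" by (cases p)
    show "p \<in> merge I J -` {x \<in> space (gauss (I \<union> J)). P x \<and> Q x} \<inter> space ?M \<longleftrightarrow>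
        p \<in> {x \<in> space (gauss I). P x} \<times> {x \<in> space (gauss J). Q x}"
    proof (cases "x \<in> extensional I \<and> y \<in> extensional J")
      case True
      then have "P (merge I J (x, y)) = P x" "Q (merge I J (x, y)) = Q y"
        using dep(1)[of "merge I J (x, y)"] dep(2)[of "merge I J (x, y)"] r[of x y] by auto
      then show ?thesis using True measurable_space[OF mm, of p]
        by (simp add: p space_pair_measure space_gauss)
    qed (auto simp: p space_pair_measure space_gauss)
  qed
  also have "measure ?M \<dots> = measure (gauss I) {x \<in> space (gauss I). P x} * measure (gauss J) {x \<in> space (gauss J). Q x}"
    using meas by (simp add: measure_def GJ.emeasure_pair_measure_Times enn2real_mult)
  finally show ?thesis .
qed

lemma gauss_restrict:
  assumes "finite J" "I \<subseteq> J"
    and "{x \<in> space (gauss I). P x} \<in> sets (gauss I)" and "\<And>x. P (restrict x I) = P x"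
  shows "\<P>(x in gauss J. P x) = \<P>(x in gauss I. P x)"
proof -
  interpret GJ: prob_space "gauss (J - I)" by (rule prob_space_gauss)
  have "I \<union> (J - I) = J" using assms by auto
  moreover have "finite I" using assms finite_subset by blast
  ultimately show ?thesis
    using gauss_indep[of I "J - I" P "\<lambda>_. True"] assms GJ.prob_space by (simp add: sets.top)
qed

lemma ip_restrict [simp]: "ip J u (restrict x J) = ip J u x"
  by (simp add: ip_def)

lemma ip_mono_neutral:
  "finite J \<Longrightarrow> I \<subseteq> J \<Longrightarrow> (\<And>j. j \<in> J - I \<Longrightarrow> u j = 0) \<Longrightarrow> ip J u x = ip I u x"
  unfolding ip_def by (rule sum.mono_neutral_right) auto

lemma ip_cong: "(\<And>j. j \<in> J \<Longrightarrow> u j * x j = v j * y j) \<Longrightarrow> ip J u x = ip J v y"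
  unfolding ip_def by (auto intro!: sum.cong)

lemma ip_single: "finite J \<Longrightarrow> N \<in> J \<Longrightarrow> ip J (\<lambda>j. if j = N then c else 0) x = c * x N"
  unfolding ip_def by (subst sum.remove[of _ N]) auto

lemma prob_gauss_component:
  assumes "j \<in> J" "A \<in> sets borel"
  shows "\<P>(x in gauss J. x j \<in> A) = measure std_normal_distribution A"
proof -
  interpret product_prob_space "\<lambda>_. std_normal_distribution" J by (rule product_prob_space_std_normal)
  show ?thesis
    using emeasure_PiM_Collect_single[of j A] assms unfolding gauss_def by (simp add: measure_def)
qed

section \<open>The one-dimensional normal tail\<close>

lemma normal_tail_antimono: "a \<le> b \<Longrightarrow> normal_tail b \<le> normal_tail a"
proof -
  interpret prob_space std_normal_distribution by (rule prob_space_std_normal)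
  show "a \<le> b \<Longrightarrow> ?thesis" unfolding normal_tail_def by (rule finite_measure_mono) auto
qed

lemma normal_tail_le_1: "normal_tail t \<le> 1" and normal_tail_nonneg: "0 \<le> normal_tail t"
proof -
  interpret prob_space std_normal_distribution by (rule prob_space_std_normal)
  show "normal_tail t \<le> 1" "0 \<le> normal_tail t" unfolding normal_tail_def by simp_all
qed

lemma ennreal_normal_tail:
  "ennreal (normal_tail t) = (\<integral>\<^sup>+x. ennreal (std_normal_density x) * indicator {t<..} x \<partial>lborel)"
proof -
  interpret prob_space std_normal_distribution by (rule prob_space_std_normal)
  have "ennreal (normal_tail t) = emeasure std_normal_distribution {t<..}"
    unfolding normal_tail_def by (simp add: emeasure_eq_measure)
  then show ?thesis by (simp add: emeasure_density)
qed

lemma std_normal_null_singleton: "measure std_normal_distribution {t} = 0"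
  by (simp add: measure_def emeasure_density nn_integral_cmult_indicator[of _ lborel] nn_integral_indicator_singleton)

lemma measure_std_normal_atLeast: "measure std_normal_distribution {t..} = normal_tail t"
proof -
  interpret prob_space std_normal_distribution by (rule prob_space_std_normal)
  have "measure std_normal_distribution ({t} \<union> {t<..}) = measure std_normal_distribution {t} + normal_tail t"
    unfolding normal_tail_def by (rule finite_measure_Union) auto
  moreover have "{t} \<union> {t<..} = {t..}" by auto
  ultimately show ?thesis by (simp add: std_normal_null_singleton)
qed

lemma measure_std_normal_atMost: "measure std_normal_distribution {..t} = 1 - normal_tail t"
proof -
  interpret prob_space std_normal_distribution by (rule prob_space_std_normal)
  have "{..t} = space std_normal_distribution - {t<..}" by auto
  then show ?thesis unfolding normal_tail_def using prob_compl[of "{t<..}"] by simp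
qed

lemma measure_std_normal_atMost_uminus: "measure std_normal_distribution {..-t} = normal_tail t"
proof -
  interpret prob_space std_normal_distribution by (rule prob_space_std_normal)
  have "emeasure std_normal_distribution {..-t} = (\<integral>\<^sup>+x. ennreal (std_normal_density x) * indicator {..-t} x \<partial>lborel)"
    by (simp add: emeasure_density)
  also have "\<dots> = (\<integral>\<^sup>+x. ennreal (std_normal_density (0 + (-1) * x)) * indicator {..-t} (0 + (-1) * x) \<partial>lborel)"
    by (subst nn_integral_real_affine[where c = "-1" and t = 0]) auto
  also have "\<dots> = (\<integral>\<^sup>+x. ennreal (std_normal_density x) * indicator {t..} x \<partial>lborel)"
    by (intro nn_integral_cong) (auto simp: indicator_def std_normal_density_def)
  also have "\<dots> = emeasure std_normal_distribution {t..}"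
    by (simp add: emeasure_density)
  finally show ?thesis by (simp add: measure_std_normal_atLeast[symmetric] measure_def)
qed

lemma normal_tail_0: "normal_tail 0 = 1 / 2"
  using measure_std_normal_atMost[of 0] measure_std_normal_atMost_uminus[of 0] by simp

text \<open>Translation by \<open>b\<close> multiplies the density by
  \<open>exp (- b^2 / 2) * exp (- b * x)\<close>, and the last factor is at most 1 for
  \<open>x\<close> above \<open>a\<close>. This is the device that turns an additive margin in a
  threshold into a multiplicative gain.\<close>

lemma normal_tail_shift:
  assumes "0 \<le> a" "0 \<le> b"
  shows "normal_tail (a + b) \<le> exp (- b\<^sup>2 / 2) * normal_tail a"
proof -
  have "ennreal (normal_tail (a + b)) = (\<integral>\<^sup>+x. ennreal (std_normal_density (b + 1 * x)) * indicator {a + b<..} (b + 1 * x) \<partial>lborel)"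
    unfolding ennreal_normal_tail by (subst nn_integral_real_affine[where c = 1 and t = b]) auto
  also have "\<dots> \<le> (\<integral>\<^sup>+x. ennreal (exp (- b\<^sup>2 / 2)) * (ennreal (std_normal_density x) * indicator {a<..} x) \<partial>lborel)"
  proof (intro nn_integral_mono)
    fix x
    show "ennreal (std_normal_density (b + 1 * x)) * indicator {a + b<..} (b + 1 * x)
      \<le> ennreal (exp (- b\<^sup>2 / 2)) * (ennreal (std_normal_density x) * indicator {a<..} x)"
    proof (cases "a < x")
      case True
      have "exp (- ((b + x)\<^sup>2 / 2)) \<le> exp (- b\<^sup>2 / 2) * exp (- (x\<^sup>2 / 2))"
        using True assms mult_nonneg_nonneg[of b x] by (simp add: exp_add[symmetric] power2_sum field_simps)
      then have "std_normal_density (b + x) \<le> exp (- b\<^sup>2 / 2) * std_normal_density x"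
        unfolding std_normal_density_def by (simp add: field_simps)
      then show ?thesis using True
        by (simp add: ennreal_mult[symmetric] normal_density_nonneg ennreal_leI add.commute indicator_def)
    qed simp
  qed
  also have "\<dots> = ennreal (exp (- b\<^sup>2 / 2) * normal_tail a)"
    by (simp add: nn_integral_cmult ennreal_normal_tail[symmetric] ennreal_mult normal_tail_nonneg)
  finally show ?thesis using normal_tail_nonneg by (simp add: ennreal_le_iff)
qed

lemma normal_tail_le_exp: "0 \<le> t \<Longrightarrow> normal_tail t \<le> exp (- t\<^sup>2 / 2)"
  using normal_tail_shift[of 0 t] normal_tail_nonneg[of t] by (simp add: normal_tail_0)

text \<open>Only the interval from \<open>t\<close> to \<open>t + 1\<close> is kept, where the
  density is smallest at the right end.\<close>

lemma normal_tail_ge_density: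
  assumes "0 \<le> t" shows "std_normal_density (t + 1) \<le> normal_tail t"
proof -
  have "ennreal (std_normal_density (t + 1)) = (\<integral>\<^sup>+x. ennreal (std_normal_density (t + 1)) * indicator {t<..t+1} x \<partial>lborel)"
    by (simp add: nn_integral_cmult_indicator)
  also have "\<dots> \<le> ennreal (normal_tail t)"
    unfolding ennreal_normal_tail
  proof (intro nn_integral_mono)
    fix x
    have "std_normal_density (t + 1) \<le> std_normal_density x" if "t < x" "x \<le> t + 1"
    proof -
      have "x\<^sup>2 \<le> (t + 1)\<^sup>2" using assms that by (intro power_mono) auto
      then show ?thesis unfolding std_normal_density_def by (simp add: divide_right_mono)
    qed
    then show "ennreal (std_normal_density (t + 1)) * indicator {t<..t + 1} x \<le> ennreal (std_normal_density x) * indicator {t<..} x"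
      by (auto simp: indicator_def ennreal_leI)
  qed
  finally show ?thesis using normal_tail_nonneg by (simp add: ennreal_le_iff)
qed

lemma normal_tail_pos: "0 < normal_tail t"
proof -
  have "0 < std_normal_density (max 0 t + 1)" by (simp add: normal_density_pos)
  also have "\<dots> \<le> normal_tail (max 0 t)" by (rule normal_tail_ge_density) simp
  also have "\<dots> \<le> normal_tail t" by (rule normal_tail_antimono) simp
  finally show ?thesis .
qed

text \<open>On the range of integration \<open>1 \<le> x / t\<close>, and \<open>x\<close> times the
  density has an elementary antiderivative. The factor \<open>1 / t\<close>, absent from
  \<open>normal_tail_le_exp\<close>, is what makes the union bound over \<open>d\<close> indices at
  level \<open>sqrt (2 * ln d)\<close> small.\<close>

lemma normal_tail_mills:
  assumes "0 < t" shows "normal_tail t \<le> std_normal_density t / t"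
proof -
  have "ennreal (normal_tail t) \<le> (\<integral>\<^sup>+x. ennreal (x / t * std_normal_density x) * indicator {t..} x \<partial>lborel)"
    unfolding ennreal_normal_tail
  proof (intro nn_integral_mono)
    fix x
    have "std_normal_density x \<le> x / t * std_normal_density x" if "t < x"
      using mult_right_mono[of 1 "x / t" "std_normal_density x"] that assms by (simp add: normal_density_nonneg)
    then show "ennreal (std_normal_density x) * indicator {t<..} x \<le> ennreal (x / t * std_normal_density x) * indicator {t..} x"
      by (auto simp: indicator_def ennreal_leI)
  qed
  also have "\<dots> = ennreal (0 - - std_normal_density t / t)"
  proof (rule nn_integral_FTC_atLeast[where F = "\<lambda>x. - std_normal_density x / t" and T = 0])
    show "((\<lambda>x. - std_normal_density x / t) has_real_derivative x / t * std_normal_density x) (at x)" for x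
      using DERIV_cdivide[OF DERIV_minus[OF std_normal_density_DERIV]] by simp
    show "((\<lambda>x. - std_normal_density x / t) \<longlongrightarrow> 0) at_top"
      using tendsto_divide[OF tendsto_minus[OF std_normal_density_tendsto_0(1)] tendsto_const[of t]] assms by simp
  qed (use assms in \<open>auto simp: normal_density_nonneg\<close>)
  finally show ?thesis
    using assms by (simp add: ennreal_le_iff normal_density_nonneg)
qed

text \<open>Lets an argument that has a strictly larger threshold at its disposal, and hence strict
  inequalities, reach \<open>t\<close> itself.\<close>

lemma normal_tail_right_continuous:
  assumes "\<And>e. 0 < e \<Longrightarrow> normal_tail (t + e) * c \<le> F"
  shows "normal_tail t * c \<le> F"
proof -
  interpret prob_space std_normal_distribution by (rule prob_space_std_normal)
  have "(\<lambda>n. measure std_normal_distribution {t + 1 / real (Suc n)<..}) \<longlonglongrightarrow>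
      measure std_normal_distribution (\<Union>n. {t + 1 / real (Suc n)<..})"
  proof (rule finite_Lim_measure_incseq)
    show "incseq (\<lambda>n. {t + 1 / real (Suc n)<..})"
      by (rule incseq_SucI) (auto intro!: le_less_trans[rotated] simp: frac_le)
  qed auto
  moreover have "(\<Union>n. {t + 1 / real (Suc n)<..}) = {t<..}"
  proof (intro equalityI subsetI)
    fix x assume "x \<in> {t<..}"
    then obtain n where "1 / real (Suc n) < x - t" using nat_approx_posE[of "x - t"] by auto
    then show "x \<in> (\<Union>n. {t + 1 / real (Suc n)<..})" by (auto intro!: exI[of _ n])
  qed (auto intro: less_trans[rotated] simp: add_pos_pos)
  ultimately have "(\<lambda>n. normal_tail (t + 1 / real (Suc n)) * c) \<longlonglongrightarrow> normal_tail t * c"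
    unfolding normal_tail_def by (auto intro!: tendsto_mult)
  then show ?thesis by (rule LIMSEQ_le_const2) (use assms in auto)
qed

section \<open>Linear functionals of a Gaussian vector and their maximum\<close>

lemma sets_gauss_ip_le [measurable]:
  "{x \<in> space (gauss J). ip J u x \<le> t} \<in> sets (gauss J)"
  "{x \<in> space (gauss J). t \<le> ip J u x} \<in> sets (gauss J)"
  by measurable

lemma ex_fresh_nat: "finite (J :: nat set) \<Longrightarrow> \<exists>N. \<forall>j\<in>J. j < N"
  using finite_nat_set_iff_bounded by auto

lemma ip_insert_zero:
  "finite J \<Longrightarrow> N \<notin> J \<Longrightarrow> ip (insert N J) (\<lambda>j. if j \<in> J then u j else 0) x = ip J u x"
  by (auto simp: ip_def intro!: sum.cong)

lemma ip_self_nonneg: "0 \<le> ip J u u"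
  by (simp add: ip_def sum_nonneg)

text \<open>Slepian's inequality with a single index, for which there is no off-diagonal condition,
  compares the functional with \<alpha> times a fresh coordinate \<open>N\<close>; this stands in
  for rotation invariance. Signs are flipped because the events of \<open>slepian\<close> are upper
  bounds.\<close>

lemma gauss_linear_tail:
  assumes J: "finite J" and b: "ip J u u \<le> b\<^sup>2" "0 < b" and t: "0 < t"
  shows "\<P>(x in gauss J. t \<le> ip J u x) \<le> normal_tail (t / b)"
proof -
  interpret J: prob_space "gauss J" by (rule prob_space_gauss)
  obtain N where N: "N \<notin> J" using J ex_new_if_finite infinite_UNIV_nat by blast
  define \<alpha> where "\<alpha> = sqrt (ip J u u)"
  have \<alpha>: "0 \<le> \<alpha>" "\<alpha>\<^sup>2 = ip J u u" "\<alpha> \<le> b"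
    using b ip_self_nonneg[of J u] by (auto simp: \<alpha>_def real_le_lsqrt)
  let ?J = "insert N J"
  interpret I: prob_space "gauss ?J" by (rule prob_space_gauss)
  have finJ: "finite ?J" using J by simp
  let ?u = "\<lambda>j. if j \<in> J then - u j else 0" and ?v = "\<lambda>j. if j = N then - \<alpha> else 0"
  have ipu: "ip ?J ?u x = - ip J u x" for x
    using ip_insert_zero[OF J N, of "\<lambda>j. - u j" x] by (simp add: ip_def sum_negf)
  have ipv: "ip ?J ?v x = - \<alpha> * x N" for x
    using ip_single[OF finJ, of N "- \<alpha>"] by simp
  have ipuu: "ip ?J ?u ?u = ip J u u"
    unfolding ipu by (simp add: ip_commute[of J u "\<lambda>j. if j \<in> J then _ j else _"]) (simp add: ip_def sum_negf)
  have "\<P>(x in gauss J. t \<le> ip J u x) = \<P>(x in gauss ?J. t \<le> ip J u x)"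
    by (rule gauss_restrict[symmetric]) (use J in auto)
  also have "\<dots> = \<P>(x in gauss ?J. \<forall>i\<in>{()}. ip ?J ?u x + ip ?J (\<lambda>_. 0) x \<le> - t)"
    unfolding ipu by (simp add: ip_def)
  also have "\<dots> \<le> \<P>(x in gauss ?J. \<forall>i\<in>{()}. ip ?J ?v x + ip ?J (\<lambda>_. 0) x \<le> - t)"
    by (rule slepian)
      (use N finJ \<alpha>(2) in \<open>auto simp: ipv ipuu power2_eq_square ip_commute[of ?J ?u ?v]\<close>,
       auto simp: ip_def)
  also have "\<dots> = \<P>(x in gauss ?J. t \<le> \<alpha> * x N)"
    unfolding ipv by (simp add: ip_def)
  also have "\<dots> \<le> normal_tail (t / b)"
  proof (cases "\<alpha> = 0")
    case True
    then show ?thesis using t normal_tail_nonneg by simp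
  next
    case False
    then have p: "0 < \<alpha>" using \<alpha> by simp
    have "\<P>(x in gauss ?J. t \<le> \<alpha> * x N) = \<P>(x in gauss ?J. x N \<in> {t / \<alpha>..})"
      using p by (simp add: divide_le_eq mult.commute)
    also have "\<dots> = normal_tail (t / \<alpha>)"
      by (subst prob_gauss_component) (auto simp: measure_std_normal_atLeast)
    also have "\<dots> \<le> normal_tail (t / b)"
      using p \<alpha> t by (intro normal_tail_antimono divide_left_mono) auto
    finally show ?thesis .
  qed
  finally show ?thesis .
qed

lemma gauss_abs_tail:
  assumes J: "finite J" and b: "ip J u u \<le> b\<^sup>2" "0 < b" and t: "0 < t"
  shows "\<P>(x in gauss J. t \<le> \<bar>ip J u x\<bar>) \<le> 2 * normal_tail (t / b)"
proof -
  interpret J: prob_space "gauss J" by (rule prob_space_gauss)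
  have n: "ip J (\<lambda>j. - u j) x = - ip J u x" for x by (simp add: ip_def sum_negf)
  have "{x \<in> space (gauss J). t \<le> \<bar>ip J u x\<bar>} =
    {x \<in> space (gauss J). t \<le> ip J u x} \<union> {x \<in> space (gauss J). t \<le> ip J (\<lambda>j. - u j) x}"
    unfolding n by auto
  then have "\<P>(x in gauss J. t \<le> \<bar>ip J u x\<bar>) \<le>
    \<P>(x in gauss J. t \<le> ip J u x) + \<P>(x in gauss J. t \<le> ip J (\<lambda>j. - u j) x)"
    using measure_Un_le[OF sets_gauss_ip_le(2) sets_gauss_ip_le(2)] by simp
  also have "\<dots> \<le> normal_tail (t / b) + normal_tail (t / b)"
    by (intro add_mono gauss_linear_tail J b t) (use b in \<open>simp add: ip_def\<close>)
  finally show ?thesis by simp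
qed

text \<open>Uncorrelated linear functionals of a Gaussian vector are independent; this is the case of equality
  of the covariances in Slepian's inequality.\<close>

lemma gauss_orthogonal_indep:
  assumes J: "finite J" and I: "finite I" and orth: "\<And>i. i \<in> I \<Longrightarrow> ip J a (h i) = 0"
    and \<alpha>: "ip J a a = \<alpha>\<^sup>2" "0 < \<alpha>"
  shows "normal_tail (t / \<alpha>) * \<P>(x in gauss J. \<forall>i\<in>I. \<bar>ip J (h i) x\<bar> \<le> l) \<le>
    \<P>(x in gauss J. t \<le> ip J a x \<and> (\<forall>i\<in>I. \<bar>ip J (h i) x\<bar> \<le> l))"
proof -
  obtain N where N: "N \<notin> J" using J ex_new_if_finite infinite_UNIV_nat by blast
  let ?J = "insert N J"
  have finJ: "finite ?J" using J by simp
  \<comment> \<open>\<open>None\<close> is the event on \<open>a\<close>; \<open>Some (i, 1)\<close>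
    and \<open>Some (i, -1)\<close> are the two halves of the bound on
    \<open>\<bar>ip J (h i) x\<bar>\<close>. In \<open>u\<close> the functional \<open>a\<close> is
    replaced by a fresh coordinate of equal variance, in \<open>v\<close> it is kept, and the bounds
    on the \<open>h i\<close> sit in the common part \<open>w\<close>, to which both are
    orthogonal.\<close>
  define T where "T = insert None (Some ` (I \<times> {-1, 1 :: real}))"
  define u where "u = (\<lambda>k :: ('a \<times> real) option. case k of None \<Rightarrow> (\<lambda>j. if j = N then - \<alpha> else 0) | Some _ \<Rightarrow> (\<lambda>_. 0))"
  define v where "v = (\<lambda>k :: ('a \<times> real) option. case k of None \<Rightarrow> (\<lambda>j. if j \<in> J then - a j else 0) | Some _ \<Rightarrow> (\<lambda>_. 0 :: real))"
  define w where "w = (\<lambda>k. case k of None \<Rightarrow> (\<lambda>_. 0) | Some (i, s) \<Rightarrow> (\<lambda>j. if j \<in> J then s * h i j else 0))"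
  define r where "r = (\<lambda>k :: ('a \<times> real) option. case k of None \<Rightarrow> - t | Some _ \<Rightarrow> l)"
  have zero: "ip K (\<lambda>_. 0) x = 0" "ip K x (\<lambda>_. 0) = 0" for K x by (simp_all add: ip_def)
  have uN: "ip ?J (u None) x = - \<alpha> * x N" for x
    unfolding u_def using ip_single[OF finJ, of N "- \<alpha>"] by simp
  have vN: "ip ?J (v None) x = - ip J a x" for x
    unfolding v_def using ip_insert_zero[OF J N, of "\<lambda>j. - a j" x] by (simp add: ip_def sum_negf)
  have wS: "ip ?J (w (Some (i, s))) x = s * ip J (h i) x" for i s x
    unfolding w_def using ip_insert_zero[OF J N, of "\<lambda>j. s * h i j" x] by (simp add: ip_scale_left)
  have uS: "u (Some p) = (\<lambda>_. 0)" "v (Some p) = (\<lambda>_. 0)" "w None = (\<lambda>_. 0)" for p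
    by (simp_all add: u_def v_def w_def)
  have vw: "ip J a (w (Some (i, s))) = s * ip J a (h i)" for i s
    unfolding w_def by (simp add: ip_def sum_distrib_left ac_simps)
  have vv: "ip J a (v None) = - ip J a a"
    unfolding v_def by (simp add: ip_def sum_negf)
  have vN0: "v None N = 0" "w (Some p) N = 0" for p
    using N by (simp_all add: v_def w_def split: prod.split)
  have uNN: "u None N = - \<alpha>" by (simp add: u_def)
  have sl: "\<P>(x in gauss ?J. \<forall>k\<in>T. ip ?J (u k) x + ip ?J (w k) x \<le> r k) \<le>
    \<P>(x in gauss ?J. \<forall>k\<in>T. ip ?J (v k) x + ip ?J (w k) x \<le> r k)"
  proof (rule slepian)
    show "finite T" using I by (simp add: T_def)
    show "ip ?J (u k) (v k') = 0" "ip ?J (u k) (w k') = 0" "ip ?J (v k) (w k') = 0"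
      if "k \<in> T" "k' \<in> T" for k k'
      using that orth by (cases k; cases k'; auto simp: T_def uN vN uS zero vN0 vw)+
    show "ip ?J (u k) (u k) = ip ?J (v k) (v k)" if "k \<in> T" for k
      using \<alpha> by (cases k; auto simp: uN vN uS zero vv uNN power2_eq_square)
    show "ip ?J (u k) (u k') \<le> ip ?J (v k) (v k')" if "k \<in> T" "k' \<in> T" "k \<noteq> k'" for k k'
      using that by (cases k; cases k'; auto simp: uS zero)
  qed (use finJ in auto)
  let ?P = "\<lambda>x. \<forall>i\<in>I. \<bar>ip J (h i) x\<bar> \<le> l"
  have wq: "(\<forall>k\<in>T. ip ?J (u k) x + ip ?J (w k) x \<le> r k) \<longleftrightarrow> ?P x \<and> t / \<alpha> \<le> x N" for x
    using \<alpha> by (auto simp: T_def uN wS uS zero r_def abs_le_iff divide_le_eq mult.commute)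
  have vq: "(\<forall>k\<in>T. ip ?J (v k) x + ip ?J (w k) x \<le> r k) \<longleftrightarrow> t \<le> ip J a x \<and> ?P x" for x
    by (auto simp: T_def vN wS uS zero r_def abs_le_iff)
  have meas: "{x \<in> space (gauss J). ?P x} \<in> sets (gauss J)"
    using I by measurable
  have meas2: "{x \<in> space (gauss J). t \<le> ip J a x \<and> ?P x} \<in> sets (gauss J)"
    using I by measurable
  have "normal_tail (t / \<alpha>) * \<P>(x in gauss J. ?P x) = \<P>(x in gauss (J \<union> {N}). ?P x \<and> t / \<alpha> \<le> x N)"
  proof (subst gauss_indep)
    show "{x \<in> space (gauss {N}). t / \<alpha> \<le> x N} \<in> sets (gauss {N})"
      using measurable_gauss_component[of N "{N}"] by measurable
    have "\<P>(x in gauss {N}. x N \<in> {t / \<alpha>..}) = normal_tail (t / \<alpha>)"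
      by (subst prob_gauss_component) (auto simp: measure_std_normal_atLeast)
    then show "normal_tail (t / \<alpha>) * \<P>(x in gauss J. ?P x) = \<P>(x in gauss J. ?P x) * \<P>(x in gauss {N}. t / \<alpha> \<le> x N)"
      by simp
  qed (use J N meas in auto)
  also have "\<dots> = \<P>(x in gauss ?J. \<forall>k\<in>T. ip ?J (u k) x + ip ?J (w k) x \<le> r k)"
    unfolding wq by simp
  also note sl
  also have "\<P>(x in gauss ?J. \<forall>k\<in>T. ip ?J (v k) x + ip ?J (w k) x \<le> r k) =
      \<P>(x in gauss J. t \<le> ip J a x \<and> ?P x)"
    unfolding vq by (rule gauss_restrict) (use J meas2 in auto)
  finally show ?thesis .
qed

text \<open>By independence of the two blocks, the left side is a lower bound for the probability
  that all sums are at most \<open>t + w\<close>. The comparison vector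
  \<open>sqrt \<mu> * Z + sqrt (1 - \<mu>) * Z i\<close> satisfies this only if
  \<open>Z \<le> - y\<close> or every \<open>Z i \<le> z\<close>, and the \<open>Z i\<close> are
  independent.\<close>

lemma gauss_max_lower_tail:
  fixes I :: "nat set"
  assumes fin: "finite J1" "finite J2" "finite I" and disj: "J1 \<inter> J2 = {}"
    and \<mu>: "0 \<le> \<mu>" "\<mu> < 1"
    and diag: "\<And>i. i \<in> I \<Longrightarrow> ip J1 (g i) (g i) + ip J2 (p i) (p i) = 1"
    and off: "\<And>i l. i \<in> I \<Longrightarrow> l \<in> I \<Longrightarrow> i \<noteq> l \<Longrightarrow> ip J1 (g i) (g l) + ip J2 (p i) (p l) \<le> \<mu>"
    and le: "t + w + sqrt \<mu> * y \<le> sqrt (1 - \<mu>) * z"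
  shows "\<P>(x in gauss J1. \<forall>i\<in>I. ip J1 (g i) x \<le> t) * \<P>(x in gauss J2. \<forall>i\<in>I. ip J2 (p i) x \<le> w)
    \<le> normal_tail y + (1 - normal_tail z) ^ card I"
proof -
  obtain N where N: "\<And>j. j \<in> J1 \<union> J2 \<Longrightarrow> j < N"
    using ex_fresh_nat[of "J1 \<union> J2"] fin by auto
  \<comment> \<open>\<open>N\<close> is the coordinate of the shared normal \<open>Z\<close>, and
    \<open>Suc (N + i)\<close> is that of the individual \<open>Z i\<close>; all of them lie above
    both blocks.\<close>
  define J3 where "J3 = insert N ((\<lambda>i. Suc (N + i)) ` I)"
  define J where "J = (J1 \<union> J2) \<union> J3"
  interpret J: prob_space "gauss J" by (rule prob_space_gauss)
  have finJ: "finite J" "finite J3" using fin by (auto simp: J_def J3_def)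
  have d3: "(J1 \<union> J2) \<inter> J3 = {}" using N by (fastforce simp: J3_def)
  define u where "u = (\<lambda>i j. if j \<in> J1 then g i j else if j \<in> J2 then p i j else 0)"
  define v where "v = (\<lambda>i j. if j = N then sqrt \<mu> else if j = Suc (N + i) then sqrt (1 - \<mu>) else 0)"
  have ipu: "ip J (u i) x = ip J1 (g i) x + ip J2 (p i) x" for i x
  proof -
    have "ip J (u i) x = ip (J1 \<union> J2) (u i) x"
      using finJ by (intro ip_mono_neutral) (auto simp: J_def u_def)
    also have "\<dots> = ip J1 (u i) x + ip J2 (u i) x"
      unfolding ip_def using fin disj by (simp add: sum.union_disjoint)
    also have "ip J1 (u i) x = ip J1 (g i) x" by (rule ip_cong) (simp add: u_def)
    also have "ip J2 (u i) x = ip J2 (p i) x" by (rule ip_cong) (use disj in \<open>auto simp: u_def\<close>)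
    finally show ?thesis .
  qed
  have ipuu: "ip J1 (g i) (u l) = ip J1 (g i) (g l)" "ip J2 (p i) (u l) = ip J2 (p i) (p l)" for i l
    using disj by (auto simp: u_def intro!: ip_cong)
  have ipv: "ip J (v i) x = sqrt \<mu> * x N + sqrt (1 - \<mu>) * x (Suc (N + i))" if "i \<in> I" for i x
  proof -
    have "ip J (v i) x = ip {N, Suc (N + i)} (v i) x"
      using finJ that by (intro ip_mono_neutral) (auto simp: J_def J3_def v_def)
    then show ?thesis by (simp add: ip_def v_def)
  qed
  have zero: "ip K (\<lambda>_. 0) x = 0" "ip K x (\<lambda>_. 0) = 0" for K x by (simp_all add: ip_def)
  have u0: "u l N = 0" "u l (Suc (N + i)) = 0" for l i
    using N[of N] N[of "Suc (N + i)"] by (auto simp: u_def)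
  have sl: "\<P>(x in gauss J. \<forall>i\<in>I. ip J (u i) x + ip J (\<lambda>_. 0) x \<le> t + w) \<le>
     \<P>(x in gauss J. \<forall>i\<in>I. ip J (v i) x + ip J (\<lambda>_. 0) x \<le> t + w)"
  proof (rule slepian)
    show "ip J (u i) (v l) = 0" if "i \<in> I" "l \<in> I" for i l
      using that by (subst ip_commute) (simp add: ipv u0)
    show "ip J (u i) (u i) = ip J (v i) (v i)" if "i \<in> I" for i
      using that diag \<mu> by (simp add: ipu ipuu ipv) (simp add: v_def)
    show "ip J (u i) (u l) \<le> ip J (v i) (v l)" if "i \<in> I" "l \<in> I" "i \<noteq> l" for i l
      using that off \<mu> by (simp add: ipu ipuu ipv) (simp add: v_def)
  qed (use fin finJ zero in auto)
  have meas: "{x \<in> space (gauss J1). \<forall>i\<in>I. ip J1 (g i) x \<le> t} \<in> sets (gauss J1)"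
    "{x \<in> space (gauss J2). \<forall>i\<in>I. ip J2 (p i) x \<le> w} \<in> sets (gauss J2)"
    using fin by measurable
  have mJ: "{x \<in> space (gauss J). x N \<le> - y} \<in> sets (gauss J)"
    "{x \<in> space (gauss J). \<forall>k\<in>(\<lambda>i. Suc (N + i)) ` I. x k \<in> {..z}} \<in> sets (gauss J)"
    "{x \<in> space (gauss J). \<forall>i\<in>I. ip J (u i) x \<le> t + w} \<in> sets (gauss J)"
  proof -
    have [measurable]: "(\<lambda>x. x N) \<in> borel_measurable (gauss J)"
      "\<And>k. k \<in> (\<lambda>i. Suc (N + i)) ` I \<Longrightarrow> (\<lambda>x. x k) \<in> borel_measurable (gauss J)"
      by (auto simp: J_def J3_def intro!: measurable_gauss_component)
    have f: "finite ((\<lambda>i. Suc (N + i)) ` I)" using fin by simp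
    show "{x \<in> space (gauss J). x N \<le> - y} \<in> sets (gauss J)" by measurable
    show "{x \<in> space (gauss J). \<forall>k\<in>(\<lambda>i. Suc (N + i)) ` I. x k \<in> {..z}} \<in> sets (gauss J)"
      using f by measurable
    show "{x \<in> space (gauss J). \<forall>i\<in>I. ip J (u i) x \<le> t + w} \<in> sets (gauss J)"
      using fin by measurable
  qed
  have "\<P>(x in gauss J1. \<forall>i\<in>I. ip J1 (g i) x \<le> t) * \<P>(x in gauss J2. \<forall>i\<in>I. ip J2 (p i) x \<le> w) =
    \<P>(x in gauss (J1 \<union> J2). (\<forall>i\<in>I. ip J1 (g i) x \<le> t) \<and> (\<forall>i\<in>I. ip J2 (p i) x \<le> w))"
    by (rule gauss_indep[symmetric]) (use fin disj meas in auto)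
  also have "\<dots> = \<P>(x in gauss J. (\<forall>i\<in>I. ip J1 (g i) x \<le> t) \<and> (\<forall>i\<in>I. ip J2 (p i) x \<le> w))"
  proof (rule gauss_restrict[symmetric])
    have [measurable]: "ip J1 u \<in> borel_measurable (gauss (J1 \<union> J2))" "ip J2 u \<in> borel_measurable (gauss (J1 \<union> J2))" for u
      unfolding ip_def[abs_def] by (auto intro!: borel_measurable_sum borel_measurable_times measurable_gauss_component)
    show "{x \<in> space (gauss (J1 \<union> J2)). (\<forall>i\<in>I. ip J1 (g i) x \<le> t) \<and> (\<forall>i\<in>I. ip J2 (p i) x \<le> w)} \<in> sets (gauss (J1 \<union> J2))"
      using fin by measurable
    have "ip J1 u (restrict x (J1 \<union> J2)) = ip J1 u x" "ip J2 u (restrict x (J1 \<union> J2)) = ip J2 u x" for u x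
      by (auto intro!: ip_cong)
    then show "((\<forall>i\<in>I. ip J1 (g i) (restrict x (J1 \<union> J2)) \<le> t) \<and> (\<forall>i\<in>I. ip J2 (p i) (restrict x (J1 \<union> J2)) \<le> w)) =
      ((\<forall>i\<in>I. ip J1 (g i) x \<le> t) \<and> (\<forall>i\<in>I. ip J2 (p i) x \<le> w))" for x by simp
  qed (use finJ in \<open>auto simp: J_def\<close>)
  also have "\<dots> \<le> \<P>(x in gauss J. \<forall>i\<in>I. ip J (u i) x \<le> t + w)"
    by (rule J.finite_measure_mono) (use mJ(3) in \<open>auto simp: ipu intro: add_mono\<close>)
  also have "\<dots> \<le> \<P>(x in gauss J. \<forall>i\<in>I. ip J (v i) x \<le> t + w)"
    using sl by (simp add: zero)
  also have "\<dots> \<le> measure (gauss J) ({x \<in> space (gauss J). x N \<le> - y} \<union>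
      {x \<in> space (gauss J). \<forall>k\<in>(\<lambda>i. Suc (N + i)) ` I. x k \<in> {..z}})"
      (is "measure _ ?V \<le> measure _ ?U")
  proof (rule J.finite_measure_mono)
    show "?V \<subseteq> ?U"
    proof (rule subsetI)
      fix x assume x: "x \<in> ?V"
      have "x (Suc (N + i)) \<le> z" if i: "i \<in> I" and y: "\<not> x N \<le> - y" for i
      proof -
        have "sqrt \<mu> * x N + sqrt (1 - \<mu>) * x (Suc (N + i)) \<le> t + w" using x i ipv by auto
        moreover have "sqrt \<mu> * - y \<le> sqrt \<mu> * x N" using y \<mu> by (intro mult_left_mono) auto
        ultimately have "sqrt (1 - \<mu>) * x (Suc (N + i)) \<le> sqrt (1 - \<mu>) * z" using le by simp
        then show ?thesis using \<mu> by simp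
      qed
      then show "x \<in> ?U"
        using x by auto
    qed
  qed (use mJ in auto)
  also have "\<dots> \<le> \<P>(x in gauss J. x N \<le> - y) + \<P>(x in gauss J. \<forall>k\<in>(\<lambda>i. Suc (N + i)) ` I. x k \<in> {..z})"
    by (rule measure_Un_le) (use mJ in auto)
  also have "\<P>(x in gauss J. x N \<le> - y) = normal_tail y"
    using prob_gauss_component[of N J "{..-y}"] by (simp add: J_def J3_def measure_std_normal_atMost_uminus)
  also have "\<P>(x in gauss J. \<forall>k\<in>(\<lambda>i. Suc (N + i)) ` I. x k \<in> {..z}) = (1 - normal_tail z) ^ card I"
  proof -
    interpret product_prob_space "\<lambda>_. std_normal_distribution" J by (rule product_prob_space_std_normal)
    have "emeasure (gauss J) {x \<in> space (gauss J). \<forall>k\<in>(\<lambda>i. Suc (N + i)) ` I. x k \<in> {..z}} =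
      (\<Prod>k\<in>(\<lambda>i. Suc (N + i)) ` I. emeasure std_normal_distribution {..z})"
      unfolding gauss_def by (rule emeasure_PiM_Collect) (use fin in \<open>auto simp: J_def J3_def\<close>)
    also have "\<dots> = ennreal ((1 - normal_tail z) ^ card I)"
      by (simp add: card_image inj_on_def finite_measure.emeasure_eq_measure[OF prob_space.finite_measure[OF prob_space_std_normal]] measure_std_normal_atMost ennreal_power normal_tail_le_1)
    finally show ?thesis by (simp add: measure_def normal_tail_le_1)
  qed
  finally show ?thesis by simp
qed

subsection \<open>One round on one machine\<close>

lemma ip_diff_left: "ip J (\<lambda>j. u j - v j) w = ip J u w - ip J v w"
  by (simp add: ip_def algebra_simps sum_subtractf)

lemma ip_diff_right: "ip J w (\<lambda>j. u j - v j) = ip J w u - ip J w v"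
  by (simp add: ip_def algebra_simps sum_subtractf)

lemma ip_sum_left: "ip J (\<lambda>j. \<Sum>k\<in>s. c k * u k j) w = (\<Sum>k\<in>s. c k * ip J (u k) w)"
  unfolding ip_def sum_distrib_left sum_distrib_right by (subst sum.swap) (simp add: mult.assoc)

lemma ip_sum_right: "ip J w (\<lambda>j. \<Sum>k\<in>s. c k * u k j) = (\<Sum>k\<in>s. c k * ip J w (u k))"
  by (subst ip_commute, subst ip_sum_left) (simp add: ip_commute)

lemma ip_self_eq_0:
  assumes "finite J" "ip J u u = 0" shows "ip J u v = 0"
proof -
  have "\<forall>j\<in>J. u j * u j = 0"
    using assms by (subst sum_nonneg_eq_0_iff[symmetric]) (auto simp: ip_def)
  then show ?thesis by (simp add: ip_def)
qed

text \<open>Gram-Schmidt: both \<open>v\<close> and the new vector are projected off the old ones,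
  and then the component of the first residual along the second is removed.\<close>

lemma ex_projection:
  assumes J: "finite J" and "finite s"
  shows "\<exists>b. \<forall>l\<in>s. ip J (\<lambda>j. v j - (\<Sum>k\<in>s. b k * x k j)) (x l) = 0"
  using \<open>finite s\<close>
proof (induction s arbitrary: v rule: finite_induct)
  case (insert i s)
  obtain b where b: "\<forall>l\<in>s. ip J (\<lambda>j. v j - (\<Sum>k\<in>s. b k * x k j)) (x l) = 0"
    using insert.IH by blast
  obtain c where c: "\<forall>l\<in>s. ip J (\<lambda>j. x i j - (\<Sum>k\<in>s. c k * x k j)) (x l) = 0"
    using insert.IH by blast
  define rv where "rv = (\<lambda>j. v j - (\<Sum>k\<in>s. b k * x k j))"
  define ri where "ri = (\<lambda>j. x i j - (\<Sum>k\<in>s. c k * x k j))"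
  \<comment> \<open>If \<open>ri\<close> has norm 0, division by zero gives \<open>t = 0\<close>.
    This is the right value, since then every inner product with \<open>ri\<close> vanishes.\<close>
  define t where "t = ip J rv ri / ip J ri ri"
  define b' where "b' = (\<lambda>k. if k = i then t else b k - t * c k)"
  have res: "(\<lambda>j. v j - (\<Sum>k\<in>insert i s. b' k * x k j)) = (\<lambda>j. rv j - t * ri j)"
  proof
    fix j
    have "(\<Sum>k\<in>s. b' k * x k j) = (\<Sum>k\<in>s. b k * x k j - t * (c k * x k j))"
      using insert.hyps by (intro sum.cong) (auto simp: b'_def algebra_simps)
    then show "v j - (\<Sum>k\<in>insert i s. b' k * x k j) = rv j - t * ri j"
      using insert.hyps by (simp add: b'_def rv_def ri_def sum_subtractf sum_distrib_left algebra_simps)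
  qed
  have orth: "ip J (\<lambda>j. rv j - t * ri j) (x l) = 0" if "l \<in> s" for l
    using that b c by (simp add: ip_diff_left ip_scale_left rv_def ri_def)
  have "ip J rv ri - t * ip J ri ri = 0"
    using ip_self_eq_0[OF J, of ri rv]
    by (cases "ip J ri ri = 0") (simp_all add: t_def ip_commute[of J rv ri])
  then have "ip J (\<lambda>j. rv j - t * ri j) ri = 0"
    by (simp add: ip_diff_left ip_scale_left)
  moreover have "ip J (\<lambda>j. rv j - t * ri j) ri = ip J (\<lambda>j. rv j - t * ri j) (x i)"
    unfolding ri_def[THEN fun_cong, abs_def, symmetric]
    using orth by (subst (2) ri_def) (simp add: ip_diff_right ip_sum_right)
  ultimately show ?case
    using orth by (intro exI[of _ b']) (simp only: res, auto)
qed simp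

section \<open>Scalar inequalities for the coherence and the Gram defect after projecting out q
  columns\<close>

definition delta_at :: "real \<Rightarrow> real \<Rightarrow> real" where
  "delta_at q \<mu> = q * \<mu>\<^sup>2 / (1 - (q - 1) * \<mu>)"

lemma delta_eq_delta_at: "delta K \<mu> = delta_at (real K - 1) \<mu>"
  by (simp add: delta_def delta_at_def algebra_simps)

lemma coherence_condition:
  fixes K :: nat
  assumes "1 \<le> K" "0 \<le> \<mu>" "\<mu> < 1 / (2 * real K - 1)"
  shows "(2 * real K - 1) * \<mu> < 1" "\<mu> < 1" "2 \<le> K \<Longrightarrow> 3 * \<mu> < 1"
proof -
  have K: "real K \<ge> 1" using assms by simp
  show 1: "(2 * real K - 1) * \<mu> < 1" using assms K by (simp add: field_simps)
  have "1 * \<mu> \<le> (2 * real K - 1) * \<mu>" using K assms by (intro mult_right_mono) auto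
  with 1 show "\<mu> < 1" by simp
  assume "2 \<le> K"
  then have "3 * \<mu> \<le> (2 * real K - 1) * \<mu>" using assms by (intro mult_right_mono) auto
  with 1 show "3 * \<mu> < 1" by simp
qed

lemma denom_pos:
  fixes q K \<mu> :: real
  assumes "q \<le> K - 1" "0 \<le> \<mu>" "(2 * K - 1) * \<mu> < 1" "1 \<le> K"
  shows "0 < 1 - (q - 1) * \<mu>"
proof -
  have "(q - 1) * \<mu> \<le> (2 * K - 1) * \<mu>" using assms by (intro mult_right_mono) auto
  then show ?thesis using assms by linarith
qed

lemma delta_at_mono:
  fixes q K \<mu> :: real
  assumes "0 \<le> q" "q \<le> K - 1" "0 \<le> \<mu>" "(2 * K - 1) * \<mu> < 1" "1 \<le> K"
  shows "delta_at q \<mu> \<le> delta_at (K - 1) \<mu>" "0 \<le> delta_at q \<mu>"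
proof -
  have p: "0 < 1 - (q - 1) * \<mu>" "0 < 1 - (K - 1 - 1) * \<mu>"
    using assms denom_pos[of q K] denom_pos[of "K - 1" K] by auto
  have "(q - 1) * \<mu> \<le> (K - 1 - 1) * \<mu>" using assms by (intro mult_right_mono) auto
  then show "delta_at q \<mu> \<le> delta_at (K - 1) \<mu>"
    unfolding delta_at_def using assms p by (intro frac_le mult_right_mono) auto
  show "0 \<le> delta_at q \<mu>" using p assms by (simp add: delta_at_def)
qed

lemma delta_at_le_mu:
  fixes q K \<mu> :: real
  assumes "0 \<le> q" "q \<le> K - 1" "0 \<le> \<mu>" "(2 * K - 1) * \<mu> < 1" "1 \<le> K"
  shows "delta_at q \<mu> \<le> \<mu>"
proof -
  have p: "0 < 1 - (q - 1) * \<mu>" using assms denom_pos[of q K] by auto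
  have "2 * q * \<mu> \<le> (2 * K - 1) * \<mu>" using assms by (intro mult_right_mono) auto
  then have "q * \<mu> \<le> 1 - (q - 1) * \<mu>" using assms by (simp add: algebra_simps)
  then have "\<mu> * (q * \<mu>) \<le> \<mu> * (1 - (q - 1) * \<mu>)" using assms by (intro mult_left_mono) auto
  then show ?thesis using p by (simp add: delta_at_def divide_le_eq power2_eq_square algebra_simps)
qed

text \<open>The loss in the signal part that comes from projecting out \<open>q\<close> columns is compensated
  by the columns that no longer interfere.\<close>

lemma signal_gap_ge:
  fixes q K \<mu> :: real
  assumes "0 \<le> q" "q \<le> K - 1" "0 \<le> \<mu>" "(2 * K - 1) * \<mu> < 1" "1 \<le> K"
  shows "(K - q) * delta_at q \<mu> \<le> q * \<mu>"
    "1 - (2 * K - 1) * \<mu> \<le> 1 - (2 * (K - q) - 1) * \<mu> - 2 * (K - q) * delta_at q \<mu>"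
proof -
  have p: "0 < 1 - (q - 1) * \<mu>" using assms denom_pos[of q K] by auto
  have "1 * (K - 1) * \<mu> \<le> (2 * K - 1) * \<mu>" using assms by (intro mult_right_mono) auto
  then have "(K - q) * \<mu> \<le> 1 - (q - 1) * \<mu>" using assms by (simp add: algebra_simps)
  then have "q * \<mu> * ((K - q) * \<mu>) \<le> q * \<mu> * (1 - (q - 1) * \<mu>)"
    using assms by (intro mult_left_mono) auto
  then show 1: "(K - q) * delta_at q \<mu> \<le> q * \<mu>"
    using p by (simp add: delta_at_def divide_le_eq power2_eq_square algebra_simps)
  then show "1 - (2 * K - 1) * \<mu> \<le> 1 - (2 * (K - q) - 1) * \<mu> - 2 * (K - q) * delta_at q \<mu>"
    by (simp add: algebra_simps)
qed

text \<open>In units of the critical level, \<rho> times the relative signal gap plus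
  \<open>1 - \<rho>\<close> times the relative gain from noise has to reach 1. For
  \<open>q = 0\<close> both ratios are 1. Otherwise put
  \<open>g = q * \<mu> / (1 - (q - 1) * \<mu>)\<close>, so that the defect is
  \<open>g * \<mu>\<close>: the signal ratio is at least \<open>1 + 2 * g\<close>, the noise ratio
  at least \<open>1 - 3 * g * \<mu>\<close>, and the last hypothesis on \<rho> is exactly the
  balance of gain and loss.\<close>

lemma signal_noise_tradeoff:
  fixes q K \<mu> \<rho> :: real
  assumes q: "q = 0 \<or> 1 \<le> q" "q \<le> K - 1" and \<mu>: "0 \<le> \<mu>" "(2 * K - 1) * \<mu> < 1" "1 \<le> K"
    and \<rho>: "0 \<le> \<rho>" "\<rho> \<le> 1" "2 \<le> K \<Longrightarrow> 3 * \<mu> * (1 - \<rho>) \<le> 2 * \<rho>"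
  shows "1 \<le> \<rho> * ((1 - (2 * (K - q) - 1) * \<mu> - 2 * (K - q) * delta_at q \<mu>) / (1 - (2 * K - 1) * \<mu>))
    + (1 - \<rho>) * ((1 - \<mu> - 2 * delta_at q \<mu>) / ((1 - delta_at q \<mu>) * (1 - \<mu>)))"
proof (cases "q = 0")
  case True
  have "\<mu> \<le> (2 * K - 1) * \<mu>" using \<mu> mult_right_mono[of 1 "2 * K - 1" \<mu>] by auto
  then show ?thesis using True \<mu> by (simp add: delta_at_def)
next
  case False
  then have q1: "1 \<le> q" using q by auto
  then have K2: "2 \<le> K" using q by linarith
  let ?\<delta> = "delta_at q \<mu>" and ?D = "1 - (2 * K - 1) * \<mu>" and ?e = "1 - (q - 1) * \<mu>"
  have p: "0 < ?e" using q1 q \<mu> denom_pos[of q K] by auto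
  have "3 * \<mu> \<le> (2 * K - 1) * \<mu>" using K2 \<mu> by (intro mult_right_mono) auto
  then have m3: "3 * \<mu> < 1" using \<mu> by linarith
  have d: "?\<delta> \<le> \<mu>" "0 \<le> ?\<delta>" using delta_at_le_mu[of q K \<mu>] delta_at_mono[of q K \<mu>] q1 q \<mu> by auto
  have \<delta>: "?\<delta> * ?e = q * \<mu>\<^sup>2" using p by (simp add: delta_at_def)
  have D: "0 < ?D" using \<mu> by simp
  have P: "0 < (1 - ?\<delta>) * (1 - \<mu>)" using d m3 by (intro mult_pos_pos) auto
  have K1: "(2 * K - 1) * \<mu> \<le> 1" using \<mu> by simp
  have "2 * \<mu> * (K - 1) \<le> 1" using K1 \<mu> by (simp add: algebra_simps)
  have gap: "q * \<mu> / ?e * ?D \<le> q * \<mu> - (K - q) * ?\<delta>"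
  proof -
    have "q * \<mu> * ?D \<le> q * \<mu> * ?e - (K - q) * (q * \<mu>\<^sup>2)"
    proof -
      have "0 \<le> q * \<mu> * (K * \<mu>)" using q1 \<mu> by simp
      then show ?thesis by (simp add: algebra_simps power2_eq_square)
    qed
    also have "\<dots> = (q * \<mu> - (K - q) * ?\<delta>) * ?e"
      using \<delta> by (simp add: algebra_simps)
    finally show ?thesis using p by (simp add: field_simps)
  qed
  have R: "1 + 2 * (q * \<mu> / ?e) \<le> (1 - (2 * (K - q) - 1) * \<mu> - 2 * (K - q) * ?\<delta>) / ?D"
  proof -
    have X: "(1 + 2 * g) * ?D \<le> 1 - (2 * (K - q) - 1) * \<mu> - 2 * (K - q) * ?\<delta>"
      if "g * ?D \<le> q * \<mu> - (K - q) * ?\<delta>" for g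
      using that by (simp add: algebra_simps)
    show ?thesis by (rule pos_le_divide_eq[OF D, THEN iffD2, OF X[OF gap]])
  qed
  have "(1 - \<mu> - 2 * ?\<delta>) / ((1 - ?\<delta>) * (1 - \<mu>)) = 1 - ?\<delta> * (1 + \<mu>) / ((1 - ?\<delta>) * (1 - \<mu>))"
    using P by (simp add: field_simps)
  moreover have "?\<delta> * (1 + \<mu>) / ((1 - ?\<delta>) * (1 - \<mu>)) \<le> 3 * ?\<delta>"
  proof -
    \<comment> \<open>Both the defect and \<mu> are below 1/3, so each factor is at least 2/3, while
      \<open>1 + \<mu>\<close> is below 4/3, which is 3 times 4/9.\<close>
    have "(2 / 3) * (2 / 3) \<le> (1 - ?\<delta>) * (1 - \<mu>)" using d m3 by (intro mult_mono) auto
    then have "1 + \<mu> \<le> 3 * ((1 - ?\<delta>) * (1 - \<mu>))" using m3 by linarith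
    then have "?\<delta> * (1 + \<mu>) \<le> ?\<delta> * (3 * ((1 - ?\<delta>) * (1 - \<mu>)))" using d by (intro mult_left_mono) auto
    then show ?thesis using P by (simp add: divide_le_eq algebra_simps)
  qed
  ultimately have S: "1 - 3 * ?\<delta> \<le> (1 - \<mu> - 2 * ?\<delta>) / ((1 - ?\<delta>) * (1 - \<mu>))" by simp
  have \<delta>': "?\<delta> = q * \<mu> / ?e * \<mu>" by (simp add: delta_at_def power2_eq_square)
  have "0 \<le> q * \<mu> / ?e" using q1 \<mu> p by simp
  then have "q * \<mu> / ?e * (3 * \<mu> * (1 - \<rho>)) \<le> q * \<mu> / ?e * (2 * \<rho>)"
    using \<rho> K2 by (intro mult_left_mono) auto
  moreover have "(1 - \<rho>) * (3 * (g * \<mu>)) \<le> \<rho> * (2 * g)" if "g * (3 * \<mu> * (1 - \<rho>)) \<le> g * (2 * \<rho>)" for g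
    using that by (simp add: algebra_simps)
  ultimately have "(1 - \<rho>) * (3 * ?\<delta>) \<le> \<rho> * (2 * (q * \<mu> / ?e))"
    unfolding \<delta>' by blast
  then have "1 \<le> \<rho> * (1 + 2 * (q * \<mu> / ?e)) + (1 - \<rho>) * (1 - 3 * ?\<delta>)"
    by (simp add: algebra_simps)
  also have "\<dots> \<le> \<rho> * ((1 - (2 * (K - q) - 1) * \<mu> - 2 * (K - q) * ?\<delta>) / ?D)
    + (1 - \<rho>) * ((1 - \<mu> - 2 * ?\<delta>) / ((1 - ?\<delta>) * (1 - \<mu>)))"
    using R S \<rho> by (intro add_mono mult_left_mono) auto
  finally show ?thesis .
qed

text \<open>One machine in one round: unit columns \<open>x i\<close>, current set \<open>s\<close>, and \<open>a i\<close> the part of \<open>x i\<close>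
  orthogonal to the columns of \<open>s\<close>.  The coefficients \<open>\<theta>\<close> are those with respect to the unit columns.\<close>

locale omp_machine =
  fixes n d :: nat and S s :: "nat set" and K :: nat and \<mu> :: real
    and x :: "nat \<Rightarrow> nat \<Rightarrow> real" and b a :: "nat \<Rightarrow> nat \<Rightarrow> real" and \<theta> :: "nat \<Rightarrow> real" and \<sigma> :: real
  assumes K1: "1 \<le> K" and mu: "0 \<le> \<mu>" "\<mu> < 1 / (2 * real K - 1)"
    and S: "S \<subseteq> {..<d}" "card S = K" and s: "s \<subset> S" and \<sigma>: "0 < \<sigma>"
    and unit: "\<And>i. i < d \<Longrightarrow> ip {..<n} (x i) (x i) = 1"
    and incoh: "\<And>i l. i < d \<Longrightarrow> l < d \<Longrightarrow> i \<noteq> l \<Longrightarrow> \<bar>ip {..<n} (x i) (x l)\<bar> \<le> \<mu>"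
    and a_def: "\<And>i j. a i j = x i j - (\<Sum>k\<in>s. b i k * x k j)"
    and orth: "\<And>i l. i < d \<Longrightarrow> l \<in> s \<Longrightarrow> ip {..<n} (a i) (x l) = 0"
begin

abbreviation J where "J \<equiv> {..<n}"

section \<open>Gram matrix of the projected columns, signal and signal gap\<close>

definition q :: real where "q = real (card s)"
definition \<delta> :: real where "\<delta> = delta_at q \<mu>"
text \<open>The noiseless correlation of column \<open>i\<close> with the residual. Columns in
  \<open>s\<close> drop out because \<open>a i\<close> is orthogonal to them.\<close>

definition signal :: "nat \<Rightarrow> real" where "signal i = (\<Sum>l\<in>S - s. \<theta> l * ip J (a i) (a l))"
definition stat :: "nat \<Rightarrow> (nat \<Rightarrow> real) \<Rightarrow> real" where "stat i \<xi> = \<bar>signal i + \<sigma> * ip J (a i) \<xi>\<bar>"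
definition T :: real where "T = (MAX l\<in>S - s. \<bar>\<theta> l\<bar>)"

lemma finite_S: "finite S" "finite s" "finite (S - s)"
  using S s finite_subset by (metis finite_lessThan, metis finite_lessThan psubset_imp_subset order_trans,
      metis finite_lessThan finite_Diff)

lemma s_lt: "k \<in> s \<Longrightarrow> k < d" and S_lt: "k \<in> S \<Longrightarrow> k < d"
  using S s by auto

lemma q: "0 \<le> q" "q \<le> real K - 1" "q = 0 \<or> 1 \<le> q" "real (card (S - s)) = real K - q"
proof -
  have c: "card s < K" using psubset_card_mono[OF finite_S(1) s] S by simp
  then show "0 \<le> q" "q \<le> real K - 1" "q = 0 \<or> 1 \<le> q" by (auto simp: q_def)
  show "real (card (S - s)) = real K - q"
    using c S s card_Diff_subset[OF finite_S(2), of S] by (auto simp: q_def of_nat_diff)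
qed

lemma mu': "(2 * real K - 1) * \<mu> < 1" "\<mu> < 1" "real K \<ge> 1" "2 \<le> K \<Longrightarrow> 3 * \<mu> < 1"
  using coherence_condition[OF K1 mu] K1 by auto

lemma e_pos: "0 < 1 - (q - 1) * \<mu>"
  using denom_pos[of q "real K" \<mu>] q mu mu' by auto

lemma \<delta>: "0 \<le> \<delta>" "\<delta> \<le> \<mu>" "\<delta> \<le> delta K \<mu>" "delta K \<mu> \<le> \<mu>"
  unfolding \<delta>_def delta_eq_delta_at using q mu mu'
  by (auto intro!: delta_at_mono[of q "real K"] delta_at_le_mu[of _ "real K"])

lemma ip_orth_sum: "i < d \<Longrightarrow> ip J (a i) (\<lambda>j. \<Sum>k\<in>s. c k * x k j) = 0"
  using orth by (simp add: ip_sum_right)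

lemma a_eq: "a i = (\<lambda>j. x i j - (\<Sum>k\<in>s. b i k * x k j))"
  by (rule ext) (rule a_def)

lemma ip_a_a: "i < d \<Longrightarrow> ip J (a i) (a l) = ip J (a i) (x l)"
  unfolding a_eq[of l] by (simp add: ip_diff_right ip_orth_sum)

text \<open>For a chosen index, \<open>a i\<close> is orthogonal to \<open>x i\<close> as well,
  hence to itself. Its statistic is identically 0.\<close>

lemma ip_a_zero: "i \<in> s \<Longrightarrow> ip J (a i) v = 0"
  using ip_self_eq_0[of J "a i" v] ip_a_a[of i i] orth[of i i] s_lt[of i] by simp

text \<open>Diagonal dominance: in the normal equation of the index with the largest absolute
  coefficient \<open>m\<close>, the unit diagonal yields
  \<open>m \<le> \<mu> + (q - 1) * (m * \<mu>)\<close>.\<close>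

lemma abs_b_le:
  assumes i: "i < d" "i \<notin> s" and k: "k \<in> s"
  shows "\<bar>b i k\<bar> \<le> \<mu> / (1 - (q - 1) * \<mu>)"
proof -
  define m where "m = (MAX k\<in>s. \<bar>b i k\<bar>)"
  have "m \<in> (\<lambda>k. \<bar>b i k\<bar>) ` s" unfolding m_def using finite_S k by (intro Max_in) auto
  then obtain k0 where k0: "k0 \<in> s" "m = \<bar>b i k0\<bar>" by auto
  have le: "\<bar>b i k\<bar> \<le> m" if "k \<in> s" for k unfolding m_def using finite_S that by (intro Max_ge) auto
  have "0 = ip J (a i) (x k0)" using orth i k0 by simp
  also have "\<dots> = ip J (x i) (x k0) - (\<Sum>k\<in>s. b i k * ip J (x k) (x k0))"
    unfolding a_eq by (simp add: ip_diff_left ip_sum_left)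
  also have "(\<Sum>k\<in>s. b i k * ip J (x k) (x k0)) = b i k0 + (\<Sum>k\<in>s - {k0}. b i k * ip J (x k) (x k0))"
    using finite_S k0 unit s_lt by (subst sum.remove[of _ k0]) auto
  finally have "b i k0 = ip J (x i) (x k0) - (\<Sum>k\<in>s - {k0}. b i k * ip J (x k) (x k0))" by simp
  then have "m \<le> \<bar>ip J (x i) (x k0)\<bar> + \<bar>\<Sum>k\<in>s - {k0}. b i k * ip J (x k) (x k0)\<bar>"
    using k0 by linarith
  also have "\<bar>\<Sum>k\<in>s - {k0}. b i k * ip J (x k) (x k0)\<bar> \<le> (\<Sum>k\<in>s - {k0}. m * \<mu>)"
    using le k0 s_lt by (intro order_trans[OF sum_abs] sum_mono) (auto simp: abs_mult intro!: mult_mono incoh)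
  also have "\<dots> = (q - 1) * (m * \<mu>)"
  proof -
    have "1 \<le> card s" using finite_S k0 by (simp add: Suc_le_eq card_gt_0_iff) auto
    then show ?thesis using finite_S k0 by (simp add: q_def of_nat_diff)
  qed
  also have "\<bar>ip J (x i) (x k0)\<bar> \<le> \<mu>" using i k0 s_lt by (intro incoh) auto
  finally have "m * (1 - (q - 1) * \<mu>) \<le> \<mu>" by (simp add: algebra_simps)
  then have "m \<le> \<mu> / (1 - (q - 1) * \<mu>)" using e_pos by (simp add: le_divide_eq)
  then show ?thesis using le[OF k] by simp
qed

lemma abs_b_le_1:
  assumes "i < d" "i \<notin> s" "k \<in> s" shows "\<bar>b i k\<bar> \<le> 1"
proof -
  have "q * \<mu> \<le> (2 * real K - 1) * \<mu>" using q mu mu' by (intro mult_right_mono) auto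
  then have "\<mu> \<le> 1 - (q - 1) * \<mu>" using mu' by (simp add: algebra_simps)
  then have "\<mu> / (1 - (q - 1) * \<mu>) \<le> 1" using e_pos by (simp add: divide_le_eq)
  then show ?thesis using abs_b_le[OF assms] by simp
qed

text \<open>The defect is a sum of \<open>q\<close> products of a projection coefficient with an
  inner product bounded by \<mu>. This is the origin of the formula for
  \<open>delta\<close>.\<close>

lemma abs_gram_defect:
  assumes i: "i < d" "i \<notin> s" and l: "l < d" "l \<notin> s"
  shows "\<bar>ip J (x i) (x l) - ip J (a i) (a l)\<bar> \<le> \<delta>"
proof -
  have "ip J (x i) (x l) - ip J (a i) (a l) = (\<Sum>k\<in>s. b i k * ip J (x k) (x l))"
    unfolding ip_a_a[OF i(1)] unfolding a_eq by (simp add: ip_diff_left ip_sum_left)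
  also have "\<bar>\<dots>\<bar> \<le> (\<Sum>k\<in>s. \<mu> / (1 - (q - 1) * \<mu>) * \<mu>)"
  proof (rule order_trans[OF sum_abs], rule sum_mono, unfold abs_mult, rule mult_mono)
    show "\<bar>b i k\<bar> \<le> \<mu> / (1 - (q - 1) * \<mu>)" "\<bar>ip J (x k) (x l)\<bar> \<le> \<mu>" if "k \<in> s" for k
      using abs_b_le[OF i that] l s_lt[OF that] that by (auto intro!: incoh)
  qed (use e_pos mu in auto)
  also have "\<dots> = \<delta>" by (simp add: \<delta>_def delta_at_def q_def power2_eq_square)
  finally show ?thesis .
qed

lemma gram_bounds:
  assumes "i < d" "l < d" "i \<noteq> l" shows "\<bar>ip J (a i) (a l)\<bar> \<le> \<mu> + \<delta>"
proof (cases "i \<in> s \<or> l \<in> s")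
  case True
  then have "ip J (a i) (a l) = 0" using ip_a_zero ip_commute[of J "a i" "a l"] by auto
  then show ?thesis using mu \<delta> by simp
next
  case False
  then show ?thesis using abs_gram_defect[of i l] incoh[of i l] assms by auto
qed

lemma norm_bounds:
  assumes "i < d" shows "ip J (a i) (a i) \<le> 1" "i \<notin> s \<Longrightarrow> 1 - \<delta> \<le> ip J (a i) (a i)"
proof -
  show "i \<notin> s \<Longrightarrow> 1 - \<delta> \<le> ip J (a i) (a i)"
    using abs_gram_defect[of i i] unit assms by auto
  let ?p = "\<lambda>j. \<Sum>k\<in>s. b i k * x k j"
  have "x i = (\<lambda>j. a i j + ?p j)" by (simp add: a_def)
  then have "1 = ip J (a i) (\<lambda>j. a i j + ?p j) + ip J ?p (\<lambda>j. a i j + ?p j)"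
    using unit[OF assms] by (metis ip_add_left)
  also have "\<dots> = ip J (a i) (a i) + ip J ?p ?p"
    using ip_orth_sum[OF assms, of "b i"] by (simp add: ip_add_right ip_commute[of J ?p "a i"])
  finally show "ip J (a i) (a i) \<le> 1" using ip_self_nonneg[of J ?p] by simp
qed

lemma T: "l \<in> S - s \<Longrightarrow> \<bar>\<theta> l\<bar> \<le> T" "\<exists>k\<in>S - s. \<bar>\<theta> k\<bar> = T"
proof -
  show "l \<in> S - s \<Longrightarrow> \<bar>\<theta> l\<bar> \<le> T" unfolding T_def using finite_S by (intro Max_ge) auto
  have "T \<in> (\<lambda>l. \<bar>\<theta> l\<bar>) ` (S - s)" unfolding T_def using finite_S s by (intro Max_in) auto
  then show "\<exists>k\<in>S - s. \<bar>\<theta> k\<bar> = T" by auto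
qed

lemma T_nonneg: "0 \<le> T"
  using T(2) by (metis abs_ge_zero)

lemma abs_signal_le:
  assumes j: "j < d" "j \<notin> S - s" shows "\<bar>signal j\<bar> \<le> T * ((real K - q) * (\<mu> + \<delta>))"
proof -
  have "\<bar>signal j\<bar> \<le> (\<Sum>l\<in>S - s. T * (\<mu> + \<delta>))"
    unfolding signal_def using T T_nonneg j S_lt
    by (intro order_trans[OF sum_abs] sum_mono) (auto simp: abs_mult intro!: mult_mono gram_bounds)
  then show ?thesis using q(4) by (simp add: algebra_simps)
qed

text \<open>By \<open>signal_gap_ge\<close> the dependence on \<open>q\<close> disappears. Twice
  this amount is the term with \<open>2 * \<mu> * K\<close> in the denominator of
  \<open>Q1\<close>.\<close>

lemma abs_signal_le': "j < d \<Longrightarrow> j \<notin> S - s \<Longrightarrow> \<bar>signal j\<bar> \<le> T * (real K * \<mu>)"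
proof -
  assume j: "j < d" "j \<notin> S - s"
  have "(real K - q) * \<delta> \<le> q * \<mu>"
    unfolding \<delta>_def using signal_gap_ge(1)[of q "real K" \<mu>] q mu mu' by auto
  then have "(real K - q) * (\<mu> + \<delta>) \<le> real K * \<mu>" by (simp add: algebra_simps)
  then show ?thesis using abs_signal_le[OF j] mult_left_mono[OF _ T_nonneg] by (meson order_trans)
qed

definition lead :: nat where "lead = (SOME k. k \<in> S - s \<and> \<bar>\<theta> k\<bar> = T)"

lemma lead: "lead \<in> S - s" "\<bar>\<theta> lead\<bar> = T" "lead < d"
proof -
  have "\<exists>k. k \<in> S - s \<and> \<bar>\<theta> k\<bar> = T" using T(2) by auto
  then have "lead \<in> S - s \<and> \<bar>\<theta> lead\<bar> = T" unfolding lead_def by (rule someI_ex)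
  then show "lead \<in> S - s" "\<bar>\<theta> lead\<bar> = T" "lead < d" using S_lt by auto
qed

definition sg :: real where "sg = (if 0 \<le> \<theta> lead then 1 else -1)"

lemma sg: "\<bar>sg\<bar> = 1" "sg * sg = 1" "sg * \<theta> lead = T"
  using lead(2) by (auto simp: sg_def)

text \<open>The diagonal term contributes at least \<open>1 - \<delta>\<close>, and each of the
  \<open>K - q - 1\<close> other remaining support columns interferes by at most
  \<open>\<mu> + \<delta>\<close>.\<close>

lemma signal_lead_ge: "T * (1 - \<delta> - (real K - q - 1) * (\<mu> + \<delta>)) \<le> sg * signal lead"
proof -
  have "sg * signal lead = sg * \<theta> lead * ip J (a lead) (a lead) + sg * (\<Sum>l\<in>S - s - {lead}. \<theta> l * ip J (a lead) (a l))"
    unfolding signal_def using finite_S lead by (subst sum.remove[of _ lead]) (auto simp: algebra_simps)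
  moreover have "T * (1 - \<delta>) \<le> T * ip J (a lead) (a lead)"
    using norm_bounds(2)[of lead] lead T_nonneg by (intro mult_left_mono) auto
  moreover have "\<bar>sg * (\<Sum>l\<in>S - s - {lead}. \<theta> l * ip J (a lead) (a l))\<bar> \<le> (\<Sum>l\<in>S - s - {lead}. T * (\<mu> + \<delta>))"
    unfolding abs_mult[of sg] sg(1) mult_1 using T T_nonneg lead S_lt
    by (intro order_trans[OF sum_abs] sum_mono) (auto simp: abs_mult intro!: mult_mono gram_bounds)
  moreover have "(\<Sum>l\<in>S - s - {lead}. T * (\<mu> + \<delta>)) = (real K - q - 1) * (T * (\<mu> + \<delta>))"
  proof -
    have "1 \<le> card (S - s)" using finite_S lead by (simp add: Suc_le_eq card_gt_0_iff) auto
    then have "real (card (S - s - {lead})) = real (card (S - s)) - 1" using finite_S lead by (simp add: of_nat_diff)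
    then show ?thesis using q(4) by simp
  qed
  ultimately show ?thesis using sg(3) by (simp add: algebra_simps)
qed

text \<open>The guaranteed advantage of \<open>lead\<close> over a wrong index in units of
  \<open>T\<close>, namely \<open>1 - \<delta> - (K - q - 1) * (\<mu> + \<delta>)\<close> minus
  \<open>(K - q) * (\<mu> + \<delta>)\<close>.\<close>

definition gap :: real where "gap = 1 - (2 * (real K - q) - 1) * \<mu> - 2 * (real K - q) * \<delta>"

lemma signal_gap:
  assumes "j < d" "j \<notin> S - s" shows "T * gap \<le> sg * signal lead - \<bar>signal j\<bar>"
proof -
  have "T * gap = T * (1 - \<delta> - (real K - q - 1) * (\<mu> + \<delta>)) - T * ((real K - q) * (\<mu> + \<delta>))"
    by (simp add: gap_def algebra_simps)
  then show ?thesis using signal_lead_ge abs_signal_le[OF assms] by linarith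
qed

text \<open>The left side is the denominator of \<open>theta_crit\<close>; through it the
  signal-to-noise ratio bounds the gap for every size of \<open>s\<close>.\<close>

lemma gap_ge: "1 - (2 * real K - 1) * \<mu> \<le> gap"
  unfolding gap_def \<delta>_def using signal_gap_ge(2)[of q "real K" \<mu>] q mu mu' by auto

lemma stat_lead_ge: "sg * signal lead + \<sigma> * ip J (\<lambda>j. sg * a lead j) \<xi> \<le> stat lead \<xi>"
proof -
  have "sg * signal lead + \<sigma> * ip J (\<lambda>j. sg * a lead j) \<xi> = sg * (signal lead + \<sigma> * ip J (a lead) \<xi>)"
    by (simp add: ip_scale_left algebra_simps)
  also have "\<dots> \<le> \<bar>sg * (signal lead + \<sigma> * ip J (a lead) \<xi>)\<bar>" by simp
  finally show ?thesis by (simp add: stat_def abs_mult sg)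
qed

lemma stat_le: "stat j \<xi> \<le> \<bar>signal j\<bar> + \<sigma> * \<bar>ip J (a j) \<xi>\<bar>"
  unfolding stat_def using \<sigma> by (metis abs_mult abs_of_pos abs_triangle_ineq)

lemma borel_measurable_stat [measurable]: "stat j \<in> borel_measurable (gauss J)"
  unfolding stat_def by measurable

end

section \<open>Probabilities of a correct and of a wrong vote\<close>

lemma prob_Ball_abs_le:
  assumes fin: "finite J" "finite I" and h: "\<And>i. i \<in> I \<Longrightarrow> ip J (h i) (h i) \<le> 1" and l: "0 < l"
  shows "1 - real (card I) * (2 * normal_tail l) \<le> \<P>(\<xi> in gauss J. \<forall>i\<in>I. \<bar>ip J (h i) \<xi>\<bar> \<le> l)"
proof -
  interpret J: prob_space "gauss J" by (rule prob_space_gauss)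
  have sets: "{\<xi> \<in> space (gauss J). l \<le> \<bar>ip J (h i) \<xi>\<bar>} \<in> sets (gauss J)" for i by measurable
  have "1 - \<P>(\<xi> in gauss J. \<forall>i\<in>I. \<bar>ip J (h i) \<xi>\<bar> \<le> l) = \<P>(\<xi> in gauss J. \<not> (\<forall>i\<in>I. \<bar>ip J (h i) \<xi>\<bar> \<le> l))"
    by (rule J.prob_neg[symmetric]) (use fin in measurable)
  also have "\<dots> \<le> measure (gauss J) (\<Union>i\<in>I. {\<xi> \<in> space (gauss J). l \<le> \<bar>ip J (h i) \<xi>\<bar>})"
    by (rule J.finite_measure_mono) (use sets fin in auto)
  also have "\<dots> \<le> (\<Sum>i\<in>I. \<P>(\<xi> in gauss J. l \<le> \<bar>ip J (h i) \<xi>\<bar>))"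
    by (rule measure_UNION_le) (use sets fin in auto)
  also have "\<dots> \<le> (\<Sum>i\<in>I. 2 * normal_tail (l / 1))"
    by (intro sum_mono gauss_abs_tail) (use h l fin in auto)
  finally show ?thesis by simp
qed

text \<open>The coordinates from \<open>n\<close> to \<open>2 * n\<close> serve as an independent
  copy of the noise space; the shift preserves all inner products.\<close>

lemma ip_shift: "ip {n..<2 * n} (\<lambda>j. f (j - n)) (\<lambda>j. g (j - n)) = ip {..<n :: nat} f g"
  unfolding ip_def
  by (rule sum.reindex_bij_witness[where i = "\<lambda>j. j + n" and j = "\<lambda>j. j - n"]) auto

context omp_machine
begin

definition \<kappa> :: real where "\<kappa> = sqrt (1 - delta K \<mu>) * (1 - \<mu>)"

lemma delta_small: "0 < 1 - \<mu> - 2 * \<delta>" "0 < 1 - delta K \<mu>" "0 < \<kappa>" "0 < 1 - \<delta>"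
proof -
  show 1: "0 < 1 - \<mu> - 2 * \<delta>"
  proof (cases "2 \<le> K")
    case True then show ?thesis using mu'(4) \<delta> by simp
  next
    case False
    then have "K = 1" using K1 by simp
    then have "q = 0" using q by simp
    then show ?thesis using mu' by (simp add: \<delta>_def delta_at_def)
  qed
  show "0 < 1 - delta K \<mu>" using \<delta> mu' by simp
  then show "0 < \<kappa>" unfolding \<kappa>_def using mu' by simp
  show "0 < 1 - \<delta>" using \<delta> mu' by simp
qed

text \<open>The threshold is cut off at 0 because the comparison with the other statistics uses
  positive noise along \<open>lead\<close>; for \<open>1 \<le> \<rho>\<close> the tail is then 1/2.
  The margin \<open>e\<close>, removed at the start by right continuity, makes the victory strict,
  so that no tie break can undo it.\<close>

lemma prob_lead_wins:
  assumes L: "0 < L" and TL: "T * (1 - (2 * real K - 1) * \<mu>) = \<rho> * \<sigma> * L"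
    and \<rho>: "0 \<le> \<rho>" "2 \<le> K \<Longrightarrow> 3 * \<mu> * (1 - \<rho>) \<le> 2 * \<rho>" and dL: "2 * real d * normal_tail L \<le> 1"
  shows "normal_tail (max 0 ((1 - \<rho>) * L / \<kappa>)) * (1 - 2 * real d * normal_tail L) \<le>
    \<P>(\<xi> in gauss J. \<forall>j<d. j \<notin> S - s \<longrightarrow> stat j \<xi> < stat lead \<xi>)" (is "_ \<le> measure _ ?W")
proof (rule normal_tail_right_continuous)
  fix e :: real assume e: "0 < e"
  interpret G: prob_space "gauss J" by (rule prob_space_gauss)
  let ?D = "1 - (2 * real K - 1) * \<mu>"
  define m where "m = max 0 ((1 - \<rho>) * L / \<kappa>)"
  define z where "z = m + e"
  define \<alpha> where "\<alpha> = sqrt (ip J (a lead) (a lead))"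
  define u where "u = (\<lambda>j. sg * a lead j)"
  have nl: "1 - \<delta> \<le> ip J (a lead) (a lead)" "ip J (a lead) (a lead) \<le> 1"
    using norm_bounds[of lead] lead by auto
  have \<alpha>: "sqrt (1 - \<delta>) \<le> \<alpha>" "\<alpha> \<le> 1" "0 < \<alpha>" "ip J (a lead) (a lead) = \<alpha>\<^sup>2"
    unfolding \<alpha>_def using nl delta_small by auto
  have uu: "ip J u u = \<alpha>\<^sup>2"
    unfolding u_def using \<alpha>(4) sg by (simp add: ip_scale_left ip_scale_right)
  define \<beta> where "\<beta> = (\<lambda>j. ip J (a j) u / \<alpha>\<^sup>2)"
  define h where "h = (\<lambda>j i. a j i - \<beta> j * u i)"
  define I where "I = {j. j < d \<and> j \<notin> S - s}"
  have finI: "finite I" "card I \<le> d" unfolding I_def using card_mono[of "{..<d}" "{j. j < d \<and> j \<notin> S - s}"] by auto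
  have hu: "ip J u (h j) = 0" for j
  proof -
    have "\<beta> j * \<alpha>\<^sup>2 = ip J (a j) u" using \<alpha>(3) by (simp add: \<beta>_def)
    then show ?thesis unfolding h_def using uu by (simp add: ip_diff_right ip_scale_right ip_commute[of J u "a j"])
  qed
  have hh: "ip J (h j) (h j) \<le> 1" if "j \<in> I" for j
  proof -
    have "ip J (h j) (h j) = ip J (h j) (a j)"
      using hu[of j] by (subst (2) h_def) (simp add: ip_diff_right ip_scale_right ip_commute[of J "h j" u])
    also have "\<dots> = ip J (a j) (a j) - \<beta> j * (\<beta> j * \<alpha>\<^sup>2)"
    proof -
      have "\<beta> j * \<alpha>\<^sup>2 = ip J (a j) u" using \<alpha>(3) by (simp add: \<beta>_def)
      then show ?thesis unfolding h_def by (simp add: ip_diff_left ip_scale_left ip_commute[of J u "a j"])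
    qed
    also have "\<dots> \<le> 1"
      using norm_bounds(1)[of j] that mult_nonneg_nonneg[OF zero_le_square[of "\<beta> j"] zero_le_power2[of \<alpha>]] by (simp add: I_def mult.assoc)
    finally show ?thesis .
  qed
  \<comment> \<open>The gain over \<open>j\<close> per unit of normalised noise along
    \<open>lead\<close> is at least \<open>\<alpha> - (\<mu> + \<delta>) / \<alpha>\<close>, which
    increases with \<alpha>. \<open>q0\<close> is its value at the smallest possible \<alpha>,
    \<open>sqrt (1 - \<delta>)\<close>.\<close>
  define q0 where "q0 = (1 - \<mu> - 2 * \<delta>) / sqrt (1 - \<delta>)"
  have q0: "0 < q0" unfolding q0_def using delta_small by simp
  have \<beta>: "q0 \<le> (1 - \<bar>\<beta> j\<bar>) * \<alpha>" if "j \<in> I" for j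
  proof -
    have "\<bar>ip J (a j) u\<bar> \<le> \<mu> + \<delta>"
      using gram_bounds[of j lead] lead that sg by (auto simp: u_def ip_scale_right abs_mult I_def)
    then have "\<bar>\<beta> j\<bar> \<le> (\<mu> + \<delta>) / \<alpha>\<^sup>2" unfolding \<beta>_def by (simp add: divide_right_mono)
    then have "(1 - (\<mu> + \<delta>) / \<alpha>\<^sup>2) * \<alpha> \<le> (1 - \<bar>\<beta> j\<bar>) * \<alpha>" using \<alpha> by (intro mult_right_mono) auto
    moreover have "(1 - (\<mu> + \<delta>) / \<alpha>\<^sup>2) * \<alpha> = \<alpha> - (\<mu> + \<delta>) / \<alpha>"
      using \<alpha>(3) by (simp add: field_simps power2_eq_square)
    moreover have "(\<mu> + \<delta>) / \<alpha> \<le> (\<mu> + \<delta>) / sqrt (1 - \<delta>)"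
      using \<alpha> mu \<delta> delta_small by (intro divide_left_mono) auto
    moreover have "q0 = sqrt (1 - \<delta>) - (\<mu> + \<delta>) / sqrt (1 - \<delta>)"
    proof -
      have "q0 = ((1 - \<delta>) - (\<mu> + \<delta>)) / sqrt (1 - \<delta>)" by (simp add: q0_def)
      also have "\<dots> = (1 - \<delta>) / sqrt (1 - \<delta>) - (\<mu> + \<delta>) / sqrt (1 - \<delta>)" by (rule diff_divide_distrib)
      also have "(1 - \<delta>) / sqrt (1 - \<delta>) = sqrt (1 - \<delta>)" using delta_small by (intro real_div_sqrt) simp
      finally show ?thesis .
    qed
    ultimately show ?thesis using \<alpha>(1) by linarith
  qed
  \<comment> \<open>For \<open>1 \<le> \<rho>\<close> the signal gap alone covers the level
    \<open>L\<close> of the remainders, and \<open>z > 0\<close> gives strictness. Otherwise the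
    deficit is covered by \<open>signal_noise_tradeoff\<close>.\<close>
  have main: "\<sigma> * L < T * gap + \<sigma> * (q0 * z)"
  proof (cases "1 \<le> \<rho>")
    case True
    have "1 * (\<sigma> * L) \<le> \<rho> * (\<sigma> * L)" using True \<sigma> L by (intro mult_right_mono) auto
    also have "\<dots> = T * ?D" using TL by simp
    also have "\<dots> \<le> T * gap" using gap_ge T_nonneg by (intro mult_left_mono) auto
    also have "\<dots> < T * gap + \<sigma> * (q0 * z)" using \<sigma> q0 e by (simp add: z_def m_def)
    finally show ?thesis by simp
  next
    case False
    have D: "0 < ?D" using mu' by simp
    have "1 \<le> \<rho> * (gap / ?D) + (1 - \<rho>) * ((1 - \<mu> - 2 * \<delta>) / ((1 - \<delta>) * (1 - \<mu>)))"
      unfolding gap_def \<delta>_def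
      by (rule signal_noise_tradeoff) (use q mu mu' \<rho> False in auto)
    also have "(1 - \<mu> - 2 * \<delta>) / ((1 - \<delta>) * (1 - \<mu>)) \<le> q0 / \<kappa>"
    proof -
      have "sqrt (1 - \<delta>) * \<kappa> \<le> sqrt (1 - \<delta>) * (sqrt (1 - \<delta>) * (1 - \<mu>))"
        unfolding \<kappa>_def using \<delta> mu' delta_small by (intro mult_left_mono mult_right_mono) auto
      also have "\<dots> = (1 - \<delta>) * (1 - \<mu>)" using delta_small by simp
      finally show ?thesis unfolding q0_def divide_divide_eq_left using delta_small mu'
        by (intro divide_left_mono mult_pos_pos) auto
    qed
    finally have "1 \<le> \<rho> * (gap / ?D) + (1 - \<rho>) * (q0 / \<kappa>)" using False by (simp add: mult_left_mono)
    then have "\<sigma> * L * 1 \<le> \<sigma> * L * (\<rho> * (gap / ?D) + (1 - \<rho>) * (q0 / \<kappa>))" using \<sigma> L by (intro mult_left_mono) auto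
    also have "\<dots> = (\<rho> * \<sigma> * L) * gap / ?D + \<sigma> * (q0 * ((1 - \<rho>) * L / \<kappa>))" by (simp add: algebra_simps)
    also have "(\<rho> * \<sigma> * L) * gap / ?D = T * gap" unfolding TL[symmetric] using D by simp
    also have "T * gap + \<sigma> * (q0 * ((1 - \<rho>) * L / \<kappa>)) < T * gap + \<sigma> * (q0 * z)"
    proof -
      have "(1 - \<rho>) * L / \<kappa> \<le> m" unfolding m_def by simp
      then have "(1 - \<rho>) * L / \<kappa> < z" unfolding z_def using e by linarith
      then show ?thesis using \<sigma> q0 by (intro add_strict_left_mono mult_strict_left_mono)
    qed
    finally show ?thesis by simp
  qed
  have "normal_tail z * (1 - 2 * real d * normal_tail L) \<le>
      normal_tail (\<alpha> * z / \<alpha>) * \<P>(\<xi> in gauss J. \<forall>i\<in>I. \<bar>ip J (h i) \<xi>\<bar> \<le> L)"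
  proof (rule mult_mono)
    have "1 - 2 * real d * normal_tail L \<le> 1 - real (card I) * (2 * normal_tail L)"
      using finI normal_tail_nonneg[of L] mult_right_mono[of "real (card I)" "real d" "2 * normal_tail L"] by simp
    then show "1 - 2 * real d * normal_tail L \<le> \<P>(\<xi> in gauss J. \<forall>i\<in>I. \<bar>ip J (h i) \<xi>\<bar> \<le> L)"
      using prob_Ball_abs_le[of J I h L] finI hh L by auto
  qed (use \<alpha> normal_tail_nonneg dL in auto)
  also have "\<dots> \<le> \<P>(\<xi> in gauss J. \<alpha> * z \<le> ip J u \<xi> \<and> (\<forall>i\<in>I. \<bar>ip J (h i) \<xi>\<bar> \<le> L))"
    by (rule gauss_orthogonal_indep) (use finI hu uu \<alpha> in auto)
  also have "\<dots> \<le> measure (gauss J) ?W"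
  proof (rule G.finite_measure_mono)
    show "?W \<in> sets (gauss J)" by measurable
    show "{\<xi> \<in> space (gauss J). \<alpha> * z \<le> ip J u \<xi> \<and> (\<forall>i\<in>I. \<bar>ip J (h i) \<xi>\<bar> \<le> L)} \<subseteq> ?W" (is "?E \<subseteq> _")
    proof (intro subsetI CollectI conjI allI impI)
      fix \<xi> j
      assume \<xi>: "\<xi> \<in> ?E"
        and j: "j < d" "j \<notin> S - s"
      let ?g = "ip J u \<xi>"
      have jI: "j \<in> I" using j by (simp add: I_def)
      have "ip J (a j) \<xi> = ip J (h j) \<xi> + \<beta> j * ?g" by (simp add: h_def ip_diff_left ip_scale_left)
      then have "\<bar>ip J (a j) \<xi>\<bar> \<le> \<bar>ip J (h j) \<xi>\<bar> + \<bar>\<beta> j * ?g\<bar>" by simp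
      moreover have z0: "0 < z" unfolding z_def m_def using e by simp
      then have g0: "0 < \<alpha> * z" using \<alpha> by simp
      then have gp: "0 < ?g" "\<alpha> * z \<le> ?g" using \<xi> by auto
      ultimately have "\<bar>ip J (a j) \<xi>\<bar> \<le> L + \<bar>\<beta> j\<bar> * ?g" using \<xi> jI by (auto simp: abs_mult intro: order_trans)
      moreover have "q0 * z \<le> (1 - \<bar>\<beta> j\<bar>) * ?g"
      proof -
        have "q0 * z \<le> (1 - \<bar>\<beta> j\<bar>) * \<alpha> * z" using \<beta>[OF jI] z0 by (intro mult_right_mono) auto
        also have "\<dots> \<le> (1 - \<bar>\<beta> j\<bar>) * ?g"
        proof -
          have "0 < (1 - \<bar>\<beta> j\<bar>) * \<alpha>" using \<beta>[OF jI] q0 by linarith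
          then have "0 \<le> 1 - \<bar>\<beta> j\<bar>" using \<alpha> by (simp add: zero_less_mult_iff)
          then show ?thesis using gp by (simp add: mult_left_mono mult.assoc)
        qed
        finally show ?thesis .
      qed
      ultimately have "q0 * z - L \<le> ?g - \<bar>ip J (a j) \<xi>\<bar>" by (simp add: algebra_simps)
      then have "\<sigma> * (q0 * z - L) \<le> \<sigma> * (?g - \<bar>ip J (a j) \<xi>\<bar>)" using \<sigma> by (intro mult_left_mono) auto
      then have "\<sigma> * (q0 * z) - \<sigma> * L \<le> \<sigma> * ?g - \<sigma> * \<bar>ip J (a j) \<xi>\<bar>" by (simp add: algebra_simps)
      then show "stat j \<xi> < stat lead \<xi>"
        using stat_le[of j \<xi>] stat_lead_ge[of \<xi>] signal_gap[OF j] main unfolding u_def by linarith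
    qed auto
  qed
  finally show "normal_tail (max 0 ((1 - \<rho>) * L / \<kappa>) + e) * (1 - 2 * real d * normal_tail L) \<le> measure (gauss J) ?W"
    by (simp add: z_def m_def)
qed

text \<open>If \<open>lead\<close> does not beat \<open>j\<close>, one of the two functionals
  \<open>a j - u\<close> and \<open>- a j - u\<close>, with \<open>u\<close> the signed
  \<open>a lead\<close>, must reach \<open>\<rho> * L\<close>. Both have squared norm at most
  \<open>2 + 2 * (\<mu> + delta K \<mu>)\<close>, the radicand in \<open>Q2\<close>.\<close>

lemma prob_tie_le_gap:
  assumes L: "0 < L" and TL: "T * (1 - (2 * real K - 1) * \<mu>) = \<rho> * \<sigma> * L" and \<rho>: "0 < \<rho>"
    and j: "j < d" "j \<notin> S - s"
  shows "\<P>(\<xi> in gauss J. \<forall>i<d. stat i \<xi> \<le> stat j \<xi>) \<le>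
    2 * normal_tail (\<rho> * L / sqrt (2 + 2 * (\<mu> + delta K \<mu>)))"
proof -
  interpret G: prob_space "gauss J" by (rule prob_space_gauss)
  let ?u = "\<lambda>j. sg * a lead j" and ?B = "sqrt (2 + 2 * (\<mu> + delta K \<mu>))"
  let ?v = "\<lambda>i. a j i - ?u i" and ?w = "\<lambda>i. (- 1) * a j i - ?u i"
  have B: "0 < ?B" "?B\<^sup>2 = 2 + 2 * (\<mu> + delta K \<mu>)" using mu \<delta> by auto
  have "\<bar>ip J (a j) (a lead)\<bar> \<le> \<mu> + \<delta>" using j lead by (intro gram_bounds) auto
  then have "\<bar>sg * ip J (a j) (a lead)\<bar> \<le> \<mu> + delta K \<mu>" using \<delta> sg by (auto simp: abs_mult)
  moreover have sgsg: "sg * (sg * t) = t" for t using sg(2) by (simp add: mult.assoc[symmetric])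
  ultimately have vw: "ip J ?v ?v \<le> ?B\<^sup>2" "ip J ?w ?w \<le> ?B\<^sup>2"
    unfolding B(2) ip_diff_left ip_diff_right ip_scale_left ip_scale_right
    using norm_bounds(1)[of j] norm_bounds(1)[of lead] j lead(3)
    by (auto simp: ip_commute[of J "a lead" "a j"] sgsg simp del: mult_cancel_left1 mult_cancel_left2)
  have "\<P>(\<xi> in gauss J. \<forall>i<d. stat i \<xi> \<le> stat j \<xi>) \<le> measure (gauss J)
      ({\<xi> \<in> space (gauss J). \<rho> * L \<le> ip J ?v \<xi>} \<union> {\<xi> \<in> space (gauss J). \<rho> * L \<le> ip J ?w \<xi>})"
      (is "measure _ ?C \<le> measure _ ?U")
  proof (rule G.finite_measure_mono)
    show "?C \<subseteq> ?U"
    proof (rule subsetI)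
      fix \<xi> assume \<xi>: "\<xi> \<in> ?C"
      have "T * (1 - (2 * real K - 1) * \<mu>) \<le> T * gap" using gap_ge T_nonneg by (intro mult_left_mono) auto
      also have "\<dots> \<le> sg * signal lead - \<bar>signal j\<bar>" by (rule signal_gap[OF j])
      also have "\<dots> \<le> stat lead \<xi> - \<sigma> * ip J ?u \<xi> - stat j \<xi> + \<sigma> * \<bar>ip J (a j) \<xi>\<bar>"
        using stat_le[of j \<xi>] stat_lead_ge[of \<xi>] by linarith
      also have "\<dots> \<le> \<sigma> * (\<bar>ip J (a j) \<xi>\<bar> - ip J ?u \<xi>)"
        using \<xi> lead by (simp add: algebra_simps)
      finally have "\<sigma> * (\<rho> * L) \<le> \<sigma> * (\<bar>ip J (a j) \<xi>\<bar> - ip J ?u \<xi>)" using TL by (simp add: ac_simps)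
      then have "\<rho> * L \<le> \<bar>ip J (a j) \<xi>\<bar> - ip J ?u \<xi>" using \<sigma> by simp
      then have "\<rho> * L \<le> ip J ?v \<xi> \<or> \<rho> * L \<le> ip J ?w \<xi>"
        unfolding ip_diff_left ip_scale_left[of J "- 1"] by linarith
      then show "\<xi> \<in> ?U"
        using \<xi> by auto
    qed
  qed auto
  also have "\<dots> \<le> \<P>(\<xi> in gauss J. \<rho> * L \<le> ip J ?v \<xi>) + \<P>(\<xi> in gauss J. \<rho> * L \<le> ip J ?w \<xi>)"
    by (rule measure_Un_le) auto
  also have "\<dots> \<le> normal_tail (\<rho> * L / ?B) + normal_tail (\<rho> * L / ?B)"
    by (intro add_mono gauss_linear_tail vw B) (use \<rho> L in auto)
  finally show ?thesis by simp
qed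

text \<open>Let \<open>M\<close> be the quantity subtracted from \<open>t\<close>. All signals
  involved are at most \<open>\<sigma> * M / 2\<close>, so if \<open>j\<close> is maximal, no noise
  outside \<open>S\<close> exceeds that of \<open>j\<close> by more than \<open>M\<close>. Either
  the noise of \<open>j\<close> reaches \<open>t - M\<close>, or the maximum over these indices
  stays below \<open>t\<close>.\<close>

lemma prob_tie_le_max:
  assumes L: "0 < L" and TL: "T * (1 - (2 * real K - 1) * \<mu>) = \<rho> * \<sigma> * L"
    and j: "j < d" "j \<notin> S - s"
    and t: "0 < t - 2 * real K * \<mu> * \<rho> * L / (1 - (2 * real K - 1) * \<mu>)"
    and w: "0 < w" "2 * real K * normal_tail (w / real K) \<le> 1 / 2"
    and yz: "t + w + sqrt \<mu> * y \<le> sqrt (1 - \<mu>) * z"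
  shows "\<P>(\<xi> in gauss J. \<forall>i<d. stat i \<xi> \<le> stat j \<xi>) \<le>
    2 * normal_tail (t - 2 * real K * \<mu> * \<rho> * L / (1 - (2 * real K - 1) * \<mu>))
    + 2 * (normal_tail y + (1 - normal_tail z) ^ (d - K))"
proof -
  interpret G: prob_space "gauss J" by (rule prob_space_gauss)
  define M where "M = 2 * real K * \<mu> * \<rho> * L / (1 - (2 * real K - 1) * \<mu>)"
  have D: "0 < 1 - (2 * real K - 1) * \<mu>" using mu' by simp
  have M: "2 * (T * (real K * \<mu>)) = \<sigma> * M"
  proof -
    have "T = \<rho> * \<sigma> * L / (1 - (2 * real K - 1) * \<mu>)" using TL D by (simp add: eq_divide_eq)
    then show ?thesis unfolding M_def by simp
  qed
  \<comment> \<open>Outside \<open>S\<close> two bounds are available: on the signal, as the index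
    is not in \<open>S - s\<close>, and on the projection coefficients, as it is not in
    \<open>s\<close>. Moreover the number \<open>d - K\<close> does not depend on
    \<open>s\<close>.\<close>
  define I where "I = {..<d} - S"
  have finI: "finite I" "card I = d - K" unfolding I_def using S card_Diff_subset[OF finite_S(1) S(1)] by auto
  have Is: "i < d" "i \<notin> s" "i \<notin> S - s" if "i \<in> I" for i using that s by (auto simp: I_def)
  define J2 where "J2 = {n..<2 * n}"
  interpret G2: prob_space "gauss J2" by (rule prob_space_gauss)
  define x' where "x' = (\<lambda>k j. x k (j - n))"
  define p where "p = (\<lambda>i j. \<Sum>k\<in>s. b i k * x' k j)"
  \<comment> \<open>The projection has at most \<open>K\<close> terms with coefficients bounded by
    1, hence the level \<open>w / K\<close> for each. Dividing by the probability 1/2 produces the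
    factor 2 in the conclusion.\<close>
  have half: "1 / 2 \<le> \<P>(\<xi> in gauss J2. \<forall>i\<in>I. ip J2 (p i) \<xi> \<le> w)"
  proof -
    have "real (card s) * (2 * normal_tail (w / real K)) \<le> real K * (2 * normal_tail (w / real K))"
      using q normal_tail_nonneg by (intro mult_right_mono) (auto simp: q_def)
    then have "1 / 2 \<le> 1 - real (card s) * (2 * normal_tail (w / real K))" using w(2) by simp
    also have "\<dots> \<le> \<P>(\<xi> in gauss J2. \<forall>k\<in>s. \<bar>ip J2 (x' k) \<xi>\<bar> \<le> w / real K)"
      by (rule prob_Ball_abs_le) (use finite_S w K1 unit s_lt in \<open>auto simp: J2_def x'_def ip_shift\<close>)
    also have "\<dots> \<le> \<P>(\<xi> in gauss J2. \<forall>i\<in>I. ip J2 (p i) \<xi> \<le> w)" (is "measure _ ?X \<le> measure _ ?P")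
    proof (rule G2.finite_measure_mono)
      show "?P \<in> sets (gauss J2)" using finI by measurable
      show "?X \<subseteq> ?P"
      proof (intro subsetI CollectI conjI ballI)
        fix \<xi> i assume \<xi>: "\<xi> \<in> ?X" and i: "i \<in> I"
        have "ip J2 (p i) \<xi> = (\<Sum>k\<in>s. b i k * ip J2 (x' k) \<xi>)" unfolding p_def by (rule ip_sum_left)
        also have "\<dots> \<le> (\<Sum>k\<in>s. w / real K)"
        proof (rule sum_mono)
          fix k assume k: "k \<in> s"
          have "\<bar>b i k * ip J2 (x' k) \<xi>\<bar> \<le> 1 * (w / real K)"
            unfolding abs_mult using \<xi> k Is[OF i] by (intro mult_mono abs_b_le_1) auto
          then show "b i k * ip J2 (x' k) \<xi> \<le> w / real K" by linarith
        qed
        also have "\<dots> = q * (w / real K)" by (simp add: q_def)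
        also have "\<dots> \<le> real K * (w / real K)" using q w by (intro mult_right_mono) auto
        finally show "ip J2 (p i) \<xi> \<le> w" using K1 by simp
      qed auto
    qed
    finally show ?thesis .
  qed
  have "\<P>(\<xi> in gauss J. \<forall>i\<in>I. ip J (a i) \<xi> \<le> t) * \<P>(\<xi> in gauss J2. \<forall>i\<in>I. ip J2 (p i) \<xi> \<le> w)
    \<le> normal_tail y + (1 - normal_tail z) ^ card I"
  proof (rule gauss_max_lower_tail)
    have pp: "ip J2 (p i) (p l) = ip J (\<lambda>j. \<Sum>k\<in>s. b i k * x k j) (\<lambda>j. \<Sum>k\<in>s. b l k * x k j)" for i l
      unfolding p_def x'_def J2_def by (rule ip_shift)
    have "ip J (x i) (x l) = ip J (a i) (a l) + ip J2 (p i) (p l)" if "i < d" "l < d" for i l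
    proof -
      have e: "x i = (\<lambda>j. a i j + (\<Sum>k\<in>s. b i k * x k j))" for i by (simp add: a_def)
      show ?thesis
        unfolding pp using ip_orth_sum[OF that(1), of "b l"] ip_orth_sum[OF that(2), of "b i"]
        by (subst (1) e, subst (2) e)
          (simp add: ip_add_left ip_add_right ip_commute[of J "\<lambda>j. \<Sum>k\<in>s. b i k * x k j" "a l"])
    qed
    note gram = this[symmetric]
    show "ip J (a i) (a i) + ip J2 (p i) (p i) = 1" if "i \<in> I" for i
      using gram[OF Is(1)[OF that] Is(1)[OF that]] unit[OF Is(1)[OF that]] by simp
    show "ip J (a i) (a l) + ip J2 (p i) (p l) \<le> \<mu>" if "i \<in> I" "l \<in> I" "i \<noteq> l" for i l
      using gram[OF Is(1)[OF that(1)] Is(1)[OF that(2)]] incoh[OF Is(1)[OF that(1)] Is(1)[OF that(2)] that(3)] by simp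
  qed (use finI mu mu' yz in \<open>auto simp: J2_def\<close>)
  moreover have "\<P>(\<xi> in gauss J. \<forall>i\<in>I. ip J (a i) \<xi> \<le> t) * (1 / 2) \<le>
      \<P>(\<xi> in gauss J. \<forall>i\<in>I. ip J (a i) \<xi> \<le> t) * \<P>(\<xi> in gauss J2. \<forall>i\<in>I. ip J2 (p i) \<xi> \<le> w)"
    using half by (intro mult_left_mono) auto
  ultimately have max: "\<P>(\<xi> in gauss J. \<forall>i\<in>I. ip J (a i) \<xi> \<le> t) \<le> 2 * (normal_tail y + (1 - normal_tail z) ^ (d - K))"
    using finI by simp
  have "\<P>(\<xi> in gauss J. \<forall>i<d. stat i \<xi> \<le> stat j \<xi>) \<le> measure (gauss J)
      ({\<xi> \<in> space (gauss J). t - M \<le> \<bar>ip J (a j) \<xi>\<bar>} \<union> {\<xi> \<in> space (gauss J). \<forall>i\<in>I. ip J (a i) \<xi> \<le> t})"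
      (is "measure _ ?C \<le> measure _ ?U")
  proof (rule G.finite_measure_mono)
    show "?U \<in> sets (gauss J)"
      using finI by measurable
    show "?C \<subseteq> ?U"
    proof (rule subsetI)
      fix \<xi> assume \<xi>: "\<xi> \<in> ?C"
      have "ip J (a i) \<xi> \<le> t" if i: "i \<in> I" and nt: "\<not> t - M \<le> \<bar>ip J (a j) \<xi>\<bar>" for i
      proof -
        have "\<sigma> * \<bar>ip J (a i) \<xi>\<bar> \<le> stat i \<xi> + \<bar>signal i\<bar>"
          unfolding stat_def using \<sigma> by (simp add: abs_mult[of \<sigma>, symmetric, simplified abs_of_pos[OF \<sigma>]])
        also have "\<dots> \<le> (\<bar>signal j\<bar> + \<sigma> * \<bar>ip J (a j) \<xi>\<bar>) + \<bar>signal i\<bar>"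
          using \<xi> Is[OF i] stat_le[of j \<xi>] by force
        also have "\<dots> \<le> \<sigma> * \<bar>ip J (a j) \<xi>\<bar> + \<sigma> * M"
          using abs_signal_le'[OF j] abs_signal_le'[OF Is(1)[OF i] Is(3)[OF i]] M by linarith
        also have "\<dots> = \<sigma> * (\<bar>ip J (a j) \<xi>\<bar> + M)" by (simp add: algebra_simps)
        finally have "\<bar>ip J (a i) \<xi>\<bar> \<le> \<bar>ip J (a j) \<xi>\<bar> + M" using \<sigma> by simp
        then show ?thesis using nt by linarith
      qed
      then show "\<xi> \<in> ?U"
        using \<xi> by auto
    qed
  qed
  also have "\<dots> \<le> \<P>(\<xi> in gauss J. t - M \<le> \<bar>ip J (a j) \<xi>\<bar>) + \<P>(\<xi> in gauss J. \<forall>i\<in>I. ip J (a i) \<xi> \<le> t)"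
    by (rule measure_Un_le) (use finI in measurable)
  also have "\<P>(\<xi> in gauss J. t - M \<le> \<bar>ip J (a j) \<xi>\<bar>) \<le> 2 * normal_tail ((t - M) / 1)"
    by (rule gauss_abs_tail) (use norm_bounds(1)[OF j(1)] t in \<open>auto simp: M_def\<close>)
  finally show ?thesis using max by (simp add: M_def)
qed

end

subsection \<open>Large dimensions\<close>

text \<open>The scale of the maximum of \<open>d\<close> standard normals: at this level
  \<open>exp (- t^2 / 2)\<close> equals exactly \<open>1 / d\<close>.\<close>

definition noise_max :: "nat \<Rightarrow> real" where
  "noise_max d = sqrt (2 * ln (real d))"

lemma noise_max_at_top: "filterlim noise_max at_top sequentially"
  unfolding noise_max_def by real_asymp

lemma noise_max_exp: "d \<ge> 1 \<Longrightarrow> exp ((noise_max d)\<^sup>2 / 2) = real d"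
  by (simp add: noise_max_def)

lemma normal_tail_tendsto_0: "(normal_tail \<longlongrightarrow> 0) at_top"
proof (rule Lim_null_comparison)
  show "\<forall>\<^sub>F t in at_top. norm (normal_tail t) \<le> exp (- t\<^sup>2 / 2)"
    using eventually_ge_at_top[of 0] by eventually_elim (use normal_tail_le_exp in \<open>simp add: normal_tail_nonneg\<close>)
  show "((\<lambda>t :: real. exp (- t\<^sup>2 / 2)) \<longlongrightarrow> 0) at_top" by real_asymp
qed

lemma eventually_normal_tail_le:
  assumes "0 < c" "0 < e"
  shows "\<forall>\<^sub>F d in sequentially. normal_tail (c * noise_max d) \<le> e"
proof -
  have "filterlim (\<lambda>d. c * noise_max d) at_top sequentially"
    using noise_max_at_top assms by (intro filterlim_tendsto_pos_mult_at_top[OF tendsto_const])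
  then have "((\<lambda>d. normal_tail (c * noise_max d)) \<longlongrightarrow> 0) sequentially"
    by (rule filterlim_compose[OF normal_tail_tendsto_0])
  from order_tendstoD(2)[OF this assms(2)] show ?thesis by (rule eventually_mono) simp
qed

text \<open>The Gaussian weight \<open>1 / d\<close> only cancels the factor \<open>d\<close>. What
  tends to 0 is the remaining \<open>2 / (sqrt (2 * pi) * noise_max d)\<close> from Mills' bound,
  which is at most 1/10 once \<open>noise_max d \<ge> 10\<close>.\<close>

lemma eventually_union_noise:
  "\<forall>\<^sub>F d in sequentially. 2 * real d * normal_tail (noise_max d) \<le> 1 / 10"
proof -
  have "\<forall>\<^sub>F d in sequentially. noise_max d \<ge> 10"
    using noise_max_at_top by (simp add: filterlim_at_top)
  then show ?thesis
    using eventually_ge_at_top[of 1]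
  proof eventually_elim
    case (elim d)
    have "normal_tail (noise_max d) \<le> std_normal_density (noise_max d) / noise_max d"
      using elim by (intro normal_tail_mills) simp
    also have "std_normal_density (noise_max d) = 1 / (sqrt (2 * pi) * real d)"
      using noise_max_exp[of d] elim by (simp add: std_normal_density_def exp_minus field_simps)
    finally have "2 * real d * normal_tail (noise_max d) \<le> 2 * real d * (1 / (sqrt (2 * pi) * real d) / noise_max d)"
      by (intro mult_left_mono) auto
    also have "\<dots> = 2 / (sqrt (2 * pi) * noise_max d)" using elim by (simp add: field_simps)
    also have "\<dots> \<le> 2 / (2 * 10)"
    proof -
      have "2 \<le> sqrt (2 * pi)" using pi_gt3 by (intro real_le_rsqrt) simp
      then have "2 * 10 \<le> sqrt (2 * pi) * noise_max d" using elim by (intro mult_mono) auto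
      then show ?thesis by (intro divide_left_mono) auto
    qed
    finally show ?case by simp
  qed
qed

text \<open>Write L for \<open>noise_max d\<close>. The first tail is smaller than the one on the
  right by the factor \<open>exp (- (\<eta> * L)^2 / 2)\<close>. For the power, \<open>d - K\<close>
  times the tail at \<open>(1 - \<eta>) * L\<close> grows like the exponential of a multiple of L^2,
  so the power is below \<open>exp (- L^3)\<close>, which is negligible against every Gaussian
  tail.\<close>

lemma eventually_max_noise:
  fixes K :: nat and \<tau> \<eta> e :: real
  assumes \<eta>: "0 < \<eta>" "\<eta> < 1" and \<tau>: "0 \<le> \<tau>" and e: "0 < e"
  shows "\<forall>\<^sub>F d in sequentially. normal_tail ((\<tau> + \<eta>) * noise_max d)
      + (1 - normal_tail ((1 - \<eta>) * noise_max d)) ^ (d - K) \<le> e * normal_tail (\<tau> * noise_max d)"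
proof -
  define c where "c = (1 - (1 - \<eta>)\<^sup>2) / 2"
  have "(1 - \<eta>)\<^sup>2 < 1" using \<eta> by (simp add: power_less_one_iff abs_square_less_1)
  then have c: "0 < c" by (simp add: c_def)
  \<comment> \<open>The cube is a growth rate between two others: eventually below
    \<open>exp (c * l^2)\<close>, yet above every quadratic exponent, as the next estimate
    requires.\<close>
  have A: "\<forall>\<^sub>F l in at_top. l ^ 3 \<le> (exp (l\<^sup>2 / 2) - real K) * (1 / sqrt (2 * pi) * exp (- (((1 - \<eta>) * l + 1)\<^sup>2 / 2)))"
  proof -
    have "\<forall>\<^sub>F l in at_top. l ^ 3 \<le> 1 / sqrt (2 * pi) * exp (c * l\<^sup>2 - (1 - \<eta>) * l - 1 / 2) - real K / sqrt (2 * pi)"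
      using c \<eta> by real_asymp
    then show ?thesis
      using eventually_ge_at_top[of 0]
    proof eventually_elim
      case (elim l)
      have "exp (l\<^sup>2 / 2) * exp (- (((1 - \<eta>) * l + 1)\<^sup>2 / 2)) = exp (c * l\<^sup>2 - (1 - \<eta>) * l - 1 / 2)"
        unfolding c_def exp_add[symmetric] by (rule arg_cong[where f = exp]) (simp add: field_simps power2_eq_square)
      moreover have "real K * exp (- (((1 - \<eta>) * l + 1)\<^sup>2 / 2)) \<le> real K * 1" by (intro mult_left_mono) auto
      ultimately have "exp (c * l\<^sup>2 - (1 - \<eta>) * l - 1 / 2) - real K
          \<le> (exp (l\<^sup>2 / 2) - real K) * exp (- (((1 - \<eta>) * l + 1)\<^sup>2 / 2))"
        by (simp add: left_diff_distrib)
      then have "(exp (c * l\<^sup>2 - (1 - \<eta>) * l - 1 / 2) - real K) / sqrt (2 * pi)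
          \<le> (exp (l\<^sup>2 / 2) - real K) * exp (- (((1 - \<eta>) * l + 1)\<^sup>2 / 2)) / sqrt (2 * pi)"
        by (intro divide_right_mono) auto
      with elim show ?case by (simp add: diff_divide_distrib)
    qed
  qed
  have B: "\<forall>\<^sub>F l in at_top. exp (- (l ^ 3)) \<le> e / 2 * (1 / sqrt (2 * pi) * exp (- ((\<tau> * l + 1)\<^sup>2 / 2)))"
  proof -
    have "((\<lambda>l. exp (- (l ^ 3) + (\<tau> * l + 1)\<^sup>2 / 2)) \<longlongrightarrow> 0) at_top"
    proof (cases "\<tau> = 0")
      case False
      then have "0 < \<tau>" using \<tau> by simp
      then show ?thesis by real_asymp
    qed (simp, real_asymp)
    moreover have "0 < e / 2 / sqrt (2 * pi)" using e by simp
    ultimately have "\<forall>\<^sub>F l in at_top. exp (- (l ^ 3) + (\<tau> * l + 1)\<^sup>2 / 2) < e / 2 / sqrt (2 * pi)"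
      by (rule order_tendstoD(2))
    then show ?thesis
    proof eventually_elim
      case (elim l)
      have "exp (- (l ^ 3)) = exp (- (l ^ 3) + (\<tau> * l + 1)\<^sup>2 / 2) * exp (- ((\<tau> * l + 1)\<^sup>2 / 2))"
        by (simp add: exp_add[symmetric])
      also have "\<dots> \<le> e / 2 / sqrt (2 * pi) * exp (- ((\<tau> * l + 1)\<^sup>2 / 2))"
        using elim by (intro mult_right_mono) auto
      finally show ?case by simp
    qed
  qed
  have C: "\<forall>\<^sub>F l in at_top. exp (- (\<eta> * l)\<^sup>2 / 2) \<le> e / 2"
  proof -
    have "((\<lambda>l. exp (- (\<eta> * l)\<^sup>2 / 2)) \<longlongrightarrow> 0) at_top" using \<eta> by real_asymp
    from order_tendstoD(2)[OF this, of "e / 2"] e show ?thesis by (auto elim: eventually_mono)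
  qed
  show ?thesis
    using eventually_ge_at_top[of "max 1 K"] eventually_compose_filterlim[OF A noise_max_at_top]
      eventually_compose_filterlim[OF B noise_max_at_top] eventually_compose_filterlim[OF C noise_max_at_top]
      eventually_compose_filterlim[OF eventually_ge_at_top[of 0] noise_max_at_top]
  proof eventually_elim
    case (elim d)
    define l where "l = noise_max d"
    have l: "0 \<le> l" "exp (l\<^sup>2 / 2) = real d" using elim noise_max_exp by (auto simp: l_def)
    have dens: "1 / sqrt (2 * pi) * exp (- (t\<^sup>2 / 2)) = std_normal_density t" for t
      by (simp add: std_normal_density_def)
    have "normal_tail (\<tau> * l + \<eta> * l) \<le> exp (- (\<eta> * l)\<^sup>2 / 2) * normal_tail (\<tau> * l)"
      using l \<tau> \<eta> by (intro normal_tail_shift) auto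
    also have "\<dots> \<le> e / 2 * normal_tail (\<tau> * l)"
      using elim normal_tail_nonneg by (intro mult_right_mono) (auto simp: l_def)
    finally have 1: "normal_tail ((\<tau> + \<eta>) * l) \<le> e / 2 * normal_tail (\<tau> * l)" by (simp add: algebra_simps)
    let ?p = "normal_tail ((1 - \<eta>) * l)"
    have "(1 - ?p) ^ (d - K) \<le> exp (- ?p) ^ (d - K)"
      using normal_tail_le_1[of "(1 - \<eta>) * l"] exp_ge_add_one_self[of "- ?p"] by (intro power_mono) auto
    also have "\<dots> = exp (- ((real d - real K) * ?p))"
      using elim by (simp add: exp_of_nat_mult[symmetric] of_nat_diff)
    also have "\<dots> \<le> exp (- (l ^ 3))"
    proof -
      have "l ^ 3 \<le> (real d - real K) * std_normal_density ((1 - \<eta>) * l + 1)"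
        using elim(2) unfolding dens l_def[symmetric] l(2) .
      also have "\<dots> \<le> (real d - real K) * ?p"
        using l \<eta> elim by (intro mult_left_mono normal_tail_ge_density) auto
      finally show ?thesis by simp
    qed
    also have "\<dots> \<le> e / 2 * std_normal_density (\<tau> * l + 1)"
      using elim(3) unfolding dens l_def[symmetric] by simp
    also have "\<dots> \<le> e / 2 * normal_tail (\<tau> * l)"
      using l \<tau> e by (intro mult_left_mono normal_tail_ge_density) auto
    finally show ?case using 1 by (simp add: l_def)
  qed
qed

context omp_machine
begin

section \<open>What the thresholds Q0, Q1 and Q2 express\<close>

lemma \<kappa>_le_1: "\<kappa> \<le> 1"
proof -
  have "\<kappa> \<le> 1 * 1" unfolding \<kappa>_def using \<delta> mu mu' delta_small by (intro mult_mono) auto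
  then show ?thesis by simp
qed

text \<open>\<open>Q0\<close> is defined so that a margin of
  \<open>sqrt (Q0 d K) * noise_max d\<close> is worth exactly this factor in
  \<open>normal_tail_shift\<close>.\<close>

lemma Q0_noise:
  assumes "2 \<le> d"
  shows "0 \<le> Q0 d K" "exp (- (sqrt (Q0 d K) * noise_max d)\<^sup>2 / 2) = 1 / (88 * sqrt 2 * real K)"
proof -
  have l: "0 < ln (real d)" using assms by simp
  have "1 \<le> sqrt (2 :: real)" by simp
  then have "1 \<le> 88 * sqrt (2 :: real)" by linarith
  then have "1 * 1 \<le> 88 * sqrt 2 * real K" using K1 by (intro mult_mono) auto
  then have p: "1 \<le> 88 * sqrt 2 * real K" by simp
  show nn: "0 \<le> Q0 d K" unfolding Q0_def using l p by (intro divide_nonneg_pos) auto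
  have "(sqrt (Q0 d K) * noise_max d)\<^sup>2 / 2 = Q0 d K * ln (real d)"
    using nn l by (simp add: noise_max_def power_mult_distrib)
  also have "\<dots> = ln (88 * sqrt 2 * real K)" using l by (simp add: Q0_def)
  finally have e: "- (sqrt (Q0 d K) * noise_max d)\<^sup>2 / 2 = - ln (88 * sqrt 2 * real K)" by simp
  show "exp (- (sqrt (Q0 d K) * noise_max d)\<^sup>2 / 2) = 1 / (88 * sqrt 2 * real K)"
  proof -
    have "0 < 88 * sqrt 2 * real K" using p by linarith
    then show ?thesis unfolding e exp_minus by (simp only: exp_ln inverse_eq_divide)
  qed
qed

text \<open>With \<open>B\<close> the square root in \<open>Q2\<close>,
  \<open>\<kappa> \<le> B\<close> makes \<open>B / (\<kappa> + B)\<close> at least 1/2. In the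
  regime of \<open>Q2\<close> this provides the lower bound on \<rho> for
  \<open>small_rho_condition\<close>.\<close>

lemma Q2_half:
  assumes "2 \<le> d" shows "1 / 2 \<le> Q2 d K \<mu>"
proof -
  let ?B = "sqrt (2 + 2 * (\<mu> + delta K \<mu>))"
  have "1 \<le> ?B" using mu \<delta> by (intro real_le_rsqrt) auto
  then have B: "\<kappa> \<le> ?B" "0 < ?B" using \<kappa>_le_1 by linarith+
  have "Q2 d K \<mu> = ?B * (1 + \<kappa> * sqrt (Q0 d K)) / (\<kappa> + ?B)"
    unfolding Q2_def \<kappa>_def by simp
  moreover have "?B * 1 \<le> ?B * (1 + \<kappa> * sqrt (Q0 d K))"
    using B delta_small Q0_noise(1)[OF assms] by (intro mult_left_mono) auto
  moreover have "(\<kappa> + ?B) * (1 / 2) \<le> ?B" using B by simp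
  ultimately have "(1 / 2) * (\<kappa> + ?B) \<le> ?B * (1 + \<kappa> * sqrt (Q0 d K))" "Q2 d K \<mu> = ?B * (1 + \<kappa> * sqrt (Q0 d K)) / (\<kappa> + ?B)"
    by linarith+
  moreover have "0 < \<kappa> + ?B" using B delta_small by linarith
  ultimately show ?thesis using pos_le_divide_eq[of "\<kappa> + ?B" "1 / 2"] by simp
qed

text \<open>The inequality is affine in \<rho>, with equality at
  \<open>\<rho> = Q2 d K \<mu>\<close>.\<close>

lemma Q2_condition:
  assumes d: "2 \<le> d" and \<rho>: "Q2 d K \<mu> \<le> \<rho>"
  shows "(1 - \<rho>) / \<kappa> + sqrt (Q0 d K) \<le> \<rho> / sqrt (2 + 2 * (\<mu> + delta K \<mu>))"
proof -
  define B where "B = sqrt (2 + 2 * (\<mu> + delta K \<mu>))"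
  define Q where "Q = sqrt (Q0 d K)"
  have B: "0 < B" unfolding B_def using mu \<delta> by simp
  have "B * (1 + \<kappa> * Q) / (\<kappa> + B) \<le> \<rho>"
    using \<rho> unfolding Q2_def B_def \<kappa>_def Q_def by simp
  then have "B * (1 + \<kappa> * Q) \<le> \<rho> * (\<kappa> + B)" using B delta_small by (simp add: divide_le_eq)
  then have "(1 - \<rho> + \<kappa> * Q) * B \<le> \<rho> * \<kappa>" by (simp add: algebra_simps)
  then have "(1 - \<rho> + \<kappa> * Q) / \<kappa> \<le> \<rho> / B" using B delta_small by (simp add: divide_le_eq le_divide_eq field_simps)
  moreover have "(1 - \<rho> + \<kappa> * Q) / \<kappa> = (1 - \<rho>) / \<kappa> + Q" using delta_small by (simp add: field_simps)
  ultimately show ?thesis by (simp add: B_def Q_def)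
qed

text \<open>The first conclusion is affine in \<rho>, with equality at \<open>Q1\<close>. The case
  condition says \<open>2 * K * \<mu> * (1 - \<mu>) < 1 - (2 * K - 1) * \<mu>\<close>, which keeps
  the coefficient \<open>E\<close> of \<rho> positive. The second conclusion holds because the
  numerator of \<open>Q1\<close> is at least \<epsilon> and \<open>E \<le> 1\<close>.\<close>

lemma Q1_condition:
  assumes d: "2 \<le> d" and \<epsilon>: "0 < \<epsilon>" "\<epsilon> < 1" and \<rho>: "Q1 d K \<mu> \<epsilon> \<le> \<rho>"
    and c: "(4 * real K - 1) * \<mu> - 2 * real K * \<mu>\<^sup>2 < 1"
  shows "(1 - \<rho>) / \<kappa> + sqrt (Q0 d K) \<le>
      (1 - \<epsilon>) * sqrt (1 - \<mu>) - 2 * real K * \<mu> * \<rho> / (1 - (2 * real K - 1) * \<mu>)" "\<epsilon> \<le> \<rho>"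
proof -
  define \<tau> where "\<tau> = (1 - \<epsilon>) * sqrt (1 - \<mu>)"
  define Q where "Q = sqrt (Q0 d K)"
  define D where "D = 1 - (2 * real K - 1) * \<mu>"
  have D: "0 < D" using mu' by (simp add: D_def)
  have Q: "0 \<le> Q" using Q0_noise(1)[OF d] by (simp add: Q_def)
  define E where "E = 1 - 2 * \<mu> * real K * \<kappa> / D"
  have "2 * \<mu> * real K * \<kappa> \<le> 2 * \<mu> * real K * (1 * (1 - \<mu>))"
    unfolding \<kappa>_def using mu mu' \<delta> delta_small by (intro mult_left_mono mult_right_mono) auto
  also have "\<dots> < D" using c by (simp add: D_def algebra_simps power2_eq_square)
  finally have "2 * \<mu> * real K * \<kappa> / D < 1" using D by simp
  moreover have "0 \<le> 2 * \<mu> * real K * \<kappa> / D" using mu delta_small D by simp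
  ultimately have E: "0 < E" "E \<le> 1" by (auto simp: E_def)
  have "Q1 d K \<mu> \<epsilon> = (1 - \<kappa> * (\<tau> - Q)) / E"
    unfolding Q1_def \<tau>_def Q_def E_def D_def \<kappa>_def by (simp add: ac_simps)
  then have *: "1 - \<kappa> * (\<tau> - Q) \<le> \<rho> * E" using \<rho> E by (simp add: divide_le_eq)
  then have "(1 - \<rho>) + \<kappa> * Q \<le> \<kappa> * (\<tau> - 2 * real K * \<mu> * \<rho> / D)"
    by (simp add: E_def algebra_simps)
  then have "((1 - \<rho>) + \<kappa> * Q) / \<kappa> \<le> \<tau> - 2 * real K * \<mu> * \<rho> / D"
    using delta_small by (simp add: divide_le_eq mult.commute)
  moreover have "((1 - \<rho>) + \<kappa> * Q) / \<kappa> = (1 - \<rho>) / \<kappa> + Q" using delta_small by (simp add: field_simps)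
  ultimately show "(1 - \<rho>) / \<kappa> + sqrt (Q0 d K) \<le>
      (1 - \<epsilon>) * sqrt (1 - \<mu>) - 2 * real K * \<mu> * \<rho> / (1 - (2 * real K - 1) * \<mu>)"
    by (simp add: \<tau>_def Q_def D_def)
  have "\<kappa> * (\<tau> - Q) \<le> \<kappa> * \<tau>" using Q delta_small by (intro mult_left_mono) auto
  also have "\<dots> \<le> 1 * ((1 - \<epsilon>) * 1)"
    unfolding \<tau>_def using \<kappa>_le_1 \<epsilon> mu mu' delta_small by (intro mult_mono mult_left_mono) auto
  finally have e: "\<epsilon> \<le> \<rho> * E" using * by simp
  then have "0 < \<rho>" using \<epsilon> E by (smt (verit) zero_less_mult_pos2)
  then have "\<rho> * E \<le> \<rho> * 1" using E by (intro mult_left_mono) auto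
  then show "\<epsilon> \<le> \<rho>" using e by simp
qed

text \<open>The lower bound on \<epsilon> means
  \<open>sqrt (\<mu> + delta K \<mu>) * (1 - \<epsilon>) < \<epsilon>\<close>. For
  \<open>\<epsilon> \<le> \<rho> \<le> 1\<close> it gives
  \<open>sqrt \<mu> * (1 - \<rho>) \<le> \<rho>\<close>, which is then multiplied by
  \<open>3 * sqrt \<mu> \<le> 2\<close>.\<close>

lemma small_rho_condition:
  assumes d: "2 \<le> d" and \<epsilon>: "sqrt (\<mu> + delta K \<mu>) / (1 + sqrt (\<mu> + delta K \<mu>)) < \<epsilon>"
    and \<rho>: "1 / 2 \<le> \<rho> \<or> \<epsilon> \<le> \<rho>" and K2: "2 \<le> K"
  shows "3 * \<mu> * (1 - \<rho>) \<le> 2 * \<rho>"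
proof -
  have m3: "3 * \<mu> < 1" using mu'(4) K2 by simp
  have "0 \<le> sqrt (\<mu> + delta K \<mu>) / (1 + sqrt (\<mu> + delta K \<mu>))" using mu \<delta> by simp
  then have \<epsilon>0: "0 < \<epsilon>" using \<epsilon> by linarith
  from \<rho> show ?thesis
  proof
    assume h: "1 / 2 \<le> \<rho>"
    have "3 * \<mu> * (1 - \<rho>) \<le> 3 * \<mu> * 1" using h mu by (intro mult_left_mono) auto
    then show ?thesis using h m3 by linarith
  next
    assume h: "\<epsilon> \<le> \<rho>"
    let ?c = "sqrt (\<mu> + delta K \<mu>)"
    have c: "0 \<le> ?c" using mu \<delta> by simp
    then have "?c < \<epsilon> * (1 + ?c)" using \<epsilon> pos_divide_less_eq[of "1 + ?c" ?c \<epsilon>] by linarith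
    then have "?c * (1 - \<epsilon>) \<le> \<epsilon>" by (simp add: algebra_simps)
    moreover have "?c * (1 - \<rho>) \<le> ?c * (1 - \<epsilon>)" using c h by (intro mult_left_mono) auto
    ultimately have 1: "?c * (1 - \<rho>) \<le> \<rho>" using h by linarith
    show ?thesis
    proof (cases "\<rho> \<le> 1")
      case True
      have "sqrt \<mu> * (1 - \<rho>) \<le> ?c * (1 - \<rho>)" using \<delta> True by (intro mult_right_mono) auto
      then have 2: "sqrt \<mu> * (1 - \<rho>) \<le> \<rho>" using 1 by simp
      have s: "sqrt \<mu> \<le> 2 / 3" using m3 mu by (intro real_le_lsqrt) (auto simp: power2_eq_square)
      have "3 * \<mu> * (1 - \<rho>) = 3 * sqrt \<mu> * (sqrt \<mu> * (1 - \<rho>))" using mu by (simp add: mult.assoc[symmetric])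
      also have "\<dots> \<le> 3 * sqrt \<mu> * \<rho>" using 2 mu by (intro mult_left_mono) auto
      also have "\<dots> \<le> 2 * \<rho>" using s h \<epsilon>0 by (intro mult_right_mono) auto
      finally show ?thesis .
    next
      case False
      then have "3 * \<mu> * (1 - \<rho>) \<le> 0" using mu by (intro mult_nonneg_nonpos) auto
      then show ?thesis using False by linarith
    qed
  qed
qed

end

text \<open>The number \<open>\<eta>\<close> absorbs all lower-order terms in the tail of the maximum; the lower bound on \<open>\<epsilon>\<close>
  is exactly what leaves room for it.\<close>

definition slack :: "real \<Rightarrow> real \<Rightarrow> real \<Rightarrow> bool" where
  "slack \<mu> \<epsilon> \<eta> \<longleftrightarrow> 0 < \<eta> \<and> \<eta> < 1 \<and>
    (1 - \<epsilon>) * sqrt (1 - \<mu>) + \<eta> + sqrt \<mu> * ((1 - \<epsilon>) * sqrt (1 - \<mu>) + \<eta>) \<le> sqrt (1 - \<mu>) * (1 - \<eta>)"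

definition high_snr :: "nat \<Rightarrow> nat \<Rightarrow> real \<Rightarrow> real \<Rightarrow> real \<Rightarrow> bool" where
  "high_snr d K \<mu> \<epsilon> \<rho> \<longleftrightarrow> (if (4 * real K - 1) * \<mu> - 2 * real K * \<mu>\<^sup>2 \<ge> 1 then \<rho> \<ge> Q2 d K \<mu>
    else \<rho> \<ge> min (Q1 d K \<mu> \<epsilon>) (Q2 d K \<mu>))"

lemma high_snr_mono: "high_snr d K \<mu> \<epsilon> \<rho> \<Longrightarrow> \<rho> \<le> \<rho>' \<Longrightarrow> high_snr d K \<mu> \<epsilon> \<rho>'"
  by (auto simp: high_snr_def split: if_splits)

text \<open>Only the dimension is constrained, which makes the threshold uniform over all instances.\<close>

definition large_dim :: "nat \<Rightarrow> real \<Rightarrow> real \<Rightarrow> real \<Rightarrow> nat \<Rightarrow> bool" where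
  "large_dim K \<mu> \<epsilon> \<eta> d \<longleftrightarrow> 2 \<le> d \<and>
    2 * real d * normal_tail (noise_max d) \<le> 1 / 10 \<and>
    2 * normal_tail (noise_max d / sqrt (2 + 2 * (\<mu> + delta K \<mu>))) \<le> 9 / (320 * real K) \<and>
    2 * real K * normal_tail (\<eta> * noise_max d / real K) \<le> 1 / 2 \<and>
    2 * (normal_tail (((1 - \<epsilon>) * sqrt (1 - \<mu>) + \<eta>) * noise_max d) + (1 - normal_tail ((1 - \<eta>) * noise_max d)) ^ (d - K))
      \<le> normal_tail ((1 - \<epsilon>) * sqrt (1 - \<mu>) * noise_max d) / (62 * real K)"

lemma eventually_large_dim:
  assumes "1 \<le> K" "0 \<le> \<mu>" "\<mu> < 1 / (2 * real K - 1)" "\<epsilon> < 1" "slack \<mu> \<epsilon> \<eta>"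
  shows "\<forall>\<^sub>F d in sequentially. large_dim K \<mu> \<epsilon> \<eta> d"
proof -
  have \<mu>1: "\<mu> < 1" using coherence_condition[of K \<mu>] assms by auto
  have \<eta>: "0 < \<eta>" "\<eta> < 1" using assms(5) by (auto simp: slack_def)
  have K: "0 < real K" using assms by simp
  have "0 \<le> delta K \<mu>" unfolding delta_eq_delta_at
    using delta_at_mono(2)[of "real K - 1" "real K" \<mu>] coherence_condition[of K \<mu>] assms by auto
  then have B: "0 < 1 / sqrt (2 + 2 * (\<mu> + delta K \<mu>))" using assms by simp
  have e1: "\<forall>\<^sub>F d in sequentially. normal_tail (1 / sqrt (2 + 2 * (\<mu> + delta K \<mu>)) * noise_max d) \<le> 9 / (640 * real K)"
    by (rule eventually_normal_tail_le) (use B K in auto)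
  have e2: "\<forall>\<^sub>F d in sequentially. normal_tail (\<eta> / real K * noise_max d) \<le> 1 / (4 * real K)"
    by (rule eventually_normal_tail_le) (use \<eta> K in auto)
  have e3: "\<forall>\<^sub>F d in sequentially. normal_tail (((1 - \<epsilon>) * sqrt (1 - \<mu>) + \<eta>) * noise_max d)
      + (1 - normal_tail ((1 - \<eta>) * noise_max d)) ^ (d - K) \<le> 1 / (124 * real K) * normal_tail ((1 - \<epsilon>) * sqrt (1 - \<mu>) * noise_max d)"
    by (rule eventually_max_noise) (use assms \<eta> K \<mu>1 in auto)
  show ?thesis
    using e1 e2 e3 eventually_union_noise eventually_ge_at_top[of "max 2 K"]
  proof eventually_elim
    case (elim d)
    then show ?case using K by (simp add: large_dim_def field_simps)
  qed
qed

text \<open>At \<eta> = 0 the inequality of \<open>slack\<close> reduces to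
  \<open>sqrt \<mu> * (1 - \<epsilon>) \<le> \<epsilon>\<close>, and the lower bound on \<epsilon>
  makes it strict.\<close>

lemma ex_slack:
  assumes "0 \<le> \<mu>" "\<mu> < 1" "0 \<le> c" "sqrt (\<mu> + c) / (1 + sqrt (\<mu> + c)) < \<epsilon>" "\<epsilon> < 1"
  shows "\<exists>\<eta>. slack \<mu> \<epsilon> \<eta>"
proof -
  define r where "r = sqrt (1 - \<mu>)"
  define \<tau> where "\<tau> = (1 - \<epsilon>) * r"
  define g where "g = r - \<tau> - sqrt \<mu> * \<tau>"
  have r: "0 < r" "r \<le> 1" using assms by (auto simp: r_def)
  have sm: "0 \<le> sqrt \<mu>" "sqrt \<mu> \<le> 1" using assms by auto
  have "0 < 1 + sqrt (\<mu> + c)" using assms by (simp add: add_pos_nonneg)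
  then have "sqrt (\<mu> + c) * (1 - \<epsilon>) < \<epsilon>" using assms(4) by (simp add: divide_less_eq algebra_simps)
  moreover have "sqrt \<mu> * (1 - \<epsilon>) \<le> sqrt (\<mu> + c) * (1 - \<epsilon>)" using assms by (intro mult_right_mono) auto
  ultimately have "sqrt \<mu> * (1 - \<epsilon>) < \<epsilon>" by simp
  then have "sqrt \<mu> * (1 - \<epsilon>) * r < \<epsilon> * r" using r by (intro mult_strict_right_mono) auto
  then have g: "0 < g" by (simp add: g_def \<tau>_def algebra_simps)
  have "0 < \<tau>" using assms r by (simp add: \<tau>_def)
  moreover have "0 \<le> sqrt \<mu> * \<tau>" using sm \<open>0 < \<tau>\<close> by (intro mult_nonneg_nonneg) auto
  ultimately have g1: "g \<le> 1" unfolding g_def using r by linarith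
  \<comment> \<open>The surplus \<open>g\<close> is split into three, as \<eta> enters three times:
    with coefficients 1, \<open>sqrt \<mu>\<close> and \<open>sqrt (1 - \<mu>)\<close>, all at most
    1.\<close>
  define h where "h = g / 3"
  have h: "0 < h" "h < 1" "3 * h = r - \<tau> - sqrt \<mu> * \<tau>" using g g1 by (auto simp: h_def g_def)
  have "r * h \<le> 1 * h" "sqrt \<mu> * h \<le> 1 * h" using r sm h by (intro mult_right_mono; simp)+
  then have "\<tau> + h + sqrt \<mu> * (\<tau> + h) \<le> r * (1 - h)"
    using h(3) by (simp add: algebra_simps)
  then show ?thesis using h by (intro exI[of _ h]) (auto simp: slack_def \<tau>_def r_def)
qed

text \<open>For \<open>\<rho> < 1\<close> the conditions on \<rho> put the thresholds of the tie
  bounds at least \<open>sqrt Q0 * L\<close> above the winning threshold, and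
  \<open>normal_tail_shift\<close> converts this margin into a factor. That lemma needs a
  nonnegative base point, so \<open>1 \<le> \<rho>\<close> is separate: winning then has probability
  at least 9/20, while the tie bound is small by \<open>large_dim\<close>.\<close>

lemma (in omp_machine) vote_probabilities:
  assumes ld: "large_dim K \<mu> \<epsilon> \<eta> d" and slack: "slack \<mu> \<epsilon> \<eta>"
    and \<epsilon>: "sqrt (\<mu> + delta K \<mu>) / (1 + sqrt (\<mu> + delta K \<mu>)) < \<epsilon>" "\<epsilon> < 1"
    and TL: "T * (1 - (2 * real K - 1) * \<mu>) = \<rho> * \<sigma> * noise_max d"
    and \<rho>: "high_snr d K \<mu> \<epsilon> \<rho>"
  defines "F \<equiv> \<P>(\<xi> in gauss J. \<forall>j<d. j \<notin> S - s \<longrightarrow> stat j \<xi> < stat lead \<xi>)"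
  shows "2 / 5 * normal_tail ((1 - \<rho>) * noise_max d / \<kappa>) \<le> F"
    and "\<And>j. j < d \<Longrightarrow> j \<notin> S - s \<Longrightarrow> \<P>(\<xi> in gauss J. \<forall>i<d. stat i \<xi> \<le> stat j \<xi>) \<le> F / (16 * real K)"
proof -
  define L where "L = noise_max d"
  define Q where "Q = sqrt (Q0 d K)"
  define B where "B = sqrt (2 + 2 * (\<mu> + delta K \<mu>))"
  define \<tau> where "\<tau> = (1 - \<epsilon>) * sqrt (1 - \<mu>)"
  define p where "p = normal_tail ((1 - \<rho>) * L / \<kappa>)"
  have d2: "2 \<le> d" using ld by (simp add: large_dim_def)
  have L: "0 < L" using d2 by (simp add: L_def noise_max_def)
  have K: "0 < real K" using K1 by simp
  have "0 \<le> sqrt (\<mu> + delta K \<mu>) / (1 + sqrt (\<mu> + delta K \<mu>))" using mu \<delta> by simp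
  then have \<epsilon>0: "0 < \<epsilon>" using \<epsilon> by linarith
  have B: "0 < B" using mu \<delta> by (simp add: B_def)
  have Q: "0 \<le> Q" using Q0_noise(1)[OF d2] by (simp add: Q_def)
  have cases: "Q2 d K \<mu> \<le> \<rho> \<or> Q1 d K \<mu> \<epsilon> \<le> \<rho> \<and> (4 * real K - 1) * \<mu> - 2 * real K * \<mu>\<^sup>2 < 1"
    using \<rho> by (auto simp: high_snr_def min_le_iff_disj split: if_splits)
  have ge: "1 / 2 \<le> \<rho> \<or> \<epsilon> \<le> \<rho>"
    using cases Q2_half[OF d2] Q1_condition(2)[OF d2 \<epsilon>0 \<epsilon>(2)] by (meson order_trans)
  then have \<rho>0: "0 < \<rho>" using \<epsilon>0 by auto
  have F: "normal_tail (max 0 ((1 - \<rho>) * L / \<kappa>)) * (9 / 10) \<le> F"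
  proof -
    have "normal_tail (max 0 ((1 - \<rho>) * L / \<kappa>)) * (9 / 10) \<le> normal_tail (max 0 ((1 - \<rho>) * L / \<kappa>)) * (1 - 2 * real d * normal_tail L)"
      using ld normal_tail_nonneg by (intro mult_left_mono) (auto simp: large_dim_def L_def)
    also have "\<dots> \<le> F"
      unfolding F_def
      by (rule prob_lead_wins) (use L TL \<rho>0 ld small_rho_condition[OF d2 \<epsilon>(1) ge] in \<open>auto simp: L_def large_dim_def\<close>)
    finally show ?thesis .
  qed
  have F1: "9 / 20 \<le> F" if "1 \<le> \<rho>"
  proof -
    have "(1 - \<rho>) * L / \<kappa> \<le> 0" using that L delta_small by (intro divide_nonpos_pos mult_nonpos_nonneg) auto
    then show ?thesis using F by (simp add: normal_tail_0)
  qed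
  have F2: "p * (9 / 10) \<le> F" if "\<rho> < 1"
    using F that L delta_small by (simp add: p_def)
  have pp: "0 < p" "p \<le> 1" by (simp_all add: p_def normal_tail_pos normal_tail_le_1)
  \<comment> \<open>The constant 2/5 lies below both 9/10, for \<open>\<rho> < 1\<close>, and 9/20,
    which is 9/10 times the tail 1/2 at threshold 0.\<close>
  show "2 / 5 * normal_tail ((1 - \<rho>) * noise_max d / \<kappa>) \<le> F"
    unfolding L_def[symmetric] p_def[symmetric] using F1 F2 pp by (cases "1 \<le> \<rho>") auto
  have shift: "normal_tail t \<le> p / (88 * sqrt 2 * real K)" if t: "((1 - \<rho>) / \<kappa> + Q) * L \<le> t" and r: "\<rho> < 1" for t
  proof -
    have "normal_tail t \<le> normal_tail ((1 - \<rho>) * L / \<kappa> + Q * L)"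
      using t by (intro normal_tail_antimono) (simp add: algebra_simps)
    also have "\<dots> \<le> exp (- (Q * L)\<^sup>2 / 2) * p"
      unfolding p_def using r L Q delta_small by (intro normal_tail_shift) auto
    also have "exp (- (Q * L)\<^sup>2 / 2) = 1 / (88 * sqrt 2 * real K)"
      unfolding Q_def L_def by (rule Q0_noise(2)[OF d2])
    finally show ?thesis by simp
  qed
  \<comment> \<open>\<open>88 * sqrt 2\<close> is about 124.4; rounding it down makes the constants
    rational.\<close>
  have const: "p / (88 * sqrt 2 * real K) \<le> p / (123 * real K)"
  proof -
    have "123 / 88 \<le> sqrt (2 :: real)" by (intro real_le_rsqrt) (simp add: power2_eq_square)
    then have "123 \<le> 88 * sqrt (2 :: real)" by simp
    then show ?thesis using pp K by (intro divide_left_mono mult_right_mono mult_pos_pos) auto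
  qed
  fix j assume j: "j < d" "j \<notin> S - s"
  show "\<P>(\<xi> in gauss J. \<forall>i<d. stat i \<xi> \<le> stat j \<xi>) \<le> F / (16 * real K)"
  proof (cases "1 \<le> \<rho>")
    case True
    have "\<P>(\<xi> in gauss J. \<forall>i<d. stat i \<xi> \<le> stat j \<xi>) \<le> 2 * normal_tail (\<rho> * L / B)"
      unfolding B_def by (rule prob_tie_le_gap) (use L TL \<rho>0 j in \<open>auto simp: L_def\<close>)
    also have "\<dots> \<le> 2 * normal_tail (L / B)"
      using True L B mult_right_mono[of 1 \<rho> L] by (intro mult_left_mono normal_tail_antimono divide_right_mono) auto
    also have "\<dots> \<le> 9 / (320 * real K)" using ld by (simp add: large_dim_def L_def B_def)
    also have "\<dots> = (9 / 20) / (16 * real K)" by simp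
    also have "\<dots> \<le> F / (16 * real K)" using F1[OF True] K by (intro divide_right_mono) auto
    finally show ?thesis .
  next
    case False
    then have r: "\<rho> < 1" by simp
    from cases have "\<P>(\<xi> in gauss J. \<forall>i<d. stat i \<xi> \<le> stat j \<xi>) \<le> 2 * (p / (123 * real K)) + p / (62 * real K)"
    proof
      assume "Q2 d K \<mu> \<le> \<rho>"
      from Q2_condition[OF d2 this] have "((1 - \<rho>) / \<kappa> + Q) * L \<le> \<rho> / B * L"
        using L unfolding Q_def B_def by (intro mult_right_mono) auto
      then have "normal_tail (\<rho> * L / B) \<le> p / (88 * sqrt 2 * real K)" using r by (intro shift) simp_all
      moreover have "\<P>(\<xi> in gauss J. \<forall>i<d. stat i \<xi> \<le> stat j \<xi>) \<le> 2 * normal_tail (\<rho> * L / B)"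
        unfolding B_def by (rule prob_tie_le_gap) (use L TL \<rho>0 j in \<open>auto simp: L_def\<close>)
      moreover have "0 \<le> p / (62 * real K)" using pp K by simp
      ultimately show ?thesis using const by linarith
    next
      assume q: "Q1 d K \<mu> \<epsilon> \<le> \<rho> \<and> (4 * real K - 1) * \<mu> - 2 * real K * \<mu>\<^sup>2 < 1"
      define M where "M = 2 * real K * \<mu> * \<rho> * L / (1 - (2 * real K - 1) * \<mu>)"
      have c: "(1 - \<rho>) / \<kappa> + Q \<le> \<tau> - 2 * real K * \<mu> * \<rho> / (1 - (2 * real K - 1) * \<mu>)"
        using Q1_condition(1)[OF d2 \<epsilon>0 \<epsilon>(2)] q by (simp add: Q_def \<tau>_def)
      then have "((1 - \<rho>) / \<kappa> + Q) * L \<le> (\<tau> - 2 * real K * \<mu> * \<rho> / (1 - (2 * real K - 1) * \<mu>)) * L"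
        using L by (intro mult_right_mono) auto
      also have "\<dots> = \<tau> * L - M" by (simp add: M_def left_diff_distrib)
      finally have t: "((1 - \<rho>) / \<kappa> + Q) * L \<le> \<tau> * L - M" .
      have tp: "0 < (1 - \<rho>) / \<kappa>" using r delta_small by simp
      then have "0 < ((1 - \<rho>) / \<kappa> + Q) * L" using Q L by (intro mult_pos_pos) auto
      then have t0: "0 < \<tau> * L - M" using t by linarith
      have "0 \<le> M" unfolding M_def using mu mu' \<rho>0 L by simp
      moreover have "(1 - \<rho>) * L / \<kappa> \<le> ((1 - \<rho>) / \<kappa> + Q) * L" using Q L by (simp add: algebra_simps)
      \<comment> \<open>\<open>large_dim\<close> measures the maximum term against the tail at
        \<open>\<tau> * L\<close>, which does not involve \<rho>. Since \<open>0 \<le> M\<close>,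
        this tail is at most \<open>p\<close>.\<close>
      ultimately have "normal_tail (\<tau> * L) \<le> p" unfolding p_def using t by (intro normal_tail_antimono) linarith
      then have *: "normal_tail (\<tau> * L) / (62 * real K) \<le> p / (62 * real K)" using K by (intro divide_right_mono) auto
      have "\<P>(\<xi> in gauss J. \<forall>i<d. stat i \<xi> \<le> stat j \<xi>) \<le> 2 * normal_tail (\<tau> * L - M)
        + 2 * (normal_tail ((\<tau> + \<eta>) * L) + (1 - normal_tail ((1 - \<eta>) * L)) ^ (d - K))"
        unfolding M_def
      proof (rule prob_tie_le_max[where w = "\<eta> * L"])
        have "(\<tau> + \<eta> + sqrt \<mu> * (\<tau> + \<eta>)) * L \<le> (sqrt (1 - \<mu>) * (1 - \<eta>)) * L"
          using slack L unfolding slack_def \<tau>_def by (intro mult_right_mono) auto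
        then show "\<tau> * L + \<eta> * L + sqrt \<mu> * ((\<tau> + \<eta>) * L) \<le> sqrt (1 - \<mu>) * ((1 - \<eta>) * L)"
          by (simp add: algebra_simps)
      qed (use L TL j t0 slack ld in \<open>auto simp: L_def M_def large_dim_def slack_def\<close>)
      also have "2 * (normal_tail ((\<tau> + \<eta>) * L) + (1 - normal_tail ((1 - \<eta>) * L)) ^ (d - K)) \<le> normal_tail (\<tau> * L) / (62 * real K)"
        using ld by (simp add: large_dim_def \<tau>_def L_def)
      finally show ?thesis using shift[OF t r] const * by linarith
    qed
    \<comment> \<open>The sum \<open>2 / 123 + 1 / 62\<close> is about 0.032, below
      \<open>9 / 160\<close>.\<close>
    also have "\<dots> \<le> p * (9 / 10) / (16 * real K)" using pp K by (simp add: field_simps)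
    also have "\<dots> \<le> F / (16 * real K)" using F2[OF r] K by (intro divide_right_mono) auto
    finally show ?thesis .
  qed
qed

subsection \<open>Votes\<close>

lemma one_minus_exp_ge: "0 \<le> x \<Longrightarrow> x \<le> 1 \<Longrightarrow> x / 2 \<le> 1 - exp (- x :: real)"
proof -
  assume x: "0 \<le> x" "x \<le> 1"
  have "1 + x \<le> exp x" by (rule exp_ge_add_one_self)
  then have "exp (- x) \<le> 1 / (1 + x)" using x by (simp add: exp_minus inverse_eq_divide divide_left_mono)
  moreover have "x / 2 \<le> 1 - 1 / (1 + x)"
    using x mult_left_le[of x x] by (simp add: field_simps)
  ultimately show ?thesis by linarith
qed

lemma card_eq_sum_indicator:
  "real (card {m. m < M \<and> x m \<in> A m}) = (\<Sum>m<M. indicator (A m) (x m))" for x :: "nat \<Rightarrow> 'a"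
proof -
  have "{m. m < M \<and> x m \<in> A m} = {..<M} \<inter> {m. x m \<in> A m}" by auto
  then show ?thesis by (simp add: indicator_def sum.If_cases)
qed

text \<open>Chernoff bound, with the moment generating function of \<open>#C - #B / K\<close> at \<open>1\<close>.\<close>

lemma vote_comparison:
  fixes K M :: nat and B C :: "nat \<Rightarrow> 'a set"
  assumes G: "prob_space G" and K: "1 \<le> K"
    and sets: "\<And>m. m < M \<Longrightarrow> B m \<in> sets G" "\<And>m. m < M \<Longrightarrow> C m \<in> sets G"
    and ratio: "\<And>m. m < M \<Longrightarrow> measure G (C m) \<le> measure G (B m) / (16 * real K)"
  defines "N \<equiv> \<Pi>\<^sub>M m\<in>{..<M}. G"
  shows "\<P>(\<xi> in N. card {m. m < M \<and> \<xi> m \<in> B m} \<le> K * card {m. m < M \<and> \<xi> m \<in> C m}) \<le>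
    exp (- (\<Sum>m<M. 3 / 8 * measure G (B m) / real K))"
proof -
  interpret G: prob_space G by fact
  interpret P: product_prob_space "\<lambda>_. G" "{..<M}" by (intro product_prob_spaceI G)
  interpret N: prob_space N unfolding N_def by (intro prob_space_PiM G)
  define f where "f = (\<lambda>m x. exp (- (1 / real K) * indicator (B m) x + indicator (C m) x :: real))"
  have K': "1 \<le> real K" using K by simp
  have fm: "f m \<in> borel_measurable G" if "m < M" for m
    unfolding f_def using sets[OF that] by measurable
  have fint: "integrable G (f m)" if "m < M" for m
  proof (rule G.integrable_const_bound[where B = "exp 1"])
    show "AE x in G. norm (f m x) \<le> exp 1" unfolding f_def using K' order_trans[of "- 1" 0 "1 / real K"] by (auto intro!: AE_I2 simp: indicator_def)
  qed (rule fm[OF that])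
  have fle: "(\<integral>x. f m x \<partial>G) \<le> exp (- (3 / 8 * measure G (B m) / real K))" if m: "m < M" for m
  proof -
    define c where "c = 1 - exp (- (1 / real K))"
    have c: "1 / (2 * real K) \<le> c" using one_minus_exp_ge[of "1 / real K"] K' by (simp add: c_def)
    have e1: "exp 1 \<le> (3 :: real)" by (rule exp_le)
    \<comment> \<open>Linearised in the indicators, using \<open>exp 1 - 1 \<le> 2\<close>. With
      \<open>1 / (2 * K) \<le> c\<close> the mean is at most 1 minus
      \<open>(1 / 2 - 1 / 8) * measure G (B m) / K\<close>, whence 3/8.\<close>
    have "(\<integral>x. f m x \<partial>G) \<le> (\<integral>x. 1 - c * indicator (B m) x + 2 * indicator (C m) x \<partial>G)"
    proof (rule integral_mono)
      show "integrable G (f m)" by (rule fint[OF m])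
      show "integrable G (\<lambda>x. 1 - c * indicator (B m) x + 2 * indicator (C m) x)"
        using sets[OF m] by (intro Bochner_Integration.integrable_add Bochner_Integration.integrable_diff integrable_mult_right)
          (auto simp: G.emeasure_eq_measure)
      fix x
      have "exp (- (1 / real K) + 1) \<le> exp (- (1 / real K)) + 2"
      proof -
        have "exp (- (1 / real K) + 1) = exp (- (1 / real K)) + exp (- (1 / real K)) * (exp 1 - 1)"
          unfolding exp_add by (simp add: right_diff_distrib)
        also have "exp (- (1 / real K)) * (exp 1 - 1) \<le> 1 * 2"
          using e1 by (intro mult_mono) auto
        finally show ?thesis by simp
      qed
      then show "f m x \<le> 1 - c * indicator (B m) x + 2 * indicator (C m) x"
        using e1 by (auto simp: f_def c_def indicator_def)
    qed
    also have "\<dots> = 1 - c * measure G (B m) + 2 * measure G (C m)"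
      using sets[OF m] by (simp add: G.emeasure_eq_measure G.prob_space)
    also have "\<dots> \<le> 1 - (1 / (2 * real K)) * measure G (B m) + 2 * (measure G (B m) / (16 * real K))"
      using ratio[OF m] mult_right_mono[OF c, of "measure G (B m)"] by simp
    also have "\<dots> = 1 + (- (3 / 8 * measure G (B m) / real K))" using K' by (simp add: field_simps)
    also have "\<dots> \<le> exp (- (3 / 8 * measure G (B m) / real K))" by (rule exp_ge_add_one_self)
    finally show ?thesis .
  qed
  define E where "E = {\<xi> \<in> space N. card {m. m < M \<and> \<xi> m \<in> B m} \<le> K * card {m. m < M \<and> \<xi> m \<in> C m}}"
  have comp: "(\<lambda>\<xi>. \<xi> m) \<in> measurable N G" if "m < M" for m
    unfolding N_def by (rule measurable_component_singleton) (use that in simp)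
  have cm: "(\<lambda>\<xi>. (\<Sum>m<M. indicator (A m) (\<xi> m) :: real)) \<in> borel_measurable N" if "\<And>m. m < M \<Longrightarrow> A m \<in> sets G" for A
    using that by (intro borel_measurable_sum) (auto intro!: measurable_compose[OF comp])
  have E_eq: "E = {\<xi> \<in> space N. (\<Sum>m<M. indicator (B m) (\<xi> m) :: real) \<le> real K * (\<Sum>m<M. indicator (C m) (\<xi> m))}"
    unfolding E_def card_eq_sum_indicator[symmetric] by (simp flip: of_nat_mult)
  have E: "E \<in> sets N"
    unfolding E_eq by (intro borel_measurable_le borel_measurable_times borel_measurable_const cm sets)
  have int: "integrable N (\<lambda>\<xi>. \<Prod>m<M. f m (\<xi> m))"
    unfolding N_def by (rule P.product_integrable_prod) (use fint in auto)
  have "measure N E = (\<integral>\<xi>. indicator E \<xi> \<partial>N)" using sets.sets_into_space[OF E] by (simp add: Int_absorb2)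
  \<comment> \<open>Markov's inequality: on \<open>E\<close> the exponent of the product is
    nonnegative.\<close>
  also have "\<dots> \<le> (\<integral>\<xi>. (\<Prod>m<M. f m (\<xi> m)) \<partial>N)"
  proof (rule integral_mono[OF _ int])
    show "integrable N (\<lambda>\<xi>. indicator E \<xi> :: real)" using E by (simp add: N.emeasure_eq_measure)
    fix \<xi> assume "\<xi> \<in> space N"
    have p: "(\<Prod>m<M. f m (\<xi> m)) = exp (- (1 / real K) * (\<Sum>m<M. indicator (B m) (\<xi> m)) + (\<Sum>m<M. indicator (C m) (\<xi> m)))"
      unfolding f_def by (simp add: exp_sum[symmetric] sum.distrib sum_distrib_left sum_negf sum_divide_distrib sum_subtractf)
    show "indicator E \<xi> \<le> (\<Prod>m<M. f m (\<xi> m))"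
    proof (cases "\<xi> \<in> E")
      case True
      then have "(\<Sum>m<M. indicator (B m) (\<xi> m) :: real) \<le> real K * (\<Sum>m<M. indicator (C m) (\<xi> m))" unfolding E_eq by simp
      then have "(\<Sum>m<M. indicator (B m) (\<xi> m) :: real) / real K \<le> (\<Sum>m<M. indicator (C m) (\<xi> m))"
        using K' by (simp add: divide_le_eq mult.commute)
      then show ?thesis using True unfolding p by simp
    qed (simp add: p)
  qed
  also have "\<dots> = (\<Prod>m<M. \<integral>x. f m x \<partial>G)"
    unfolding N_def by (rule P.product_integral_prod) (use fint in auto)
  also have "\<dots> \<le> (\<Prod>m<M. exp (- (3 / 8 * measure G (B m) / real K)))"
    using fle by (intro prod_mono) (auto simp: f_def intro!: Bochner_Integration.integral_nonneg)
  also have "\<dots> = exp (- (\<Sum>m<M. 3 / 8 * measure G (B m) / real K))"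
    by (simp add: exp_sum[symmetric] sum_negf)
  finally show ?thesis unfolding E_def .
qed

subsection \<open>The OMP step\<close>

definition unit_col :: "real mat \<Rightarrow> nat \<Rightarrow> nat \<Rightarrow> real" where
  "unit_col A i j = A $$ (j, i) / norm2 (col A i)"

definition residual :: "real mat \<Rightarrow> real vec \<Rightarrow> real vec \<Rightarrow> nat \<Rightarrow> real" where
  "residual A y z = (\<lambda>j. (y - A *\<^sub>v z) $ j)"

lemma norm2_eq: "norm2 v = sqrt (ip {..<dim_vec v} (\<lambda>j. v $ j) (\<lambda>j. v $ j))"
  by (simp add: norm2_def L2_set_def ip_def power2_eq_square)

lemma norm2_pos: "v \<in> carrier_vec n \<Longrightarrow> v \<noteq> 0\<^sub>v n \<Longrightarrow> 0 < norm2 v"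
proof -
  assume v: "v \<in> carrier_vec n" "v \<noteq> 0\<^sub>v n"
  then obtain i where "i < n" "v $ i \<noteq> 0" by (auto simp: vec_eq_iff)
  then have "0 < ip {..<n} (\<lambda>j. v $ j) (\<lambda>j. v $ j)"
    unfolding ip_def by (intro sum_pos2[of _ i]) (auto simp: zero_less_mult_iff linorder_neq_iff)
  then show ?thesis using v by (simp add: norm2_eq)
qed

lemma scalar_prod_ip: "w \<in> carrier_vec n \<Longrightarrow> scalar_prod v w = ip {..<n} (\<lambda>j. v $ j) (\<lambda>j. w $ j)"
  by (auto simp: scalar_prod_def ip_def atLeast0LessThan)

locale omp_matrix =
  fixes A :: "real mat" and n d :: nat
  assumes A: "A \<in> carrier_mat n d" and cols: "\<And>i. i < d \<Longrightarrow> col A i \<noteq> 0\<^sub>v n"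
begin

abbreviation J where "J \<equiv> {..<n}"

lemma nrm_pos: "i < d \<Longrightarrow> 0 < norm2 (col A i)"
  using A by (intro norm2_pos[OF _ cols] carrier_vecI) (simp_all add: carrier_matD)

lemma col_unit: "i < d \<Longrightarrow> j < n \<Longrightarrow> A $$ (j, i) = norm2 (col A i) * unit_col A i j"
  using nrm_pos[of i] by (simp add: unit_col_def)

lemma ip_col: "i < d \<Longrightarrow> ip J (\<lambda>j. col A i $ j) v = norm2 (col A i) * ip J (unit_col A i) v"
  unfolding ip_scale_left[symmetric] using A by (intro ip_cong) (auto simp: col_unit)

lemma ip_unit_col: "i < d \<Longrightarrow> ip J (unit_col A i) (unit_col A i) = 1"
proof -
  assume i: "i < d"
  have "(norm2 (col A i))\<^sup>2 = ip J (\<lambda>j. col A i $ j) (\<lambda>j. col A i $ j)"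
    using A ip_self_nonneg by (simp add: norm2_eq carrier_matD)
  also have "\<dots> = norm2 (col A i) * (norm2 (col A i) * ip J (unit_col A i) (unit_col A i))"
    by (subst ip_col[OF i], subst ip_commute, subst ip_col[OF i]) (rule refl)
  finally show ?thesis using nrm_pos[OF i] by (simp add: power2_eq_square)
qed

lemma mult_mat_vec_coord:
  "z \<in> carrier_vec d \<Longrightarrow> j < n \<Longrightarrow> (A *\<^sub>v z) $ j = (\<Sum>i<d. z $ i * norm2 (col A i) * unit_col A i j)"
  using A by (auto simp: scalar_prod_def atLeast0LessThan col_unit intro!: sum.cong)

lemma residual_coord:
  "z \<in> carrier_vec d \<Longrightarrow> j < n \<Longrightarrow> y \<in> carrier_vec n \<Longrightarrow>
    residual A y z j = y $ j - (\<Sum>i<d. z $ i * norm2 (col A i) * unit_col A i j)"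
  unfolding residual_def mult_mat_vec_coord[symmetric] using A by simp

lemma ip_residual:
  assumes "z \<in> carrier_vec d" "y \<in> carrier_vec n"
  shows "ip J v (residual A y z) = ip J v (\<lambda>j. y $ j) - (\<Sum>i<d. z $ i * norm2 (col A i) * ip J v (unit_col A i))"
proof -
  have "ip J v (residual A y z) = ip J v (\<lambda>j. y $ j - (\<Sum>i<d. z $ i * norm2 (col A i) * unit_col A i j))"
    using assms by (intro ip_cong) (simp add: residual_coord)
  then show ?thesis unfolding ip_diff_right ip_sum_right .
qed

lemma norm2_residual:
  "z \<in> carrier_vec d \<Longrightarrow> y \<in> carrier_vec n \<Longrightarrow> norm2 (y - A *\<^sub>v z) = sqrt (ip J (residual A y z) (residual A y z))"
  using A by (simp add: norm2_eq residual_def)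

lemma sum_support:
  "z \<in> carrier_vec d \<Longrightarrow> support z \<subseteq> s \<Longrightarrow> s \<subseteq> {..<d} \<Longrightarrow> (\<Sum>i<d. z $ i * f i) = (\<Sum>i\<in>s. z $ i * f i)"
  by (intro sum.mono_neutral_right) (auto simp: support_def)

text \<open>The normal equations. If the residual correlates with a column of \<open>s\<close>,
  moving along that column improves the fit; conversely, orthogonality gives Pythagoras against
  every competitor.\<close>

lemma least_squares_iff:
  assumes y: "y \<in> carrier_vec n" and s: "s \<subseteq> {..<d}"
  shows "least_squares A y s z \<longleftrightarrow> z \<in> carrier_vec d \<and> support z \<subseteq> s \<and> (\<forall>l\<in>s. ip J (unit_col A l) (residual A y z) = 0)"
proof
  assume ls: "least_squares A y s z"
  then have z: "z \<in> carrier_vec d" "support z \<subseteq> s"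
    and min: "\<And>z'. z' \<in> carrier_vec d \<Longrightarrow> support z' \<subseteq> s \<Longrightarrow> \<not> norm2 (y - A *\<^sub>v z') < norm2 (y - A *\<^sub>v z)"
    using A by (auto simp: least_squares_def is_arg_min_def)
  have "ip J (unit_col A l) (residual A y z) = 0" if l: "l \<in> s" for l
  proof (rule ccontr)
    let ?r = "residual A y z"
    define c where "c = ip J (unit_col A l) ?r"
    assume "ip J (unit_col A l) ?r \<noteq> 0"
    then have c: "c \<noteq> 0" by (simp add: c_def)
    have ld: "l < d" using l s by auto
    \<comment> \<open>The minimiser on the line along the unit column \<open>l\<close>; it lowers
      the squared residual by \<open>c * c\<close>.\<close>
    define z' where "z' = vec d (\<lambda>i. z $ i + (if i = l then c / norm2 (col A l) else 0))"
    have z': "z' \<in> carrier_vec d" "support z' \<subseteq> s"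
      using z l by (auto simp: z'_def support_def split: if_splits)
    have "residual A y z' j = ?r j - c * unit_col A l j" if "j < n" for j
    proof -
      have "(\<Sum>i<d. z' $ i * norm2 (col A i) * unit_col A i j) =
          (\<Sum>i<d. z $ i * norm2 (col A i) * unit_col A i j + (if i = l then c * unit_col A l j else 0))"
        using nrm_pos[OF ld] by (intro sum.cong) (auto simp: z'_def algebra_simps)
      also have "\<dots> = (\<Sum>i<d. z $ i * norm2 (col A i) * unit_col A i j) + c * unit_col A l j"
        using ld by (simp add: sum.distrib)
      finally show ?thesis using z' z y that by (simp add: residual_coord)
    qed
    then have "ip J (residual A y z') (residual A y z') = ip J (\<lambda>j. ?r j - c * unit_col A l j) (\<lambda>j. ?r j - c * unit_col A l j)"
      by (intro ip_cong) simp
    also have "\<dots> = ip J ?r ?r - c * c"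
      using ip_unit_col[OF ld]
      by (simp add: ip_diff_left ip_diff_right ip_scale_left ip_scale_right ip_commute[of J ?r "unit_col A l"] c_def[symmetric])
    finally have "ip J (residual A y z') (residual A y z') < ip J ?r ?r" using mult_pos_pos[of c c] mult_neg_neg[of c c] c by (cases "0 < c") auto
    then show False using min[OF z'] z z' y by (simp add: norm2_residual)
  qed
  then show "z \<in> carrier_vec d \<and> support z \<subseteq> s \<and> (\<forall>l\<in>s. ip J (unit_col A l) (residual A y z) = 0)" using z by auto
next
  assume z: "z \<in> carrier_vec d \<and> support z \<subseteq> s \<and> (\<forall>l\<in>s. ip J (unit_col A l) (residual A y z) = 0)"
  let ?r = "residual A y z"
  have "norm2 (y - A *\<^sub>v z) \<le> norm2 (y - A *\<^sub>v z')" if z': "z' \<in> carrier_vec d" "support z' \<subseteq> s" for z'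
  proof -
    let ?r' = "residual A y z'"
    let ?D = "\<lambda>j. ?r' j - ?r j"
    have "ip J v ?D = (\<Sum>i\<in>s. (z $ i - z' $ i) * (norm2 (col A i) * ip J v (unit_col A i)))" for v
      using z z' y s sum_support[of z s "\<lambda>i. norm2 (col A i) * ip J v (unit_col A i)"]
        sum_support[of z' s "\<lambda>i. norm2 (col A i) * ip J v (unit_col A i)"]
      by (simp add: ip_diff_right ip_residual left_diff_distrib sum_subtractf mult.assoc)
    then have "ip J ?r ?D = 0" using z by (simp add: ip_commute[of J ?r])
    moreover have "?r' = (\<lambda>j. ?r j + ?D j)" by simp
    then have "ip J ?r' ?r' = ip J ?r ?r + 2 * ip J ?r ?D + ip J ?D ?D"
      by (simp add: ip_diff_left ip_diff_right ip_commute[of J ?r' ?r])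
    ultimately have "ip J ?r ?r \<le> ip J ?r' ?r'" using ip_self_nonneg[of J ?D] by simp
    then show ?thesis using z z' y by (simp add: norm2_residual)
  qed
  then show "least_squares A y s z" using z A by (force simp: least_squares_def is_arg_min_def)
qed

lemma ex_least_squares:
  assumes y: "y \<in> carrier_vec n" and s: "s \<subseteq> {..<d}" shows "\<exists>z. least_squares A y s z"
proof -
  have fs: "finite s" using s finite_subset by blast
  obtain b where b: "\<forall>l\<in>s. ip J (\<lambda>j. y $ j - (\<Sum>k\<in>s. b k * unit_col A k j)) (unit_col A l) = 0"
    using ex_projection[OF _ fs, of J "\<lambda>j. y $ j" "unit_col A"] by auto
  define z where "z = vec d (\<lambda>i. if i \<in> s then b i / norm2 (col A i) else 0)"
  have z: "z \<in> carrier_vec d" "support z \<subseteq> s" by (auto simp: z_def support_def split: if_splits)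
  have "residual A y z j = y $ j - (\<Sum>k\<in>s. b k * unit_col A k j)" if "j < n" for j
  proof -
    have "(\<Sum>i<d. z $ i * (norm2 (col A i) * unit_col A i j)) = (\<Sum>i\<in>s. z $ i * (norm2 (col A i) * unit_col A i j))"
      by (rule sum_support[OF z s])
    also have "\<dots> = (\<Sum>k\<in>s. b k * unit_col A k j)"
    proof (rule sum.cong[OF refl])
      fix k assume k: "k \<in> s"
      then have "k < d" using s by auto
      then show "z $ k * (norm2 (col A k) * unit_col A k j) = b k * unit_col A k j"
        using k nrm_pos[of k] by (simp add: z_def)
    qed
    finally show ?thesis using z y that by (simp add: residual_coord mult.assoc)
  qed
  then have "ip J (unit_col A l) (residual A y z) = 0" if "l \<in> s" for l
    using b that by (subst ip_commute) (simp cong: ip_cong add: ip_def)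
  then show ?thesis using z least_squares_iff[OF y s] by blast
qed

text \<open>The residual is orthogonal to the columns of \<open>s\<close>, so
  \<open>unit_col A i\<close> may be replaced by \<open>a i\<close> in its correlation; then the
  fitted part drops out because \<open>a i\<close> is orthogonal to it. The statistic is thus the
  same for every least squares solution.\<close>

lemma omp_step_iff:
  assumes y: "y \<in> carrier_vec n" and s: "s \<subseteq> {..<d}"
    and a: "\<And>i j. a i j = unit_col A i j - (\<Sum>k\<in>s. b i k * unit_col A k j)"
    and orth: "\<And>i l. i < d \<Longrightarrow> l \<in> s \<Longrightarrow> ip J (a i) (unit_col A l) = 0"
  shows "omp_step A y s j \<longleftrightarrow> j < d \<and> (\<forall>i<d. \<bar>ip J (a i) (\<lambda>j. y $ j)\<bar> \<le> \<bar>ip J (a j) (\<lambda>j. y $ j)\<bar>)"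
proof -
  have stat: "\<bar>scalar_prod (col A i) (y - A *\<^sub>v z)\<bar> / norm2 (col A i) = \<bar>ip J (a i) (\<lambda>j. y $ j)\<bar>"
    if ls: "least_squares A y s z" and i: "i < d" for z i
  proof -
    let ?r = "residual A y z"
    have z: "z \<in> carrier_vec d" "support z \<subseteq> s" "\<And>l. l \<in> s \<Longrightarrow> ip J (unit_col A l) ?r = 0"
      using ls least_squares_iff[OF y s] by auto
    have "scalar_prod (col A i) (y - A *\<^sub>v z) = ip J (\<lambda>j. col A i $ j) ?r"
      unfolding residual_def using A y z by (intro scalar_prod_ip) auto
    also have "\<dots> = norm2 (col A i) * ip J (unit_col A i) ?r" by (rule ip_col[OF i])
    also have "ip J (unit_col A i) ?r = ip J (a i) ?r"
    proof -
      have "a i = (\<lambda>j. unit_col A i j - (\<Sum>k\<in>s. b i k * unit_col A k j))" by (rule ext) (rule a)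
      then show ?thesis using z(3) by (simp add: ip_diff_left ip_sum_left)
    qed
    also have "ip J (a i) ?r = ip J (a i) (\<lambda>j. y $ j)"
    proof -
      have "(\<Sum>l<d. z $ l * (norm2 (col A l) * ip J (a i) (unit_col A l))) = (\<Sum>l\<in>s. z $ l * (norm2 (col A l) * ip J (a i) (unit_col A l)))"
        by (rule sum_support[OF z(1,2) s])
      then show ?thesis using orth[OF i] by (simp add: ip_residual[OF z(1) y] mult.assoc)
    qed
    finally show ?thesis using nrm_pos[OF i] by (simp add: abs_mult)
  qed
  have dim: "dim_col A = d" using A by simp
  show ?thesis
  proof
    assume "omp_step A y s j"
    then obtain z where ls: "least_squares A y s z"
      and m: "is_arg_max (\<lambda>i. \<bar>scalar_prod (col A i) (y - A *\<^sub>v z)\<bar> / norm2 (col A i)) (\<lambda>i. i < d) j"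
      unfolding omp_step_def dim by auto
    show "j < d \<and> (\<forall>i<d. \<bar>ip J (a i) (\<lambda>j. y $ j)\<bar> \<le> \<bar>ip J (a j) (\<lambda>j. y $ j)\<bar>)"
    proof (intro conjI allI impI)
      show jd: "j < d" using m by (simp add: is_arg_max_def)
      fix i assume i: "i < d"
      show "\<bar>ip J (a i) (\<lambda>j. y $ j)\<bar> \<le> \<bar>ip J (a j) (\<lambda>j. y $ j)\<bar>"
      proof -
        let ?F = "\<lambda>i. \<bar>scalar_prod (col A i) (y - A *\<^sub>v z)\<bar> / norm2 (col A i)"
        have "\<not> ?F j < ?F i" using m i unfolding is_arg_max_def by blast
        then show ?thesis unfolding stat[OF ls i] stat[OF ls jd] by simp
      qed
    qed
  next
    assume h: "j < d \<and> (\<forall>i<d. \<bar>ip J (a i) (\<lambda>j. y $ j)\<bar> \<le> \<bar>ip J (a j) (\<lambda>j. y $ j)\<bar>)"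
    obtain z where ls: "least_squares A y s z" using ex_least_squares[OF y s] by blast
    let ?F = "\<lambda>i. \<bar>scalar_prod (col A i) (y - A *\<^sub>v z)\<bar> / norm2 (col A i)"
    have "?F i \<le> ?F j" if "i < d" for i
      using h that stat[OF ls that] stat[OF ls, of j] by presburger
    then have "is_arg_max ?F (\<lambda>i. i < d) j"
      unfolding is_arg_max_def using h by (auto simp only: not_less[symmetric])
    then show "omp_step A y s j"
      unfolding omp_step_def dim using ls by blast
  qed
qed

end

subsection \<open>Runs of the algorithm\<close>

lemma dj_omp_0_iff: "dj_omp M d X y 0 S \<longleftrightarrow> S = {}"
  by (auto elim: dj_omp.cases intro: dj_omp.start)

lemma dj_omp_Suc_iff:
  "dj_omp M d X y (Suc t) S' \<longleftrightarrow> (\<exists>S c j. dj_omp M d X y t S \<and> (\<forall>m<M. omp_step (X m) (y m) S (c m)) \<and>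
    is_arg_max (\<lambda>j. card {m. m < M \<and> c m = j}) (\<lambda>j. j < d) j \<and> S' = insert j S)" (is "_ \<longleftrightarrow> ?rhs")
proof
  assume "dj_omp M d X y (Suc t) S'"
  then show ?rhs
    by (cases rule: dj_omp.cases) blast
qed (blast intro: dj_omp.round)

lemma dj_omp_subset: "dj_omp M d X y t S \<Longrightarrow> S \<subseteq> {..<d}"
  by (induction rule: dj_omp.induct) (auto simp: is_arg_max_def)

lemma ex_is_arg_max:
  fixes f :: "nat \<Rightarrow> 'b :: linorder"
  assumes "0 < d" shows "\<exists>j. is_arg_max f (\<lambda>j. j < d) j"
proof -
  have "Max (f ` {..<d}) \<in> f ` {..<d}" using assms by (intro Max_in) auto
  then obtain j where j: "j < d" "f j = Max (f ` {..<d})" by auto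
  have "f i \<le> f j" if "i < d" for i using that unfolding j by (intro Max_ge) auto
  then show ?thesis using j(1) unfolding is_arg_max_def by (meson not_less)
qed

text \<open>\<open>recovers_support\<close> is an equality of sets, so it also demands that some run
  exists.\<close>

lemma ex_dj_omp:
  assumes "0 < d" and step: "\<And>m S. m < M \<Longrightarrow> S \<subseteq> {..<d} \<Longrightarrow> \<exists>j. omp_step (X m) (y m) S j"
  shows "\<exists>S. dj_omp M d X y t S"
proof (induction t)
  case 0
  then show ?case by (auto simp: dj_omp_0_iff)
next
  case (Suc t)
  then obtain S where S: "dj_omp M d X y t S" by blast
  have "\<forall>m. \<exists>j. m < M \<longrightarrow> omp_step (X m) (y m) S j" using step dj_omp_subset[OF S] by blast
  then obtain c where "\<forall>m. m < M \<longrightarrow> omp_step (X m) (y m) S (c m)" by metis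
  moreover obtain j where "is_arg_max (\<lambda>j. card {m. m < M \<and> c m = j}) (\<lambda>j. j < d) j"
    using ex_is_arg_max[OF assms(1)] by blast
  ultimately show ?case using S dj_omp.round by blast
qed

text \<open>The votes of the machines that are bound to vote inside the rest of the support are spread over
  at most \<open>K\<close> indices, so one of these indices gets at least a fraction \<open>1 / K\<close> of them.\<close>

lemma dj_omp_recovers:
  fixes win :: "nat set \<Rightarrow> nat \<Rightarrow> bool" and tie :: "nat set \<Rightarrow> nat \<Rightarrow> nat \<Rightarrow> bool"
  assumes S: "S \<subseteq> {..<d}" "card S = K"
    and win: "\<And>s m c. s \<subset> S \<Longrightarrow> m < M \<Longrightarrow> win s m \<Longrightarrow> omp_step (X m) (y m) s c \<Longrightarrow> c \<in> S - s"
    and tie: "\<And>s m c. s \<subset> S \<Longrightarrow> m < M \<Longrightarrow> omp_step (X m) (y m) s c \<Longrightarrow> tie s m c"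
    and good: "\<And>s j. s \<subset> S \<Longrightarrow> j < d \<Longrightarrow> j \<notin> S - s \<Longrightarrow> K * card {m. m < M \<and> tie s m j} < card {m. m < M \<and> win s m}"
  shows "dj_omp M d X y t R \<Longrightarrow> t \<le> K \<Longrightarrow> R \<subseteq> S \<and> card R = t"
proof (induction t arbitrary: R)
  case 0
  then show ?case by (simp add: dj_omp_0_iff)
next
  case (Suc t)
  have finS: "finite S" using S finite_subset by blast
  obtain s c j where s: "dj_omp M d X y t s" and c: "\<And>m. m < M \<Longrightarrow> omp_step (X m) (y m) s (c m)"
    and j: "is_arg_max (\<lambda>j. card {m. m < M \<and> c m = j}) (\<lambda>j. j < d) j" and R: "R = insert j s"
    using Suc.prems(1) unfolding dj_omp_Suc_iff by blast
  have IH: "s \<subseteq> S" "card s = t" using Suc.IH[OF s] Suc.prems(2) by auto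
  \<comment> \<open>The round starts with \<open>t < K\<close> correct indices, so the support is
    not yet exhausted and the hypotheses apply to \<open>s\<close>.\<close>
  then have sS: "s \<subset> S" using Suc.prems(2) S by auto
  have jd: "j < d" and jmax: "\<And>k. k < d \<Longrightarrow> card {m. m < M \<and> c m = k} \<le> card {m. m < M \<and> c m = j}"
    using j unfolding is_arg_max_def by (blast, meson not_less)
  have "j \<in> S - s"
  proof (rule ccontr)
    assume jn: "j \<notin> S - s"
    have "{m. m < M \<and> win s m} \<subseteq> (\<Union>k\<in>S - s. {m. m < M \<and> c m = k})"
      using win[OF sS _ _ c] by auto
    then have "card {m. m < M \<and> win s m} \<le> card (\<Union>k\<in>S - s. {m. m < M \<and> c m = k})"
      using finS by (intro card_mono) auto
    also have "\<dots> \<le> (\<Sum>k\<in>S - s. card {m. m < M \<and> c m = k})"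
      using finS by (intro card_UN_le) auto
    also have "\<dots> \<le> (\<Sum>k\<in>S - s. card {m. m < M \<and> c m = j})"
      using S by (intro sum_mono jmax) auto
    also have "\<dots> = card (S - s) * card {m. m < M \<and> c m = j}" by simp
    also have "\<dots> \<le> K * card {m. m < M \<and> tie s m j}"
    proof (rule mult_le_mono)
      show "card (S - s) \<le> K" using finS S by (metis Diff_subset card_mono)
      show "card {m. m < M \<and> c m = j} \<le> card {m. m < M \<and> tie s m j}"
        using tie[OF sS _ c] by (intro card_mono) auto
    qed
    also have "\<dots> < card {m. m < M \<and> win s m}" by (rule good[OF sS jd jn])
    finally show False by simp
  qed
  moreover have "finite s" using IH finS finite_subset by blast
  ultimately show ?case using IH R by auto
qed

section \<open>The random model: measurability, votes of the machines and the union bound\<close>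

locale regression =
  fixes M n d K :: nat and X :: "nat \<Rightarrow> real mat" and \<theta> :: "real vec" and \<sigma> \<mu> :: real
  assumes model: "sparse_regression_model M n d K X \<theta> \<sigma>" and coh: "max_coherence M X = \<mu>"
    and K1: "1 \<le> K" and mu: "0 \<le> \<mu>" "\<mu> < 1 / (2 * real K - 1)"
begin

abbreviation J where "J \<equiv> {..<n}"
abbreviation N where "N \<equiv> noise_law M n"
abbreviation S where "S \<equiv> support \<theta>"

abbreviation Y where "Y \<equiv> response X \<theta> \<sigma>"

lemma std_gaussian_eq: "std_gaussian n = gauss J"
  by (simp add: std_gaussian_def gauss_def)

lemma matrix: "m < M \<Longrightarrow> omp_matrix (X m) n d"
  using model by (simp add: sparse_regression_model_def omp_matrix_def)

lemma theta: "\<theta> \<in> carrier_vec d" "S \<subseteq> {..<d}" "card S = K" "0 < \<sigma>" "0 < M"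
  using model by (auto simp: sparse_regression_model_def support_def)

lemma response_carrier: "m < M \<Longrightarrow> Y \<xi> m \<in> carrier_vec n"
  using model by (auto simp: sparse_regression_model_def response_def)

text \<open>Chosen without reference to the noise, so that \<open>perp\<close> is deterministic and
  \<open>corr m s i\<close> is a function of the noise of one machine alone.\<close>

definition coef :: "nat \<Rightarrow> nat set \<Rightarrow> nat \<Rightarrow> nat \<Rightarrow> real" where
  "coef m s i = (SOME b. \<forall>l\<in>s. ip J (\<lambda>j. unit_col (X m) i j - (\<Sum>k\<in>s. b k * unit_col (X m) k j)) (unit_col (X m) l) = 0)"

definition perp :: "nat \<Rightarrow> nat set \<Rightarrow> nat \<Rightarrow> nat \<Rightarrow> real" where
  "perp m s i j = unit_col (X m) i j - (\<Sum>k\<in>s. coef m s i k * unit_col (X m) k j)"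

definition corr :: "nat \<Rightarrow> nat set \<Rightarrow> nat \<Rightarrow> (nat \<Rightarrow> real) \<Rightarrow> real" where
  "corr m s i x = \<bar>(\<Sum>l<d. \<theta> $ l * norm2 (col (X m) l) * ip J (perp m s i) (unit_col (X m) l)) + \<sigma> * ip J (perp m s i) x\<bar>"

lemma perp_orth:
  assumes "finite s" "l \<in> s" shows "ip J (perp m s i) (unit_col (X m) l) = 0"
proof -
  have "\<exists>b. \<forall>l\<in>s. ip J (\<lambda>j. unit_col (X m) i j - (\<Sum>k\<in>s. b k * unit_col (X m) k j)) (unit_col (X m) l) = 0"
    using assms by (intro ex_projection) auto
  from someI_ex[OF this] show ?thesis
    using assms(2) unfolding perp_def[abs_def] coef_def by blast
qed

lemma ip_response:
  assumes m: "m < M" shows "ip J v (\<lambda>j. Y \<xi> m $ j) =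
    (\<Sum>l<d. \<theta> $ l * norm2 (col (X m) l) * ip J v (unit_col (X m) l)) + \<sigma> * ip J v (\<xi> m)"
proof -
  interpret Mx: omp_matrix "X m" n d by (rule matrix[OF m])
  have "ip J v (\<lambda>j. Y \<xi> m $ j) =
    ip J v (\<lambda>j. (\<Sum>l<d. \<theta> $ l * norm2 (col (X m) l) * unit_col (X m) l j) + \<sigma> * \<xi> m j)"
  proof (rule ip_cong)
    fix j assume "j \<in> J"
    then show "v j * Y \<xi> m $ j = v j * ((\<Sum>l<d. \<theta> $ l * norm2 (col (X m) l) * unit_col (X m) l j) + \<sigma> * \<xi> m j)"
      using Mx.A Mx.mult_mat_vec_coord[OF theta(1), of j] by (simp add: response_def)
  qed
  then show ?thesis unfolding ip_add_right ip_sum_right ip_scale_right .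
qed

lemma omp_step_iff_corr:
  assumes m: "m < M" and s: "s \<subseteq> {..<d}"
  shows "omp_step (X m) (Y \<xi> m) s j \<longleftrightarrow> j < d \<and> (\<forall>i<d. corr m s i (\<xi> m) \<le> corr m s j (\<xi> m))"
proof -
  interpret Mx: omp_matrix "X m" n d by (rule matrix[OF m])
  have "finite s" using s finite_subset by blast
  then show ?thesis
    unfolding corr_def ip_response[OF m, symmetric]
    by (intro Mx.omp_step_iff[where b = "coef m s"] response_carrier m s perp_def perp_orth)
qed

lemma borel_measurable_corr: "corr m s i \<in> borel_measurable (gauss J)"
  unfolding corr_def[abs_def] by measurable

lemma sets_corr:
  "{x \<in> space (gauss J). \<forall>i\<in>{..<d}. corr m s i x \<le> corr m s j x} \<in> sets (gauss J)"
  "{x \<in> space (gauss J). \<forall>j\<in>{..<d} - R. corr m s j x < corr m s k x} \<in> sets (gauss J)"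
  by (intro sets.sets_Collect_finite_All borel_measurable_le borel_measurable_less borel_measurable_corr; simp)+

lemma component_measurable: "m < M \<Longrightarrow> (\<lambda>\<xi>. \<xi> m) \<in> measurable N (gauss J)"
  unfolding noise_law_def std_gaussian_eq[symmetric] by (rule measurable_component_singleton) simp

lemma pred_omp_step:
  assumes "m < M" "s \<subseteq> {..<d}"
  shows "Measurable.pred N (\<lambda>\<xi>. omp_step (X m) (Y \<xi> m) s j)"
proof -
  let ?E = "{x \<in> space (gauss J). \<forall>i\<in>{..<d}. corr m s i x \<le> corr m s j x}"
  have "{\<xi> \<in> space N. omp_step (X m) (Y \<xi> m) s j} =
    (if j < d then (\<lambda>\<xi>. \<xi> m) -` ?E \<inter> space N else {})"
    using measurable_space[OF component_measurable[OF assms(1)]]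
    unfolding omp_step_iff_corr[OF assms] by auto
  also have "\<dots> \<in> sets N"
    using measurable_sets[OF component_measurable[OF assms(1)] sets_corr(1)] by simp
  finally show ?thesis unfolding pred_def .
qed

text \<open>The existential over vote functions is infinite, but only their values below
  \<open>M\<close> matter and these are below \<open>d\<close>. Restricting to \<open>PiE\<close>
  leaves finitely many measurable cases.\<close>

lemma pred_dj_omp: "Measurable.pred N (\<lambda>\<xi>. dj_omp M d X (Y \<xi>) t S')"
proof (induction t arbitrary: S')
  case 0
  then show ?case by (simp add: dj_omp_0_iff)
next
  case (Suc t)
  let ?V = "\<lambda>c j. is_arg_max (\<lambda>j. card {m. m < M \<and> c m = j}) (\<lambda>j. j < d) j"
  have eq: "dj_omp M d X (Y \<xi>) (Suc t) S' \<longleftrightarrow>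
    (\<exists>R\<in>Pow {..<d}. \<exists>c\<in>PiE {..<M} (\<lambda>_. {..<d}). \<exists>j\<in>{..<d}. dj_omp M d X (Y \<xi>) t R \<and>
      (\<forall>m\<in>{..<M}. omp_step (X m) (Y \<xi> m) R (c m)) \<and> ?V c j \<and> S' = insert j R)" (is "_ \<longleftrightarrow> ?rhs \<xi>") for \<xi>
  proof
    assume "dj_omp M d X (Y \<xi>) (Suc t) S'"
    then obtain R c j where h: "dj_omp M d X (Y \<xi>) t R"
      "\<forall>m<M. omp_step (X m) (Y \<xi> m) R (c m)" "?V c j" "S' = insert j R"
      unfolding dj_omp_Suc_iff by blast
    have R: "R \<subseteq> {..<d}" by (rule dj_omp_subset[OF h(1)])
    have "restrict c {..<M} \<in> PiE {..<M} (\<lambda>_. {..<d})" using h(2) omp_step_iff_corr[OF _ R] by auto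
    moreover have "(\<lambda>j. card {m. m < M \<and> restrict c {..<M} m = j}) = (\<lambda>j. card {m. m < M \<and> c m = j})"
      by (intro ext arg_cong[where f = card]) auto
    moreover have "j < d" using h(3) by (simp add: is_arg_max_def)
    ultimately show "?rhs \<xi>"
      using h R by (intro bexI[of _ R] bexI[of _ "restrict c {..<M}"] bexI[of _ j]) auto
  qed (unfold dj_omp_Suc_iff, blast)
  have V: "Measurable.pred N (\<lambda>\<xi>. ?V c j \<and> S' = insert j R)" for c j R by simp
  show ?case
    unfolding eq
    by (intro pred_intros_finite pred_intros_logic Suc.IH pred_omp_step V finite_PiE) auto
qed

lemma pred_recovers: "Measurable.pred N (\<lambda>\<xi>. recovers_support M d K X (Y \<xi>) \<theta>)"
proof -
  have "recovers_support M d K X (Y \<xi>) \<theta> \<longleftrightarrow>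
    (\<forall>R\<in>Pow {..<d}. (dj_omp M d X (Y \<xi>) K R \<longrightarrow> R = S) \<and> (R = S \<longrightarrow> dj_omp M d X (Y \<xi>) K R))"
    (is "_ \<longleftrightarrow> ?R \<xi>") for \<xi>
  proof
    assume "recovers_support M d K X (Y \<xi>) \<theta>"
    then have "dj_omp M d X (Y \<xi>) K R \<longleftrightarrow> R = S" for R
      unfolding recovers_support_def by (metis mem_Collect_eq singleton_iff)
    then show "?R \<xi>" by simp
  next
    assume h: "?R \<xi>"
    have "dj_omp M d X (Y \<xi>) K R \<longleftrightarrow> R = S" if "R \<in> Pow {..<d}" for R
      using h that by blast
    moreover have "R \<in> Pow {..<d}" if "dj_omp M d X (Y \<xi>) K R \<or> R = S" for R
      using that theta(2) dj_omp_subset by blast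
    ultimately have "dj_omp M d X (Y \<xi>) K R \<longleftrightarrow> R = S" for R by blast
    then show "recovers_support M d K X (Y \<xi>) \<theta>"
      by (simp add: recovers_support_def)
  qed
  then show ?thesis
    by (simp only:) (intro pred_intros_finite pred_intros_logic pred_dj_omp; simp)
qed

lemma incoherence:
  assumes m: "m < M" and i: "i < d" and l: "l < d" and "i \<noteq> l"
  shows "\<bar>ip J (unit_col (X m) i) (unit_col (X m) l)\<bar> \<le> \<mu>"
proof -
  interpret Mx: omp_matrix "X m" n d by (rule matrix[OF m])
  let ?f = "\<lambda>(i, j). \<bar>scalar_prod (col (X m) i) (col (X m) j)\<bar> / (norm2 (col (X m) i) * norm2 (col (X m) j))"
  let ?P = "{(i, j). i < d \<and> j < d \<and> i \<noteq> j}"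
  have dim: "dim_col (X m) = d" using Mx.A by simp
  have "finite ?P" by (rule finite_subset[of _ "{..<d} \<times> {..<d}"]) auto
  then have "?f (i, l) \<le> coherence (X m)"
    unfolding coherence_def dim using assms by (intro Max_ge finite_imageI imageI) auto
  moreover have "coherence (X m) \<le> max_coherence M X"
    unfolding max_coherence_def using m by (intro Max_ge) auto
  moreover have "scalar_prod (col (X m) i) (col (X m) l) =
      norm2 (col (X m) i) * (norm2 (col (X m) l) * ip J (unit_col (X m) i) (unit_col (X m) l))"
  proof -
    have "scalar_prod (col (X m) i) (col (X m) l) = ip J (\<lambda>j. col (X m) i $ j) (\<lambda>j. col (X m) l $ j)"
      using Mx.A by (intro scalar_prod_ip) (simp add: carrier_vecI)
    also have "\<dots> = norm2 (col (X m) i) * (norm2 (col (X m) l) * ip J (unit_col (X m) l) (unit_col (X m) i))"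
      by (subst Mx.ip_col[OF i], subst ip_commute, subst Mx.ip_col[OF l]) (rule refl)
    finally show ?thesis by (simp add: ip_commute)
  qed
  ultimately show ?thesis using coh Mx.nrm_pos[OF i] Mx.nrm_pos[OF l] by (simp add: abs_mult)
qed

lemma machine:
  assumes m: "m < M" and s: "s \<subset> S"
  shows "omp_machine n d S s K \<mu> (unit_col (X m)) (coef m s) (perp m s) \<sigma>"
proof -
  interpret Mx: omp_matrix "X m" n d by (rule matrix[OF m])
  have "finite s" using s theta(2) finite_subset by (metis finite_lessThan psubset_imp_subset)
  then show ?thesis
    using theta s mu K1 Mx.ip_unit_col incoherence[OF m] perp_orth by unfold_locales (auto simp: perp_def)
qed

text \<open>Passing to unit columns multiplies the coefficients by the column norms. The terms
  outside the support vanish because \<theta> does, those in \<open>s\<close> by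
  orthogonality.\<close>

lemma corr_eq_stat:
  assumes m: "m < M" and s: "s \<subset> S" and i: "i < d"
  shows "corr m s i x = omp_machine.stat n S s (perp m s) (\<lambda>l. norm2 (col (X m) l) * \<theta> $ l) \<sigma> i x"
proof -
  interpret O: omp_machine n d S s K \<mu> "unit_col (X m)" "coef m s" "perp m s" "\<lambda>l. norm2 (col (X m) l) * \<theta> $ l" \<sigma>
    by (rule machine[OF m s])
  have "(\<Sum>l<d. \<theta> $ l * norm2 (col (X m) l) * ip J (perp m s i) (unit_col (X m) l)) =
    (\<Sum>l\<in>S - s. \<theta> $ l * norm2 (col (X m) l) * ip J (perp m s i) (unit_col (X m) l))"
    using theta(1,2) O.orth[OF i] by (intro sum.mono_neutral_right) (auto simp: support_def)
  also have "\<dots> = O.signal i"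
    unfolding O.signal_def O.ip_a_a[OF i] by (simp add: ac_simps)
  finally show ?thesis unfolding corr_def O.stat_def by simp
qed

text \<open>The strict inequality forces a vote inside \<open>S - s\<close> under every tie break,
  whereas the weak inequality in \<open>ties\<close> covers every admissible vote for
  \<open>j\<close>.\<close>

definition wins :: "nat set \<Rightarrow> nat \<Rightarrow> (nat \<Rightarrow> real) set" where
  "wins s m = {x \<in> space (gauss J). \<exists>k\<in>S - s. \<forall>j<d. j \<notin> S - s \<longrightarrow> corr m s j x < corr m s k x}"

definition ties :: "nat set \<Rightarrow> nat \<Rightarrow> nat \<Rightarrow> (nat \<Rightarrow> real) set" where
  "ties s j m = {x \<in> space (gauss J). \<forall>i<d. corr m s i x \<le> corr m s j x}"

lemma sets_wins_ties: "wins s m \<in> sets (gauss J)" "ties s j m \<in> sets (gauss J)"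
proof -
  have f: "finite (S - s)" using theta(2) finite_subset by blast
  have "ties s j m = {x \<in> space (gauss J). \<forall>i\<in>{..<d}. corr m s i x \<le> corr m s j x}"
    by (auto simp: ties_def)
  then show "ties s j m \<in> sets (gauss J)" using sets_corr(1) by simp
  have "wins s m = {x \<in> space (gauss J). \<exists>k\<in>S - s. \<forall>j\<in>{..<d} - (S - s). corr m s j x < corr m s k x}"
    by (auto simp: wins_def)
  also have "\<dots> \<in> sets (gauss J)"
    by (rule sets.sets_Collect_finite_Ex[OF sets_corr(2) f])
  finally show "wins s m \<in> sets (gauss J)" .
qed

text \<open>Each machine has its own level \<open>\<rho>m\<close>, given by its largest remaining
  coefficient and never below \<rho>. The winning tail and \<open>high_snr\<close> are monotone in
  the level, so the common \<rho> serves all machines.\<close>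

lemma vote_bounds:
  assumes m: "m < M" and s: "s \<subset> S"
    and ld: "large_dim K \<mu> \<epsilon> \<eta> d" and slack: "slack \<mu> \<epsilon> \<eta>"
    and \<epsilon>: "sqrt (\<mu> + delta K \<mu>) / (1 + sqrt (\<mu> + delta K \<mu>)) < \<epsilon>" "\<epsilon> < 1"
    and \<theta>min: "0 < \<theta>min" "\<And>k. k \<in> S \<Longrightarrow> \<theta>min \<le> norm2 (col (X m) k) * \<bar>\<theta> $ k\<bar>"
    and \<rho>: "\<rho> = \<theta>min / theta_crit d K \<mu> \<sigma>" "high_snr d K \<mu> \<epsilon> \<rho>"
  shows "2 / 5 * normal_tail ((1 - \<rho>) * sqrt (2 * ln (real d)) / (sqrt (1 - delta K \<mu>) * (1 - \<mu>))) \<le> measure (gauss J) (wins s m)"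
    and "\<And>j. j < d \<Longrightarrow> j \<notin> S - s \<Longrightarrow> measure (gauss J) (ties s j m) \<le> measure (gauss J) (wins s m) / (16 * real K)"
proof -
  interpret O: omp_machine n d S s K \<mu> "unit_col (X m)" "coef m s" "perp m s" "\<lambda>l. norm2 (col (X m) l) * \<theta> $ l" \<sigma>
    by (rule machine[OF m s])
  interpret Mx: omp_matrix "X m" n d by (rule matrix[OF m])
  interpret G: prob_space "gauss J" by (rule prob_space_gauss)
  define L where "L = noise_max d"
  define D where "D = 1 - (2 * real K - 1) * \<mu>"
  have L: "0 < L" using ld by (simp add: L_def noise_max_def large_dim_def)
  have D: "0 < D" using O.mu' by (simp add: D_def)
  define \<rho>m where "\<rho>m = O.T * D / (\<sigma> * L)"
  have "\<theta>min \<le> O.T"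
  proof -
    have "\<theta>min \<le> norm2 (col (X m) O.lead) * \<bar>\<theta> $ O.lead\<bar>" using O.lead by (intro \<theta>min) auto
    also have "\<dots> = \<bar>norm2 (col (X m) O.lead) * \<theta> $ O.lead\<bar>"
      using Mx.nrm_pos[OF O.lead(3)] by (simp add: abs_mult)
    finally show ?thesis using O.lead(2) by simp
  qed
  then have "\<theta>min * D / (\<sigma> * L) \<le> \<rho>m"
    unfolding \<rho>m_def using D theta(4) L by (intro divide_right_mono mult_right_mono) auto
  moreover have "\<rho> = \<theta>min * D / (\<sigma> * L)"
    unfolding \<rho>(1) theta_crit_def D_def L_def noise_max_def by simp
  ultimately have le: "\<rho> \<le> \<rho>m" by simp
  have TL: "O.T * (1 - (2 * real K - 1) * \<mu>) = \<rho>m * \<sigma> * noise_max d"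
    using L theta(4) by (simp add: \<rho>m_def D_def L_def)
  define F where "F = \<P>(\<xi> in gauss J. \<forall>j<d. j \<notin> S - s \<longrightarrow> O.stat j \<xi> < O.stat O.lead \<xi>)"
  have F: "F \<le> measure (gauss J) (wins s m)"
    unfolding F_def
  proof (rule G.finite_measure_mono[OF _ sets_wins_ties(1)])
    show "{\<xi> \<in> space (gauss J). \<forall>j<d. j \<notin> S - s \<longrightarrow> O.stat j \<xi> < O.stat O.lead \<xi>} \<subseteq> wins s m"
      unfolding wins_def using O.lead corr_eq_stat[OF m s] by (auto intro!: bexI[of _ O.lead])
  qed
  note vp = O.vote_probabilities[OF ld slack \<epsilon> TL high_snr_mono[OF \<rho>(2) le], folded F_def]
  have "normal_tail ((1 - \<rho>) * sqrt (2 * ln (real d)) / (sqrt (1 - delta K \<mu>) * (1 - \<mu>))) \<le> normal_tail ((1 - \<rho>m) * noise_max d / O.\<kappa>)"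
    unfolding noise_max_def[symmetric] O.\<kappa>_def[symmetric] using le L O.delta_small
    by (intro normal_tail_antimono divide_right_mono mult_right_mono) (auto simp: L_def)
  then show "2 / 5 * normal_tail ((1 - \<rho>) * sqrt (2 * ln (real d)) / (sqrt (1 - delta K \<mu>) * (1 - \<mu>))) \<le> measure (gauss J) (wins s m)"
    using vp(1) F by linarith
  fix j assume j: "j < d" "j \<notin> S - s"
  have "ties s j m = {\<xi> \<in> space (gauss J). \<forall>i<d. O.stat i \<xi> \<le> O.stat j \<xi>}"
    unfolding ties_def using corr_eq_stat[OF m s] j by auto
  then have "measure (gauss J) (ties s j m) \<le> F / (16 * real K)" using vp(2)[OF j] by simp
  also have "\<dots> \<le> measure (gauss J) (wins s m) / (16 * real K)" using F by (intro divide_right_mono) auto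
  finally show "measure (gauss J) (ties s j m) \<le> measure (gauss J) (wins s m) / (16 * real K)" .
qed

text \<open>An event for fixed \<open>s\<close>, so that the contributions of the machines to both
  counts are independent; it does not refer to the set that a run actually reaches.\<close>

definition bad :: "nat set \<Rightarrow> nat \<Rightarrow> (nat \<Rightarrow> nat \<Rightarrow> real) set" where
  "bad s j = {\<xi> \<in> space N. card {m. m < M \<and> \<xi> m \<in> wins s m} \<le> K * card {m. m < M \<and> \<xi> m \<in> ties s j m}}"

lemma sets_bad: "bad s j \<in> sets N"
proof -
  have m: "(\<lambda>\<xi>. \<Sum>m<M. indicator (A m) (\<xi> m) :: real) \<in> borel_measurable N" if "\<And>m. A m \<in> sets (gauss J)" for A
    by (intro borel_measurable_sum measurable_compose[OF component_measurable borel_measurable_indicator] that) simp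
  have "bad s j = {\<xi> \<in> space N. (\<Sum>m<M. indicator (wins s m) (\<xi> m) :: real) \<le> real K * (\<Sum>m<M. indicator (ties s j m) (\<xi> m))}"
    unfolding bad_def card_eq_sum_indicator[symmetric] by (simp flip: of_nat_mult)
  also have "\<dots> \<in> sets N"
    by (intro borel_measurable_le borel_measurable_times borel_measurable_const m sets_wins_ties)
  finally show ?thesis .
qed

lemma recovers_unless_bad:
  assumes \<xi>: "\<xi> \<in> space N" and good: "\<And>s j. s \<subset> S \<Longrightarrow> j < d \<Longrightarrow> j \<notin> S - s \<Longrightarrow> \<xi> \<notin> bad s j"
  shows "recovers_support M d K X (Y \<xi>) \<theta>"
proof -
  have sp: "\<xi> m \<in> space (gauss J)" if "m < M" for m
    using measurable_space[OF component_measurable[OF that] \<xi>] .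
  have finS: "finite S" using theta finite_subset by blast
  have run: "R = S" if "dj_omp M d X (Y \<xi>) K R" for R
  proof -
    have "R \<subseteq> S \<and> card R = K"
    proof (rule dj_omp_recovers[OF theta(2,3), where win = "\<lambda>s m. \<xi> m \<in> wins s m" and tie = "\<lambda>s m j. \<xi> m \<in> ties s j m"])
      fix s m c assume h: "s \<subset> S" "m < M" "omp_step (X m) (Y \<xi> m) s c"
      have sd: "s \<subseteq> {..<d}" using h(1) theta(2) by auto
      have c: "c < d" "\<And>i. i < d \<Longrightarrow> corr m s i (\<xi> m) \<le> corr m s c (\<xi> m)"
        using h(3) omp_step_iff_corr[OF h(2) sd] by auto
      then show "\<xi> m \<in> ties s c m" using sp[OF h(2)] by (simp add: ties_def)
      assume "\<xi> m \<in> wins s m"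
      then obtain k where k: "k \<in> S - s" "\<And>j. j < d \<Longrightarrow> j \<notin> S - s \<Longrightarrow> corr m s j (\<xi> m) < corr m s k (\<xi> m)"
        by (auto simp: wins_def)
      have "k < d" using k(1) theta(2) by auto
      then show "c \<in> S - s" using k(2)[OF c(1)] c(2)[of k] by fastforce
    next
      fix s j assume "s \<subset> S" "j < d" "j \<notin> S - s"
      from good[OF this] show "K * card {m. m < M \<and> \<xi> m \<in> ties s j m} < card {m. m < M \<and> \<xi> m \<in> wins s m}"
        using \<xi> by (simp add: bad_def)
    qed (use that in auto)
    then show ?thesis using finS theta(3) by (simp add: card_subset_eq)
  qed
  have "0 < d" using theta(2,3) K1 by (cases d) auto
  moreover have "\<exists>j. omp_step (X m) (Y \<xi> m) R j" if "m < M" "R \<subseteq> {..<d}" for m R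
    using ex_is_arg_max[OF \<open>0 < d\<close>, of "\<lambda>j. corr m R j (\<xi> m)"]
    unfolding omp_step_iff_corr[OF that] is_arg_max_def by (meson not_less)
  ultimately obtain R where "dj_omp M d X (Y \<xi>) K R"
    using ex_dj_omp[of d M X "Y \<xi>" K] by blast
  then show ?thesis using run unfolding recovers_support_def by blast
qed

lemma recovery_probability:
  assumes bad: "\<And>s j. s \<subset> S \<Longrightarrow> j < d \<Longrightarrow> j \<notin> S - s \<Longrightarrow> measure N (bad s j) \<le> e" and e: "0 \<le> e"
  shows "1 - 2 ^ K * real d * e \<le> \<P>(\<xi> in N. recovers_support M d K X (Y \<xi>) \<theta>)"
proof -
  interpret N: prob_space N
    unfolding noise_law_def std_gaussian_eq by (intro prob_space_PiM prob_space_gauss)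
  let ?rec = "\<lambda>\<xi>. recovers_support M d K X (Y \<xi>) \<theta>"
  define I where "I = {(s, j). s \<subset> S \<and> j < d \<and> j \<notin> S - s}"
  have finS: "finite S" using theta finite_subset by blast
  have sub: "I \<subseteq> Pow S \<times> {..<d}" unfolding I_def by auto
  have finP: "finite (Pow S \<times> {..<d})" using finS by simp
  have finI: "finite I" using sub finP finite_subset by blast
  have "card I \<le> card (Pow S \<times> {..<d})" by (rule card_mono[OF finP sub])
  also have "\<dots> = 2 ^ K * d" using finS theta(3) by (simp add: card_cartesian_product card_Pow)
  finally have "real (card I) \<le> real (2 ^ K * d)" by (simp only: of_nat_le_iff)
  then have card: "real (card I) \<le> 2 ^ K * real d" by simp
  have "1 - \<P>(\<xi> in N. ?rec \<xi>) = \<P>(\<xi> in N. \<not> ?rec \<xi>)"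
    by (rule N.prob_neg[symmetric]) (use pred_recovers[unfolded pred_def] in assumption)
  also have "\<dots> \<le> measure N (\<Union>p\<in>I. bad (fst p) (snd p))"
  proof (rule N.finite_measure_mono)
    show "{\<xi> \<in> space N. \<not> ?rec \<xi>} \<subseteq> (\<Union>p\<in>I. bad (fst p) (snd p))"
    proof (rule subsetI)
      fix \<xi> assume h: "\<xi> \<in> {\<xi> \<in> space N. \<not> ?rec \<xi>}"
      then obtain s j where "s \<subset> S" "j < d" "j \<notin> S - s" "\<xi> \<in> bad s j"
        using recovers_unless_bad[of \<xi>] by blast
      then show "\<xi> \<in> (\<Union>p\<in>I. bad (fst p) (snd p))" by (intro UN_I[of "(s, j)"]) (auto simp: I_def)
    qed
    show "(\<Union>p\<in>I. bad (fst p) (snd p)) \<in> sets N" using finI sets_bad by auto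
  qed
  also have "\<dots> \<le> (\<Sum>p\<in>I. measure N (bad (fst p) (snd p)))"
    by (rule measure_UNION_le) (use finI sets_bad in auto)
  also have "\<dots> \<le> (\<Sum>p\<in>I. e)" by (rule sum_mono, rule bad) (auto simp: I_def)
  also have "\<dots> \<le> 2 ^ K * real d * e" using card e by (simp add: mult_right_mono)
  finally show ?thesis by simp
qed

end

theorem theorem4p1:
  fixes K :: nat and \<mu> \<epsilon> :: real
  assumes "1 \<le> K"
    and "0 \<le> \<mu>" and "\<mu> < 1 / (2 * real K - 1)"
    and "sqrt (\<mu> + delta K \<mu>) / (1 + sqrt (\<mu> + delta K \<mu>)) < \<epsilon>" and "\<epsilon> < 1"
  shows "\<exists>d\<^sub>0 :: nat. \<forall>d \<ge> d\<^sub>0.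
    \<forall>(M :: nat) (n :: nat) (X :: nat \<Rightarrow> real mat) (\<theta> :: real vec) (\<sigma> :: real) (\<theta>min :: real) (r :: real).
      sparse_regression_model M n d K X \<theta> \<sigma> \<and>
      max_coherence M X = \<mu> \<and>
      0 < \<theta>min \<and>
      (\<forall>k \<in> support \<theta>. (MIN m \<in> {..<M}. norm2 (col (X m) k) * \<bar>\<theta> $ k\<bar>) \<ge> \<theta>min) \<and>
      r = (\<theta>min / theta_crit d K \<mu> \<sigma>)\<^sup>2 \<and>
      int M \<ge> int K * \<lceil>16 * ln (real d) /
        normal_tail ((1 - sqrt r) * sqrt (2 * ln (real d)) / (sqrt (1 - delta K \<mu>) * (1 - \<mu>)))\<rceil> \<and>
      (if (4 * real K - 1) * \<mu> - 2 * real K * \<mu>\<^sup>2 \<ge> 1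
       then sqrt r \<ge> Q2 d K \<mu>
       else sqrt r \<ge> min (Q1 d K \<mu> \<epsilon>) (Q2 d K \<mu>))
      \<longrightarrow>
      \<P>(\<xi> in noise_law M n. recovers_support M d K X (response X \<theta> \<sigma> \<xi>) \<theta>)
        \<ge> 1 - 2 ^ (K + 1) / real d"
proof -
  have \<mu>1: "\<mu> < 1" "(2 * real K - 1) * \<mu> < 1" using coherence_condition[OF assms(1-3)] by auto
  have "0 \<le> delta K \<mu>" unfolding delta_eq_delta_at
    using delta_at_mono(2)[of "real K - 1" "real K" \<mu>] \<mu>1 assms by auto
  then obtain \<eta> where slack: "slack \<mu> \<epsilon> \<eta>"
    using ex_slack[OF assms(2) \<mu>1(1) _ assms(4,5)] by blast
  \<comment> \<open>\<eta> was chosen from \<open>K\<close>, \<mu> and \<epsilon> alone, so the same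
    is true of this threshold.\<close>
  obtain d\<^sub>0 where d\<^sub>0: "\<And>d. d \<ge> d\<^sub>0 \<Longrightarrow> large_dim K \<mu> \<epsilon> \<eta> d"
    using eventually_large_dim[OF assms(1-3,5) slack] unfolding eventually_sequentially by blast
  show ?thesis
  proof (intro exI[of _ d\<^sub>0] allI impI; elim conjE)
    fix d M n :: nat and X :: "nat \<Rightarrow> real mat" and \<theta> :: "real vec" and \<sigma> \<theta>min r :: real
    assume "d\<^sub>0 \<le> d" and model: "sparse_regression_model M n d K X \<theta> \<sigma>" "max_coherence M X = \<mu>"
      and \<theta>min: "0 < \<theta>min" "\<forall>k\<in>support \<theta>. \<theta>min \<le> (MIN m\<in>{..<M}. norm2 (col (X m) k) * \<bar>\<theta> $ k\<bar>)"
      and r: "r = (\<theta>min / theta_crit d K \<mu> \<sigma>)\<^sup>2"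
      and M: "int K * \<lceil>16 * ln (real d) / normal_tail ((1 - sqrt r) * sqrt (2 * ln (real d)) / (sqrt (1 - delta K \<mu>) * (1 - \<mu>)))\<rceil> \<le> int M"
      and cond: "if 1 \<le> (4 * real K - 1) * \<mu> - 2 * real K * \<mu>\<^sup>2 then Q2 d K \<mu> \<le> sqrt r else min (Q1 d K \<mu> \<epsilon>) (Q2 d K \<mu>) \<le> sqrt r"
    interpret regression M n d K X \<theta> \<sigma> \<mu> using model assms by unfold_locales auto
    have ld: "large_dim K \<mu> \<epsilon> \<eta> d" by (rule d\<^sub>0) fact
    have d2: "2 \<le> d" using ld by (simp add: large_dim_def)
    have lnd: "0 < ln (real d)" using d2 by simp
    have "0 < theta_crit d K \<mu> \<sigma>" unfolding theta_crit_def using theta(4) lnd \<mu>1 by simp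
    then have \<rho>: "sqrt r = \<theta>min / theta_crit d K \<mu> \<sigma>" unfolding r using \<theta>min(1) by simp
    define p where "p = normal_tail ((1 - sqrt r) * sqrt (2 * ln (real d)) / (sqrt (1 - delta K \<mu>) * (1 - \<mu>)))"
    have p: "0 < p" unfolding p_def by (rule normal_tail_pos)
    have \<theta>m: "\<theta>min \<le> norm2 (col (X m) k) * \<bar>\<theta> $ k\<bar>" if "m < M" "k \<in> support \<theta>" for m k
    proof -
      have "(MIN m\<in>{..<M}. norm2 (col (X m) k) * \<bar>\<theta> $ k\<bar>) \<le> norm2 (col (X m) k) * \<bar>\<theta> $ k\<bar>"
        using that by (intro Min_le) auto
      then show ?thesis using \<theta>min(2) that by force
    qed
    have Mp: "16 * ln (real d) * real K \<le> real M * p"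
    proof -
      have "real K * (16 * ln (real d) / p) \<le> real K * real_of_int \<lceil>16 * ln (real d) / p\<rceil>"
        by (intro mult_left_mono) auto
      also have "\<dots> \<le> real M" using M unfolding p_def[symmetric] by (metis of_int_le_iff of_int_mult of_int_of_nat_eq)
      finally show ?thesis using p by (simp add: field_simps)
    qed
    \<comment> \<open>After the union over at most \<open>2 ^ K * d\<close> pairs this leaves
      \<open>2 ^ K / d\<close>.\<close>
    have "measure N (bad s j) \<le> 1 / (real d)\<^sup>2" if s: "s \<subset> support \<theta>" and j: "j < d" "j \<notin> support \<theta> - s" for s j
    proof -
      note vb = vote_bounds[OF _ s ld slack assms(4,5) \<theta>min(1) \<theta>m \<rho> cond[folded high_snr_def], folded p_def]
      have "measure N (bad s j) \<le> exp (- (\<Sum>m<M. 3 / 8 * measure (gauss J) (wins s m) / real K))"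
        unfolding bad_def noise_law_def std_gaussian_eq
        by (rule vote_comparison) (use assms(1) sets_wins_ties vb(2) j prob_space_gauss in auto)
      also have "\<dots> \<le> exp (- (2 * ln (real d)))"
      proof -
        \<comment> \<open>Each machine contributes \<open>3 / 8 * (2 / 5) = 3 / 20\<close> times
          \<open>p / K\<close> to the exponent; with \<open>M * p \<ge> 16 * K * ln d\<close> the
          total is at least \<open>2.4 * ln d\<close>.\<close>
        have "2 * ln (real d) \<le> (3 / 20 * 16) * ln (real d)" using lnd by simp
        also have "\<dots> \<le> 3 / 20 * (real M * p) / real K" using Mp assms(1) by (simp add: le_divide_eq ac_simps)
        also have "\<dots> = (\<Sum>m<M. 3 / 8 * (2 / 5 * p) / real K)" by simp
        also have "\<dots> \<le> (\<Sum>m<M. 3 / 8 * measure (gauss J) (wins s m) / real K)"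
          using vb(1) by (intro sum_mono divide_right_mono mult_left_mono) auto
        finally show ?thesis by simp
      qed
      also have "\<dots> = 1 / (real d)\<^sup>2"
        using d2 by (simp add: exp_minus inverse_eq_divide exp_double[symmetric] exp_of_nat_mult[of 2, simplified])
      finally show ?thesis .
    qed
    then have "1 - 2 ^ K * real d * (1 / (real d)\<^sup>2) \<le> \<P>(\<xi> in N. recovers_support M d K X (response X \<theta> \<sigma> \<xi>) \<theta>)"
      by (intro recovery_probability) auto
    moreover have "2 ^ K * real d * (1 / (real d)\<^sup>2) \<le> 2 ^ (K + 1) / real d"
      using d2 by (simp add: power2_eq_square divide_right_mono)
    ultimately show "1 - 2 ^ (K + 1) / real d \<le> \<P>(\<xi> in noise_law M n. recovers_support M d K X (response X \<theta> \<sigma> \<xi>) \<theta>)"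
      by linarith
  qed
qed

end
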